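(* Two linear differential equations $\delta_\nu^2 y-p(x)\delta_\nu y-q(x)y=0$ with either a regular singularity or a non-degenerate irregular singularity at the origin are analytically, resp. formally, equivalent if and only if their companion systems $\delta_\nu v=\left(\begin{smallmatrix} 0 & 1 \\ q(x) & p(x) \end{smallmatrix}\right)v$, $v=(y,\delta_\nu y)^{T}$, are analytically, resp. formally, equivalent.
   Context: Consider a second order linear differential equation $\frac{d^2y}{dx^2}+a_1(x)\frac{dy}{dx}+a_0(x)y=0$ near $x=0\in\mathbb{C}$ with meromorphic coefficients, at least one having a pole at $0$ of order $m_i$. Its Poincaré rank is $\nu=\max\{m_1-1,\lceil m_0/2\rceil-1\}\geq 0$, and with $\delta_\nu:=x^{\nu+1}\frac{\partial}{\partial x}$ the equation is rewritten as $\delta_\nu^2 y-p(x)\delta_\nu y-q(x)y=0$ with $p(x)=-x^{\nu+1}a_1(x)+(\nu+1)x^\nu$, $q(x)=-x^{2\nu+2}a_0(x)$ analytic at $0$. Let $\Delta:=p^2+4q-2\delta_\nu p$. The singularity is regular if $\nu=0$; it is irregular if $\nu>0$, and a non-degenerate irregular singularity means $\nu>0$ and either $\Delta(0)\neq0$, or $\Delta(0)=0$ and $p(0)=0$ (then $\frac{d\Delta}{dx}(0)\neq0$). Equations are compared by linear point transformations $\tilde x=\phi(x)$, $\tilde y=t(x)y$ with $\phi$ an analytic diffeomorphism fixing $0$ and $t$ a non-vanishing analytic function (analytic equivalence); systems are compared by gauge transformations $\tilde x=\phi(x)$, $\tilde v=T(x)v$ with $T$ analytic and analytically invertible. Formal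 equivalence means that $\phi(x)$ and $t(x)$, resp. $T(x)$, are formal power series in $x$. *)

theory Defs
  imports "HOL-Analysis.Analysis" "HOL-Computational_Algebra.Formal_Laurent_Series"
begin

text \<open>
  Conventions.  Germs of analytic functions at 0 are represented by their Taylor series,
  i.e. by convergent formal power series (fps with positive radius of convergence);
  meromorphic germs at 0 are formal Laurent series.  An equation
  delta_nu^2 y - p delta_nu y - q y = 0 (delta_nu = x^(nu+1) d/dx) is given by the
  triple (nu, p, q).  Written in the monic form y'' + a1 y' + a0 y = 0 its coefficients are
  a1 = ((nu+1) x^nu - p) / x^(nu+1) and a0 = - q / x^(2 nu + 2).
\<close>

definition eq_a1 :: "nat \<Rightarrow> complex fps \<Rightarrow> complex fls" where
  "eq_a1 \<nu> p = fps_to_fls (of_nat (Suc \<nu>) * fps_X ^ \<nu> - p) * fls_X powi (- int (Suc \<nu>))"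

definition eq_a0 :: "nat \<Rightarrow> complex fps \<Rightarrow> complex fls" where
  "eq_a0 \<nu> q = - fps_to_fls q * fls_X powi (- (2 * int (Suc \<nu>)))"

definition pole_order :: "complex fls \<Rightarrow> int" where
  "pole_order f = - fls_subdegree f"

definition has_pole_coeff :: "complex fls \<Rightarrow> complex fls \<Rightarrow> bool" where
  "has_pole_coeff a1 a0 \<longleftrightarrow> pole_order a1 > 0 \<or> pole_order a0 > 0"

definition poincare_rank :: "complex fls \<Rightarrow> complex fls \<Rightarrow> int" where
  "poincare_rank a1 a0 =
     max (pole_order a1 - 1) (\<lceil>real_of_int (pole_order a0) / 2\<rceil> - 1)"

definition is_rank_form :: "nat \<Rightarrow> complex fps \<Rightarrow> complex fps \<Rightarrow> bool" where
  "is_rank_form \<nu> p q \<longleftrightarrow>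
     fps_conv_radius p > 0 \<and> fps_conv_radius q > 0 \<and>
     has_pole_coeff (eq_a1 \<nu> p) (eq_a0 \<nu> q) \<and>
     int \<nu> = poincare_rank (eq_a1 \<nu> p) (eq_a0 \<nu> q)"

definition delta_op :: "nat \<Rightarrow> complex fps \<Rightarrow> complex fps" where
  "delta_op \<nu> f = fps_X ^ Suc \<nu> * fps_deriv f"

definition Delta :: "nat \<Rightarrow> complex fps \<Rightarrow> complex fps \<Rightarrow> complex fps" where
  "Delta \<nu> p q = p\<^sup>2 + 4 * q - 2 * delta_op \<nu> p"

definition regular_sing :: "nat \<Rightarrow> bool" where
  "regular_sing \<nu> \<longleftrightarrow> \<nu> = 0"

definition nondeg_irregular_sing :: "nat \<Rightarrow> complex fps \<Rightarrow> complex fps \<Rightarrow> bool" where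
  "nondeg_irregular_sing \<nu> p q \<longleftrightarrow> \<nu> > 0 \<and>
     (Delta \<nu> p q $ 0 \<noteq> 0 \<or> (Delta \<nu> p q $ 0 = 0 \<and> p $ 0 = 0))"

text \<open>Point transformation  x~ = phi(x),  y~ = t(x) y  (so y = s (y~ o phi), s = 1/t).
  Substituting into y'' + a1 y' + a0 y = 0 gives
  s phi'^2 (y~'' o phi) + (2 s' phi' + s phi'' + a1 s phi') (y~' o phi)
     + (s'' + a1 s' + a0 s) (y~ o phi) = 0,
  and the equation is transformed into y~'' + b1 y~' + b0 y~ = 0 iff
  (b1 o phi) s phi'^2 = 2 s' phi' + s phi'' + a1 s phi'  and
  (b0 o phi) s phi'^2 = s'' + a1 s' + a0 s.\<close>
definition eq_transforms ::
  "complex fls \<Rightarrow> complex fls \<Rightarrow> complex fls \<Rightarrow> complex fls \<Rightarrow> complex fps \<Rightarrow> complex fps \<Rightarrow> bool" where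
  "eq_transforms a1 a0 b1 b0 \<phi> t \<longleftrightarrow>
     (let s = inverse t;
          S = fps_to_fls s; S' = fps_to_fls (fps_deriv s); S'' = fps_to_fls (fps_deriv (fps_deriv s));
          P' = fps_to_fls (fps_deriv \<phi>); P'' = fps_to_fls (fps_deriv (fps_deriv \<phi>))
      in fls_compose_fps b1 \<phi> * S * P'\<^sup>2 = 2 * S' * P' + S * P'' + a1 * S * P' \<and>
         fls_compose_fps b0 \<phi> * S * P'\<^sup>2 = S'' + a1 * S' + a0 * S)"

definition formal_point_transf :: "complex fps \<Rightarrow> complex fps \<Rightarrow> bool" where
  "formal_point_transf \<phi> t \<longleftrightarrow> \<phi> $ 0 = 0 \<and> \<phi> $ 1 \<noteq> 0 \<and> t $ 0 \<noteq> 0"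

definition analytic_point_transf :: "complex fps \<Rightarrow> complex fps \<Rightarrow> bool" where
  "analytic_point_transf \<phi> t \<longleftrightarrow> formal_point_transf \<phi> t \<and>
     fps_conv_radius \<phi> > 0 \<and> fps_conv_radius t > 0"

definition eq_formally_equiv ::
  "nat \<Rightarrow> complex fps \<Rightarrow> complex fps \<Rightarrow> nat \<Rightarrow> complex fps \<Rightarrow> complex fps \<Rightarrow> bool" where
  "eq_formally_equiv \<nu> p q \<mu> p' q' \<longleftrightarrow>
     (\<exists>\<phi> t. formal_point_transf \<phi> t \<and>
        eq_transforms (eq_a1 \<nu> p) (eq_a0 \<nu> q) (eq_a1 \<mu> p') (eq_a0 \<mu> q') \<phi> t)"

definition eq_analytically_equiv ::
  "nat \<Rightarrow> complex fps \<Rightarrow> complex fps \<Rightarrow> nat \<Rightarrow> complex fps \<Rightarrow> complex fps \<Rightarrow> bool" where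
  "eq_analytically_equiv \<nu> p q \<mu> p' q' \<longleftrightarrow>
     (\<exists>\<phi> t. analytic_point_transf \<phi> t \<and>
        eq_transforms (eq_a1 \<nu> p) (eq_a0 \<nu> q) (eq_a1 \<mu> p') (eq_a0 \<mu> q') \<phi> t)"

text \<open>Companion system  delta_nu v = A v,  A = [[0,1],[q,p]],  i.e.  v' = B v  with
  B = x^(-nu-1) A (a meromorphic 2x2 matrix).\<close>
definition companion :: "complex fps \<Rightarrow> complex fps \<Rightarrow> complex fps ^ 2 ^ 2" where
  "companion p q = vector [vector [0, 1], vector [q, p]]"

definition sys_B :: "nat \<Rightarrow> complex fps ^ 2 ^ 2 \<Rightarrow> complex fls ^ 2 ^ 2" where
  "sys_B \<nu> A = (\<chi> i j. fps_to_fls (A $ i $ j) * fls_X powi (- int (Suc \<nu>)))"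

definition mat_to_fls :: "complex fps ^ 2 ^ 2 \<Rightarrow> complex fls ^ 2 ^ 2" where
  "mat_to_fls T = (\<chi> i j. fps_to_fls (T $ i $ j))"

text \<open>Gauge transformation  x~ = phi(x),  v~ = T(x) v  transforms v' = B v into
  v~' = C v~  iff  phi' (C o phi) T = T B + T'.\<close>
definition sys_transforms ::
  "complex fls ^ 2 ^ 2 \<Rightarrow> complex fls ^ 2 ^ 2 \<Rightarrow> complex fps \<Rightarrow> complex fps ^ 2 ^ 2 \<Rightarrow> bool" where
  "sys_transforms B C \<phi> T \<longleftrightarrow>
     (\<chi> i j. fps_to_fls (fps_deriv \<phi>) * fls_compose_fps (C $ i $ j) \<phi>) ** mat_to_fls T =
     mat_to_fls T ** B + mat_to_fls (\<chi> i j. fps_deriv (T $ i $ j))"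

definition formal_gauge :: "complex fps \<Rightarrow> complex fps ^ 2 ^ 2 \<Rightarrow> bool" where
  "formal_gauge \<phi> T \<longleftrightarrow> \<phi> $ 0 = 0 \<and> \<phi> $ 1 \<noteq> 0 \<and>
     (\<exists>U. T ** U = mat 1 \<and> U ** T = mat 1)"

definition analytic_gauge :: "complex fps \<Rightarrow> complex fps ^ 2 ^ 2 \<Rightarrow> bool" where
  "analytic_gauge \<phi> T \<longleftrightarrow> \<phi> $ 0 = 0 \<and> \<phi> $ 1 \<noteq> 0 \<and> fps_conv_radius \<phi> > 0 \<and>
     (\<forall>i j. fps_conv_radius (T $ i $ j) > 0) \<and>
     (\<exists>U. T ** U = mat 1 \<and> U ** T = mat 1 \<and> (\<forall>i j. fps_conv_radius (U $ i $ j) > 0))"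

definition sys_formally_equiv :: "nat \<Rightarrow> complex fps ^ 2 ^ 2 \<Rightarrow> nat \<Rightarrow> complex fps ^ 2 ^ 2 \<Rightarrow> bool" where
  "sys_formally_equiv \<nu> A \<mu> A' \<longleftrightarrow>
     (\<exists>\<phi> T. formal_gauge \<phi> T \<and> sys_transforms (sys_B \<nu> A) (sys_B \<mu> A') \<phi> T)"

definition sys_analytically_equiv :: "nat \<Rightarrow> complex fps ^ 2 ^ 2 \<Rightarrow> nat \<Rightarrow> complex fps ^ 2 ^ 2 \<Rightarrow> bool" where
  "sys_analytically_equiv \<nu> A \<mu> A' \<longleftrightarrow>
     (\<exists>\<phi> T. analytic_gauge \<phi> T \<and> sys_transforms (sys_B \<nu> A) (sys_B \<mu> A') \<phi> T)"

end

theory Submission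
  imports Defs "HOL-Complex_Analysis.Laurent_Convergence"
begin

text \<open>
  Pulling back the second equation along \<open>\<phi>\<close> reduces an equivalence of companion systems to a gauge
  transformation over the identity, whose first row reads $\tilde y = a y + b \delta y$. Along the foliation of
  projectivized solutions such a combination is a point transformation: there are double series
  $\Psi(x, w)$ and $T(x, w)$ with $y + w \delta y = T(x, w)\, y(\Psi(x, w))$ for all solutions $y$ at once. Applying
  $L = \delta - (1 + p w - q w^2) \partial_w$, which annihilates $\Psi$ and multiplies both $y + w \delta y$ and $T$ by
  $q w$, one obtains linear recursions for $\Psi$ and $T$ and a radius of convergence in $w$ that depends
  only on $p(0)$ and $q(0)$. Substituting the series $w = b / a$ gives the point transformation when
  $b(0) / a(0)$ is small; formally this only needs convergence of each coefficient. At $x = 0$ the gauge matrix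
  commutes with the companion matrix $A(0)$, so up to a scalar it is a product of $n$ equal factors
  $1 + w A(0)$ with $w$ small, and the general case follows in finitely many steps.
\<close>

text \<open>A gauge transformation mixes y and \<delta>y, a point transformation only rescales y and
  moves x. If f is the ratio of two independent solutions y1, y2, then (y1 + w \<delta>y1) / (y2 + w
  \<delta>y2) should be f(\<Psi>(x, w)), and T is read off from one solution. At an irregular
  singularity solutions are not power series in general, so none occurs in the proof: that T
  y(\<Psi>) is affine in w becomes two identities between double series
  (\<open>deriv_deriv_sol\<close>), proved by uniqueness for L. Since b(0) / a(0) need not vanish, w
  = b / a cannot be substituted by formal composition, and convergence in w matters even for formal
  equivalence. The recursion differentiates in x at each step; its denominators n + 1 and the
  majorants (1 - R x)^(-n-1) absorb this loss. The growth rate in n depends only on the values of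
  the data at 0, because higher coefficients merely enlarge R. As gauge transformations over the
  identity preserve p(0) and q(0), one radius serves all factors of a splitting.\<close>

unbundle no vec_syntax

section \<open>The derivation \<delta> = x^(\<nu>+1) d/dx on power series\<close>

lemma delta_op_0 [simp]: "delta_op \<nu> 0 = 0"
  and delta_op_1 [simp]: "delta_op \<nu> 1 = 0"
  and delta_op_fps_const [simp]: "delta_op \<nu> (fps_const c) = 0"
  and delta_op_fps_X [simp]: "delta_op \<nu> fps_X = fps_X ^ Suc \<nu>"
  and delta_op_add: "delta_op \<nu> (f + g) = delta_op \<nu> f + delta_op \<nu> g"
  and delta_op_diff: "delta_op \<nu> (f - g) = delta_op \<nu> f - delta_op \<nu> g"
  and delta_op_uminus: "delta_op \<nu> (- f) = - delta_op \<nu> f"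
  and delta_op_mult: "delta_op \<nu> (f * g) = delta_op \<nu> f * g + f * delta_op \<nu> g"
  by (simp_all add: delta_op_def algebra_simps)

lemma delta_op_nth:
  "delta_op \<nu> f $ j = (if j \<le> \<nu> then 0 else of_nat (j - \<nu>) * f $ (j - \<nu>))"
proof (cases "j \<le> \<nu>")
  case False
  then obtain i where "j = Suc \<nu> + i"
    by (metis add.commute le_Suc_ex not_less_eq_eq)
  then show ?thesis by (simp add: delta_op_def fps_X_power_mult_nth del: power_Suc)
qed (simp add: delta_op_def fps_X_power_mult_nth del: power_Suc)

lemma delta_op_nth_0 [simp]: "delta_op \<nu> f $ 0 = 0"
  by (simp add: delta_op_nth)

section \<open>A linear partial differential equation for double power series\<close>

text \<open>A double series in $x$ and $w$ is a power series in $w$ whose coefficients are power series in $x$.\<close>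

definition ddelta :: "nat \<Rightarrow> complex fps fps \<Rightarrow> complex fps fps" where
  "ddelta \<nu> F = Abs_fps (\<lambda>n. delta_op \<nu> (F $ n))"

lemma ddelta_nth [simp]: "ddelta \<nu> F $ n = delta_op \<nu> (F $ n)"
  by (simp add: ddelta_def)

lemma delta_op_sum: "delta_op \<nu> (sum f A) = (\<Sum>i\<in>A. delta_op \<nu> (f i))"
  by (induction A rule: infinite_finite_induct) (simp_all add: delta_op_add)

lemma ddelta_mult: "ddelta \<nu> (F * G) = ddelta \<nu> F * G + F * ddelta \<nu> G"
  by (rule fps_ext) (simp add: fps_mult_nth delta_op_sum delta_op_mult sum.distrib)

lemma ddelta_fps_const [simp]: "ddelta \<nu> (fps_const f) = fps_const (delta_op \<nu> f)"
  and ddelta_fps_X [simp]: "ddelta \<nu> fps_X = 0"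
  and ddelta_1 [simp]: "ddelta \<nu> 1 = 0"
  and ddelta_add: "ddelta \<nu> (F + G) = ddelta \<nu> F + ddelta \<nu> G"
  and ddelta_diff: "ddelta \<nu> (F - G) = ddelta \<nu> F - ddelta \<nu> G"
  and ddelta_uminus: "ddelta \<nu> (- F) = - ddelta \<nu> F"
  by (rule fps_ext; simp add: fps_X_def delta_op_add delta_op_diff delta_op_uminus)+

lemma of_nat_delta_op: "delta_op \<nu> (of_nat n * f) = of_nat n * delta_op \<nu> f"
  by (simp add: delta_op_mult flip: fps_of_nat)

lemma ddelta_fps_deriv: "ddelta \<nu> (fps_deriv F) = fps_deriv (ddelta \<nu> F)"
  by (rule fps_ext) (simp add: of_nat_delta_op del: of_nat_Suc of_nat_add)

text \<open>The coefficient of d/dw in L, up to sign. The Riccati equation for w = - y / \<delta>y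
  is \<delta>w = - (1 + p w - q w^2), so these curves are the characteristics of L.\<close>

definition pde_factor :: "complex fps \<Rightarrow> complex fps \<Rightarrow> complex fps fps" where
  "pde_factor p q = 1 + fps_const p * fps_X - fps_const q * fps_X\<^sup>2"

text \<open>This is L F = c F. The series c acts as a weight: weights add under products
  (\<open>pde_mult\<close>), so that products of known solutions can be compared by
  \<open>pde_unique\<close>.\<close>

definition pde :: "nat \<Rightarrow> complex fps \<Rightarrow> complex fps \<Rightarrow> complex fps fps \<Rightarrow> complex fps fps \<Rightarrow> bool" where
  "pde \<nu> p q c F \<longleftrightarrow> ddelta \<nu> F = pde_factor p q * fps_deriv F + c * F"

lemma pde_mult:
  assumes "pde \<nu> p q c F" "pde \<nu> p q d G"
  shows "pde \<nu> p q (c + d) (F * G)"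
  using assms by (simp add: pde_def ddelta_mult algebra_simps)

lemma pde_add: "pde \<nu> p q c F \<Longrightarrow> pde \<nu> p q c G \<Longrightarrow> pde \<nu> p q c (F + G)"
  by (simp add: pde_def ddelta_add algebra_simps)

lemma pde_uminus: "pde \<nu> p q c F \<Longrightarrow> pde \<nu> p q c (- F)"
  by (simp add: pde_def ddelta_uminus algebra_simps)

lemma pde_fps_const_mult: 
  "pde \<nu> p q c F \<Longrightarrow> delta_op \<nu> f = g * f \<Longrightarrow> pde \<nu> p q (c + fps_const g) (fps_const f * F)"
  by (simp add: pde_def ddelta_mult algebra_simps)

lemma fps_deriv_pde_factor: "fps_deriv (pde_factor p q) = fps_const p - 2 * fps_const q * fps_X"
  by (simp add: pde_factor_def power2_eq_square algebra_simps)

text \<open>L and d/dw do not commute, because the coefficient of d/dw in L depends on w. Its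
  w-derivative is therefore added to the weight.\<close>

lemma pde_deriv_iff:
  assumes "pde \<nu> p q c F"
  shows "ddelta \<nu> (fps_deriv F) =
    pde_factor p q * fps_deriv (fps_deriv F) + (fps_deriv (pde_factor p q) + c) * fps_deriv F + fps_deriv c * F"
  using assms by (simp add: pde_def ddelta_fps_deriv algebra_simps)

lemma of_nat_Suc_mult_eq_0: "of_nat (Suc n) * (f :: complex fps) = 0 \<Longrightarrow> f = 0"
  by (metis mult_eq_0_iff of_nat_eq_0_iff nat.distinct(1))

lemma pde_factor_mult_nth_Suc:
  assumes "\<And>i. i \<le> n \<Longrightarrow> G $ i = 0"
  shows "(pde_factor p q * G) $ Suc n = G $ Suc n"
proof -
  have "(\<Sum>i=0..Suc n. pde_factor p q $ i * G $ (Suc n - i)) = (\<Sum>i\<in>{0}. pde_factor p q $ i * G $ (Suc n - i))"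
    by (rule sum.mono_neutral_right) (auto simp: assms)
  then show ?thesis by (simp add: fps_mult_nth pde_factor_def)
qed

text \<open>Since \<open>pde_factor\<close> is 1 at w = 0, the equation determines the coefficient
  of w^(n+1) from the previous ones. The identities between double series below rest on this: equal
  weight and equal value at w = 0.\<close>

lemma pde_eq_0:
  assumes "pde \<nu> p q c F" "F $ 0 = 0"
  shows "F = 0"
proof -
  have "\<forall>i\<le>n. F $ i = 0" for n
  proof (induction n)
    case 0
    then show ?case using assms by simp
  next
    case (Suc n)
    have d: "fps_deriv F $ i = 0" if "i < n" for i
      using Suc that by simp
    have "(pde_factor p q * fps_deriv F) $ n = fps_deriv F $ n"
    proof (cases n)
      case 0
      then show ?thesis by (simp add: pde_factor_def)
    next
      case (Suc m)
      then show ?thesis using pde_factor_mult_nth_Suc[of m "fps_deriv F"] d by simp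
    qed
    moreover have "(c * F) $ n = 0"
      using Suc by (simp add: fps_mult_nth)
    moreover have "ddelta \<nu> F $ n = 0" using Suc by simp
    moreover have "ddelta \<nu> F $ n = (pde_factor p q * fps_deriv F) $ n + (c * F) $ n"
      using assms(1) by (simp add: pde_def)
    ultimately have "fps_deriv F $ n = 0"
      by simp
    then have "F $ Suc n = 0"
      using of_nat_Suc_mult_eq_0[of n "F $ Suc n"] by simp
    then show ?case using Suc le_Suc_eq by auto
  qed
  then show ?thesis by (metis fps_ext fps_zero_nth order_refl)
qed

lemma pde_unique:
  assumes "pde \<nu> p q c F" "pde \<nu> p q c G" "F $ 0 = G $ 0"
  shows "F = G"
  using pde_eq_0[of \<nu> p q c "F - G"] pde_add[OF assms(1) pde_uminus[OF assms(2)]] assms(3) by simp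

text \<open>The last equation is the coefficient of w^(n+1) in L F = (c0 + c1 w) F, solved for
  F_(n+2). Weights affine in w cover \<Psi>, T and the factor E of the w-derivative of
  \<Psi>.\<close>

fun sol_coeff :: "nat \<Rightarrow> complex fps \<Rightarrow> complex fps \<Rightarrow> complex fps \<Rightarrow> complex fps \<Rightarrow> complex fps \<Rightarrow> nat \<Rightarrow> complex fps"
where
  "sol_coeff \<nu> p q c0 c1 f 0 = f"
| "sol_coeff \<nu> p q c0 c1 f (Suc 0) = delta_op \<nu> f - c0 * f"
| "sol_coeff \<nu> p q c0 c1 f (Suc (Suc n)) = fps_const (1 / of_nat (n + 2)) *
     (delta_op \<nu> (sol_coeff \<nu> p q c0 c1 f (Suc n))
        - of_nat (Suc n) * p * sol_coeff \<nu> p q c0 c1 f (Suc n)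
        + of_nat n * q * sol_coeff \<nu> p q c0 c1 f n
        - c0 * sol_coeff \<nu> p q c0 c1 f (Suc n) - c1 * sol_coeff \<nu> p q c0 c1 f n)"

definition sol :: "nat \<Rightarrow> complex fps \<Rightarrow> complex fps \<Rightarrow> complex fps \<Rightarrow> complex fps \<Rightarrow> complex fps \<Rightarrow> complex fps fps" where
  "sol \<nu> p q c0 c1 f = Abs_fps (sol_coeff \<nu> p q c0 c1 f)"

lemma sol_nth_0 [simp]: "sol \<nu> p q c0 c1 f $ 0 = f"
  by (simp add: sol_def)

lemma pde_sol: "pde \<nu> p q (fps_const c0 + fps_const c1 * fps_X) (sol \<nu> p q c0 c1 f)"
proof -
  define F where "F = sol \<nu> p q c0 c1 f"
  have shift: "(fps_const a * fps_X * G) $ n = (if n = 0 then 0 else a * G $ (n - 1))"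
    "(fps_const a * fps_X\<^sup>2 * G) $ n = (if n < 2 then 0 else a * G $ (n - 2))"
    for a n and G :: "complex fps fps"
    by (simp_all add: mult.assoc fps_X_power_mult_nth)
  have "delta_op \<nu> (F $ n) =
      (pde_factor p q * fps_deriv F + (fps_const c0 + fps_const c1 * fps_X) * F) $ n" for n
  proof (cases n)
    case 0
    then show ?thesis
      by (simp add: pde_factor_def shift ring_distribs F_def sol_def)
  next
    case (Suc m)
    have [simp]: "F $ k = sol_coeff \<nu> p q c0 c1 f k" for k by (simp add: F_def sol_def)
    have c: "of_nat (m + 2) * (fps_const (1 / of_nat (m + 2)) * g) = (g :: complex fps)" for g
    proof -
      have "complex_of_nat (m + 2) \<noteq> 0" by (simp only: of_nat_eq_0_iff)
      then have "of_nat (m + 2) * fps_const (1 / of_nat (m + 2) :: complex) = 1"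
        by (simp del: of_nat_add flip: fps_of_nat fps_const_mult)
      then show ?thesis by (metis mult.assoc mult_1)
    qed
    have "(pde_factor p q * fps_deriv F) $ Suc m = of_nat (m + 2) * F $ Suc (Suc m) + p * (of_nat (Suc m) * F $ Suc m)
            - q * (of_nat m * F $ m)"
      by (cases m) (simp_all add: pde_factor_def ring_distribs shift)
    moreover have "((fps_const c0 + fps_const c1 * fps_X) * F) $ Suc m = c0 * F $ Suc m + c1 * F $ m"
      by (simp add: ring_distribs shift)
    moreover have "of_nat (m + 2) * F $ Suc (Suc m) = delta_op \<nu> (F $ Suc m) - of_nat (Suc m) * p * F $ Suc m
        + of_nat m * q * F $ m - c0 * F $ Suc m - c1 * F $ m"
      unfolding \<open>\<And>k. F $ k = sol_coeff \<nu> p q c0 c1 f k\<close> sol_coeff.simps c ..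
    ultimately show ?thesis
      by (simp only: Suc fps_add_nth) (simp add: algebra_simps)
  qed
  then show ?thesis
    unfolding pde_def F_def[symmetric] by (intro fps_ext) simp
qed

section \<open>Majorants and convergence\<close>

text \<open>binom(n+i, i) R^i is the coefficient of x^i in (1 - R x)^(-n-1), and multiplication by
  the majorant A / (1 - R x) raises the exponent by one. Only coefficients up to k enter, so R may
  depend on k when the series diverge.\<close>

lemma mult_nth_bound:
  fixes a f :: "complex fps"
  assumes "\<And>i. i \<le> k \<Longrightarrow> norm (a $ i) \<le> A * R ^ i"
    and "\<And>i. i \<le> k \<Longrightarrow> norm (f $ i) \<le> M * real ((n + i) choose i) * R ^ i"
    and "j \<le> k" "A \<ge> 0" "R \<ge> 0" "M \<ge> 0"
  shows "norm ((a * f) $ j) \<le> A * M * real ((Suc n + j) choose j) * R ^ j"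
proof -
  have "norm ((a * f) $ j) = norm (\<Sum>i=0..j. f $ i * a $ (j - i))"
    by (subst mult.commute) (simp add: fps_mult_nth)
  also have "\<dots> \<le> (\<Sum>i=0..j. norm (f $ i) * norm (a $ (j - i)))"
    by (rule order.trans[OF norm_sum]) (simp add: norm_mult)
  also have "\<dots> \<le> (\<Sum>i=0..j. (M * real ((n + i) choose i) * R ^ i) * (A * R ^ (j - i)))"
    using assms by (intro sum_mono mult_mono) auto
  also have "\<dots> = (\<Sum>i=0..j. A * M * R ^ j * real ((n + i) choose i))"
    by (rule sum.cong) (auto simp: power_diff_conv_inverse simp flip: power_add)
  also have "\<dots> = A * M * R ^ j * real (\<Sum>i\<le>j. (n + i) choose i)"
    by (simp add: sum_distrib_left atLeast0AtMost)
  finally show ?thesis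
    by (simp only: sum_choose_lower) (simp add: mult_ac)
qed

text \<open>The factor j that \<delta> costs is paid by raising the exponent of the majorant by one,
  up to a factor that the denominator of the recursion cancels.\<close>

lemma choose_Suc_absorb:
  "real (Suc n) * real ((Suc n + j) choose j) = real (Suc n + j) * real ((n + j) choose j)"
proof -
  have "(Suc n + j - j) * ((Suc n + j) choose j) = (Suc n + j) * ((Suc n + j - 1) choose j)"
    by (rule binomial_absorb_comp)
  then show ?thesis by (simp flip: of_nat_mult del: of_nat_Suc)
qed

text \<open>The coefficient of w^n is majorized by C (1 + 6 P)^n (1 - R x)^(-n-1). The growth in n
  involves P and not R; this is the source of a radius in w that ignores higher coefficients. The
  bound 2 P on c0 and c1 leaves room for c1 = - 2 q.\<close>

lemma sol_coeff_bound:
  assumes p: "\<And>i. i \<le> k \<Longrightarrow> norm (p $ i) \<le> P * R ^ i"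
    and q: "\<And>i. i \<le> k \<Longrightarrow> norm (q $ i) \<le> P * R ^ i"
    and c0: "\<And>i. i \<le> k \<Longrightarrow> norm (c0 $ i) \<le> 2 * P * R ^ i"
    and c1: "\<And>i. i \<le> k \<Longrightarrow> norm (c1 $ i) \<le> 2 * P * R ^ i"
    and f: "\<And>i. i \<le> k \<Longrightarrow> norm (f $ i) \<le> C * R ^ i"
    and PR: "P \<ge> 0" "R \<ge> 1" "C \<ge> 0" and "j \<le> k"
  shows "norm (sol_coeff \<nu> p q c0 c1 f n $ j)
          \<le> C * (1 + 6 * P) ^ n * real ((n + j) choose j) * R ^ j"
  using \<open>j \<le> k\<close>
proof (induction n arbitrary: j rule: induct_nat_012)
  case 0
  then show ?case using f by simp
next
  define B where "B = 1 + 6 * P"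
  define s where "s = sol_coeff \<nu> p q c0 c1 f"
  have B: "B \<ge> 1" using PR by (simp add: B_def)
  have delta: "norm (delta_op \<nu> g $ j) \<le> real j * (M * real ((n + j) choose j) * R ^ j)"
    if g: "\<And>i. i \<le> k \<Longrightarrow> norm (g $ i) \<le> M * real ((n + i) choose i) * R ^ i"
      and "j \<le> k" "M \<ge> 0" for g :: "complex fps" and M n j
  proof (cases "j \<le> \<nu>")
    case True
    then show ?thesis using that PR by (simp add: delta_op_nth)
  next
    case False
    have "norm (delta_op \<nu> g $ j) = real (j - \<nu>) * norm (g $ (j - \<nu>))"
      using False by (simp add: delta_op_nth norm_mult del: of_nat_diff)
    also have "\<dots> \<le> real j * (M * real ((n + (j - \<nu>)) choose (j - \<nu>)) * R ^ (j - \<nu>))"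
      using that PR by (intro mult_mono g) auto
    \<comment> \<open>\<delta> also shifts the index down by \<nu>. This only decreases the binomial
      coefficient and, as R \<ge> 1, the power of R.\<close>
    also have "\<dots> \<le> real j * (M * real ((n + j) choose j) * R ^ j)"
    proof -
      have "((n + (j - \<nu>)) choose (j - \<nu>)) \<le> ((n + j) choose j)"
        using binomial_right_mono[of "n + (j - \<nu>)" "n + j" n]
          binomial_symmetric[of n "n + (j - \<nu>)"] binomial_symmetric[of n "n + j"] by simp
      then show ?thesis
        using that PR by (intro mult_mono mult_left_mono power_increasing) auto
    qed
    finally show ?thesis .
  qed
  {
    case 1
    have "norm (s 1 $ j) \<le> norm (delta_op \<nu> f $ j) + norm ((c0 * f) $ j)"
      by (simp add: s_def norm_triangle_ineq4)
    also have "\<dots> \<le> real j * (C * R ^ j) + 2 * P * C * real ((Suc 0 + j) choose j) * R ^ j"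
      using delta[of f C 0 j] mult_nth_bound[of k c0 "2 * P" R f C 0 j] f c0 PR 1 by simp
    also have "\<dots> = (real j + 2 * P * (1 + j)) * (C * R ^ j)"
      by (simp add: algebra_simps)
    also have "\<dots> \<le> ((1 + 6 * P) * (1 + j)) * (C * R ^ j)"
      using PR by (intro mult_right_mono) (auto simp: algebra_simps)
    finally show ?case by (simp add: s_def mult_ac)
  next
    case (ge2 n)
    define X where "X = C * B ^ Suc n * R ^ j"
    define b where "b = real ((Suc (Suc n) + j) choose j)"
    have X: "X \<ge> 0" using PR B by (simp add: X_def)
    have b: "b \<ge> 0" by (simp add: b_def)
    have IH1: "norm (s n $ i) \<le> C * B ^ n * real ((n + i) choose i) * R ^ i" if "i \<le> k" for i
      using ge2(1)[OF that] by (simp add: B_def s_def)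
    have IH2: "norm (s (Suc n) $ i) \<le> C * B ^ Suc n * real ((Suc n + i) choose i) * R ^ i" if "i \<le> k" for i
      using ge2(2)[OF that] by (simp add: B_def s_def)
    have CB: "C * B ^ n \<ge> 0" "C * B ^ Suc n \<ge> 0" using PR B by auto
    have t1: "norm (delta_op \<nu> (s (Suc n)) $ j) \<le> real (n + 2) * (X * b)"
    proof -
      have "norm (delta_op \<nu> (s (Suc n)) $ j) \<le> real j * (C * B ^ Suc n * real ((Suc n + j) choose j) * R ^ j)"
        by (intro delta IH2 ge2 CB)
      also have "\<dots> = X * (real j * real ((Suc n + j) choose j))" by (simp add: X_def)
      also have "\<dots> \<le> X * (real (Suc (Suc n) + j) * real ((Suc n + j) choose j))"
        using X by (intro mult_left_mono mult_right_mono) auto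
      also have "\<dots> = X * (real (Suc (Suc n)) * b)"
        by (simp only: choose_Suc_absorb b_def)
      finally show ?thesis by (simp add: algebra_simps)
    qed
    have hi: "norm ((a * s (Suc n)) $ j) \<le> A * (X * b)"
      if "\<And>i. i \<le> k \<Longrightarrow> norm (a $ i) \<le> A * R ^ i" "A \<ge> 0" for a A
      using mult_nth_bound[of k a A R "s (Suc n)" "C * B ^ Suc n" "Suc n" j] that PR ge2 IH2 CB
      by (simp add: X_def b_def mult_ac)
    have lo: "norm ((a * s n) $ j) \<le> A * (X * b)"
      if "\<And>i. i \<le> k \<Longrightarrow> norm (a $ i) \<le> A * R ^ i" "A \<ge> 0" for a A
    proof -
      have "norm ((a * s n) $ j) \<le> A * (C * B ^ n) * real ((Suc n + j) choose j) * R ^ j"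
        using mult_nth_bound[of k a A R "s n" "C * B ^ n" "n" j] that PR ge2 IH1 CB by simp
      also have "\<dots> = A * (C * B ^ n * R ^ j * real ((Suc n + j) choose j))" by simp
      also have "\<dots> \<le> A * (C * B ^ Suc n * R ^ j * b)"
      proof (rule mult_left_mono)
        show "C * B ^ n * R ^ j * real ((Suc n + j) choose j) \<le> C * B ^ Suc n * R ^ j * b"
        proof (rule mult_mono)
          show "C * B ^ n * R ^ j \<le> C * B ^ Suc n * R ^ j"
            using PR B by (intro mult_right_mono mult_left_mono power_increasing) auto
          show "real ((Suc n + j) choose j) \<le> b"
            unfolding b_def by (rule of_nat_mono) (rule binomial_right_mono, simp)
        qed (use PR CB in auto)
      qed (use that in simp)
      finally show ?thesis by (simp add: X_def)
    qed
    have nth: "(of_nat m * g) $ i = of_nat m * g $ i" for m i and g :: "complex fps"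
      by (simp flip: fps_of_nat)
    have tri: "norm (x1 - x2 + x3 - x4 - x5) \<le> norm x1 + norm x2 + norm x3 + norm x4 + norm x5"
      for x1 x2 x3 x4 x5 :: complex
      using norm_triangle_ineq4[of "x1 - x2 + x3 - x4" x5] norm_triangle_ineq4[of "x1 - x2 + x3" x4]
        norm_triangle_ineq[of "x1 - x2" x3] norm_triangle_ineq4[of x1 x2] by linarith
    have "real (n + 2) * norm (s (Suc (Suc n)) $ j)
        = norm (delta_op \<nu> (s (Suc n)) $ j - of_nat (Suc n) * (p * s (Suc n)) $ j
            + of_nat n * (q * s n) $ j - (c0 * s (Suc n)) $ j - (c1 * s n) $ j)" (is "_ = norm ?Z")
    proof -
      have "s (Suc (Suc n)) $ j = 1 / of_nat (n + 2) * ?Z"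
        unfolding s_def sol_coeff.simps by (simp only: fps_mult_left_const_nth fps_sub_nth fps_add_nth mult.assoc nth)
      then have "norm (s (Suc (Suc n)) $ j) = 1 / real (n + 2) * norm ?Z"
        by (simp only: norm_mult norm_divide norm_of_nat norm_one)
      then show ?thesis by simp
    qed
    also have "\<dots> \<le> norm (delta_op \<nu> (s (Suc n)) $ j) + norm (of_nat (Suc n) * (p * s (Suc n)) $ j)
            + norm (of_nat n * (q * s n) $ j) + norm ((c0 * s (Suc n)) $ j) + norm ((c1 * s n) $ j)"
      by (rule tri)
    also have "\<dots> \<le> real (n + 2) * (X * b) + real (Suc n) * (P * (X * b)) + real n * (P * (X * b))
            + 2 * P * (X * b) + 2 * P * (X * b)"
      unfolding norm_mult norm_of_nat using PR
      by (intro add_mono t1 mult_left_mono hi lo p q c0 c1) auto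
    also have "\<dots> = (real (n + 2) + P * (2 * real n + 5)) * (X * b)"
      by (simp add: algebra_simps)
    \<comment> \<open>P (2 n + 5) \<le> 6 P (n + 2). The constant 6 is generous; what counts is the
      factor n + 2, which is cancelled below.\<close>
    also have "\<dots> \<le> (real (n + 2) * B) * (X * b)"
      using PR X b by (intro mult_right_mono) (auto simp: B_def algebra_simps)
    finally have "real (n + 2) * norm (s (Suc (Suc n)) $ j) \<le> real (n + 2) * (B * (X * b))"
      by (simp add: mult_ac)
    then have "norm (s (Suc (Suc n)) $ j) \<le> B * (X * b)"
      by (rule mult_left_le_imp_le) simp
    then show ?case by (simp add: s_def B_def X_def b_def mult_ac)
  }
qed

text \<open>Separates the two variables of the majorant at the price of a factor 2 in each. Hence
  the leading 2 in the denominator of \<open>pde_radius\<close>.\<close>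

lemma choose_le_power2: "real ((n + j) choose j) \<le> 2 ^ n * 2 ^ j"
proof -
  have "((n + j) choose j) \<le> 2 ^ (n + j)" by (rule binomial_le_pow2)
  then have "real ((n + j) choose j) \<le> real (2 ^ (n + j))" by (rule of_nat_mono)
  then show ?thesis by (simp add: power_add)
qed

text \<open>g^n is majorized by G^n (1 - R x)^(-n-1). Its growth 2 G, with G just above |g(0)|, is
  the reason for the condition |g(0)| < \<rho> / 2 in the substitution.\<close>

lemma power_nth_bound:
  fixes g :: "complex fps"
  assumes "\<And>i. i \<le> k \<Longrightarrow> norm (g $ i) \<le> G * R ^ i" "j \<le> k" "G \<ge> 0" "R \<ge> 1"
  shows "norm ((g ^ n) $ j) \<le> (2 * G) ^ n * (2 * R) ^ j"
proof -
  have "norm ((g ^ n) $ j) \<le> G ^ n * real ((n + j) choose j) * R ^ j"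
    using assms(2)
  proof (induction n arbitrary: j)
    case 0
    then show ?case using assms by (simp add: zero_le_power)
  next
    case (Suc n)
    then show ?case
      using mult_nth_bound[of k g G R "g ^ n" "G ^ n" n j] assms by simp
  qed
  also have "\<dots> \<le> G ^ n * (2 ^ n * 2 ^ j) * R ^ j"
    using assms choose_le_power2[of n j] by (intro mult_right_mono mult_left_mono) auto
  finally show ?thesis by (simp add: power_mult_distrib mult_ac)
qed

text \<open>A large R dominates every coefficient except the first, so P only has to dominate f(0).
  As f may diverge, R depends on k.\<close>

lemma fps_bound_truncated:
  fixes f :: "complex fps"
  assumes "norm (f $ 0) \<le> P" "P > 0"
  shows "\<exists>R\<ge>1. \<forall>j\<le>k. norm (f $ j) \<le> P * R ^ j"
proof -
  define R where "R = 1 + (\<Sum>j\<le>k. norm (f $ j)) / P"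
  have R: "R \<ge> 1" using assms by (simp add: R_def sum_nonneg)
  have "norm (f $ j) \<le> P * R ^ j" if "j \<le> k" for j
  proof (cases j)
    case (Suc i)
    have "norm (f $ j) \<le> (\<Sum>j\<le>k. norm (f $ j))"
      using that by (intro member_le_sum) auto
    also have "\<dots> \<le> P * R" using assms by (simp add: R_def distrib_left)
    also have "\<dots> \<le> P * R ^ j"
      using R assms Suc self_le_power[of R j] by simp
    finally show ?thesis .
  qed (use assms in simp)
  with R show ?thesis by blast
qed

text \<open>The Cauchy estimate has its own constant M, but for j \<ge> 1 the quotient M / P is
  absorbed into R^j. In contrast to \<open>fps_bound_truncated\<close>, one R serves all j.\<close>

lemma fps_bound_convergent:
  fixes f :: "complex fps"
  assumes "fps_conv_radius f > 0" "norm (f $ 0) \<le> P" "P > 0"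
  shows "\<exists>R\<ge>1. \<forall>j. norm (f $ j) \<le> P * R ^ j"
proof -
  obtain z where z: "0 < z" "ereal z < fps_conv_radius f"
    using ereal_dense2[OF assms(1)] by (metis ereal_less(2))
  have "summable (\<lambda>n. norm (f $ n * of_real z ^ n))"
    using z by (intro norm_summable_fps) simp
  then have "Bseq (\<lambda>n. norm (f $ n * of_real z ^ n))"
    by (intro convergent_imp_Bseq) (blast dest: summable_LIMSEQ_zero intro: convergentI)
  then obtain M where M: "M > 0" "\<And>n. norm (f $ n * of_real z ^ n) \<le> M"
    unfolding Bseq_def by auto
  define R where "R = max 1 (max 1 (M / P) / z)"
  have R: "R \<ge> 1" by (simp add: R_def)
  have "norm (f $ j) \<le> P * R ^ j" for j
  proof (cases j)
    case (Suc i)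
    define y where "y = max 1 (M / P)"
    have "norm (f $ j) * z ^ j \<le> M"
      using M(2)[of j] z by (simp add: norm_mult norm_power)
    then have "norm (f $ j) \<le> M / z ^ j" using z by (simp add: field_simps)
    also have "M \<le> P * y" using assms by (simp add: y_def max_def field_simps)
    also have "P * y \<le> P * y ^ j"
      using assms Suc self_le_power[of y j] by (simp add: y_def)
    finally have "norm (f $ j) \<le> P * (y / z) ^ j"
      using z by (simp add: divide_right_mono power_divide)
    also have "\<dots> \<le> P * R ^ j"
      using assms z by (intro mult_left_mono power_mono) (auto simp: R_def y_def)
    finally show ?thesis .
  qed (use assms in simp)
  with R show ?thesis by blast
qed

lemma fps_conv_radius_pos_iff:
  fixes f :: "complex fps"
  shows "fps_conv_radius f > 0 \<longleftrightarrow> (\<exists>C R. \<forall>j. norm (f $ j) \<le> C * R ^ j)"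
proof
  assume "fps_conv_radius f > 0"
  then show "\<exists>C R. \<forall>j. norm (f $ j) \<le> C * R ^ j"
    using fps_bound_convergent[of f "norm (f $ 0) + 1"] by (auto simp: add_nonneg_pos)
next
  assume "\<exists>C R. \<forall>j. norm (f $ j) \<le> C * R ^ j"
  then obtain C R where *: "\<And>j. norm (f $ j) \<le> C * R ^ j" by blast
  define S where "S = \<bar>R\<bar> + 1"
  have S: "S > 0" by (simp add: S_def)
  have "C \<ge> 0" using order.trans[OF norm_ge_zero *[of 0]] by simp
  have **: "norm (f $ j) \<le> C * S ^ j" for j
  proof -
    have "norm (f $ j) \<le> C * \<bar>R ^ j\<bar>"
      using *[of j] mult_left_mono[OF abs_ge_self \<open>C \<ge> 0\<close>, of "R ^ j"] by linarith
    also have "\<dots> \<le> C * S ^ j"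
      using \<open>C \<ge> 0\<close> by (auto simp: power_abs S_def intro!: mult_left_mono power_mono)
    finally show ?thesis .
  qed
  have "summable (\<lambda>j. f $ j * of_real (1 / (2 * S)) ^ j)"
  proof (rule summable_comparison_test)
    show "\<exists>N. \<forall>n\<ge>N. norm (f $ n * of_real (1 / (2 * S)) ^ n) \<le> C * (1 / 2) ^ n"
      using ** S by (auto simp: norm_mult norm_power norm_divide power_divide power_mult_distrib field_simps)
    show "summable (\<lambda>n. C * (1 / 2) ^ n :: real)"
      by (intro summable_mult summable_geometric) simp
  qed
  then have "fps_conv_radius f \<ge> ereal (1 / (2 * S))"
    using conv_radius_geI[of "fps_nth f" "of_real (1 / (2 * S)) :: complex"] S
    by (simp add: fps_conv_radius_def norm_divide norm_mult)
  moreover have "ereal (1 / (2 * S)) > 0" using S by simp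
  ultimately show "fps_conv_radius f > 0" by (meson less_le_trans)
qed

section \<open>Double series whose coefficients in x converge for |w| < \<rho>\<close>

definition radius_ge :: "real \<Rightarrow> complex fps fps \<Rightarrow> bool" where
  "radius_ge \<rho> F \<longleftrightarrow> (\<forall>k. ereal \<rho> \<le> fps_conv_radius (Abs_fps (\<lambda>n. F $ n $ k)))"

lemma fps_conv_radius_sum_ge:
  fixes f :: "'b \<Rightarrow> complex fps"
  assumes "\<And>i. i \<in> A \<Longrightarrow> r \<le> fps_conv_radius (f i)"
  shows "r \<le> fps_conv_radius (\<Sum>i\<in>A. f i)"
  using assms
proof (induction A rule: infinite_finite_induct)
  case (insert a A)
  then have "r \<le> min (fps_conv_radius (f a)) (fps_conv_radius (\<Sum>i\<in>A. f i))" by simp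
  also have "\<dots> \<le> fps_conv_radius (f a + (\<Sum>i\<in>A. f i))" by (rule fps_conv_radius_add)
  finally show ?case using insert by simp
qed auto

lemma radius_ge_add:
  assumes "radius_ge \<rho> F" "radius_ge \<rho> G"
  shows "radius_ge \<rho> (F + G)"
  unfolding radius_ge_def
proof
  fix k
  have "Abs_fps (\<lambda>n. (F + G) $ n $ k) = Abs_fps (\<lambda>n. F $ n $ k) + Abs_fps (\<lambda>n. G $ n $ k)"
    by (rule fps_ext) simp
  moreover have "ereal \<rho> \<le> min (fps_conv_radius (Abs_fps (\<lambda>n. F $ n $ k))) (fps_conv_radius (Abs_fps (\<lambda>n. G $ n $ k)))"
    using assms by (simp add: radius_ge_def)
  ultimately show "ereal \<rho> \<le> fps_conv_radius (Abs_fps (\<lambda>n. (F + G) $ n $ k))"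
    by (metis fps_conv_radius_add order.trans)
qed

text \<open>The coefficient of x^k in a product involves finitely many coefficients of the factors,
  so the radius survives although nothing uniform in k is assumed.\<close>

lemma radius_ge_mult:
  assumes "radius_ge \<rho> F" "radius_ge \<rho> G"
  shows "radius_ge \<rho> (F * G)"
  unfolding radius_ge_def
proof
  fix k
  have "Abs_fps (\<lambda>n. (F * G) $ n $ k) =
        (\<Sum>i=0..k. Abs_fps (\<lambda>n. F $ n $ i) * Abs_fps (\<lambda>n. G $ n $ (k - i)))"
    by (rule fps_ext) (simp add: fps_mult_nth fps_sum_nth sum.swap[of _ "{0..k}"])
  moreover have "ereal \<rho> \<le> fps_conv_radius (Abs_fps (\<lambda>n. F $ n $ i) * Abs_fps (\<lambda>n. G $ n $ (k - i)))" for i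
  proof -
    have "ereal \<rho> \<le> min (fps_conv_radius (Abs_fps (\<lambda>n. F $ n $ i))) (fps_conv_radius (Abs_fps (\<lambda>n. G $ n $ (k - i))))"
      using assms by (simp add: radius_ge_def)
    then show ?thesis using fps_conv_radius_mult order.trans by blast
  qed
  ultimately show "ereal \<rho> \<le> fps_conv_radius (Abs_fps (\<lambda>n. (F * G) $ n $ k))"
    by (simp add: fps_conv_radius_sum_ge)
qed

lemma radius_ge_const [simp]: "radius_ge \<rho> (fps_const f)"
proof -
  have "Abs_fps (\<lambda>n. fps_const f $ n $ k) = fps_const (f $ k)" for k
    by (rule fps_ext) simp
  then show ?thesis by (simp add: radius_ge_def)
qed

lemma radius_ge_X [simp]: "radius_ge \<rho> fps_X"
proof -
  have "Abs_fps (\<lambda>n. fps_X $ n $ k) = (if k = 0 then fps_X else 0 :: complex fps)" for k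
    by (rule fps_ext) (simp add: fps_X_def)
  then show ?thesis by (simp add: radius_ge_def)
qed

lemma radius_ge_uminus: "radius_ge \<rho> F \<Longrightarrow> radius_ge \<rho> (- F)"
  using radius_ge_mult[OF radius_ge_const[of \<rho> "-1"], of F] by (simp flip: fps_const_neg)

lemma radius_ge_diff: "radius_ge \<rho> F \<Longrightarrow> radius_ge \<rho> G \<Longrightarrow> radius_ge \<rho> (F - G)"
  using radius_ge_add[OF _ radius_ge_uminus, of \<rho> F G] by simp

lemma radius_ge_1 [simp]: "radius_ge \<rho> 1"
  using radius_ge_const[of \<rho> 1] by simp

lemma radius_ge_power: "radius_ge \<rho> F \<Longrightarrow> radius_ge \<rho> (F ^ n)"
  by (induction n) (auto intro: radius_ge_mult)

lemma radius_ge_fps_deriv: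
  assumes "radius_ge \<rho> F"
  shows "radius_ge \<rho> (fps_deriv F)"
  unfolding radius_ge_def
proof
  fix k
  have nth: "(of_nat m * g) $ i = of_nat m * g $ i" for m i and g :: "complex fps"
    by (simp flip: fps_of_nat)
  have "Abs_fps (\<lambda>n. fps_deriv F $ n $ k) = fps_deriv (Abs_fps (\<lambda>n. F $ n $ k))"
    by (rule fps_ext) (simp add: nth del: of_nat_Suc of_nat_add)
  then show "ereal \<rho> \<le> fps_conv_radius (Abs_fps (\<lambda>n. fps_deriv F $ n $ k))"
    using order.trans[OF assms[unfolded radius_ge_def, rule_format] fps_conv_radius_deriv] by (simp only:)
qed

lemma radius_ge_ddelta:
  assumes "radius_ge \<rho> F"
  shows "radius_ge \<rho> (ddelta \<nu> F)"
  unfolding radius_ge_def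
proof
  fix k
  have "Abs_fps (\<lambda>n. ddelta \<nu> F $ n $ k) =
      (if k \<le> \<nu> then 0 else fps_const (of_nat (k - \<nu>)) * Abs_fps (\<lambda>n. F $ n $ (k - \<nu>)))"
    by (rule fps_ext) (simp add: delta_op_nth)
  then show "ereal \<rho> \<le> fps_conv_radius (Abs_fps (\<lambda>n. ddelta \<nu> F $ n $ k))"
    using assms by (simp add: radius_ge_def fps_conv_radius_cmult_left del: of_nat_diff)
qed

lemma radius_ge_pde_factor: "radius_ge \<rho> (pde_factor p q)"
  unfolding pde_factor_def by (intro radius_ge_add radius_ge_diff radius_ge_mult radius_ge_power) auto

lemma radius_ge_summable:
  assumes "radius_ge \<rho> F" "0 \<le> b" "b < \<rho>"
  shows "summable (\<lambda>n. norm (F $ n $ k) * b ^ n)"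
proof -
  have "ereal b < ereal \<rho>" using assms by simp
  also have "\<dots> \<le> fps_conv_radius (Abs_fps (\<lambda>n. F $ n $ k))" using assms by (simp add: radius_ge_def)
  finally have "summable (\<lambda>n. norm (Abs_fps (\<lambda>n. F $ n $ k) $ n * of_real b ^ n))"
    using assms by (intro norm_summable_fps) simp
  then show ?thesis using assms by (simp add: norm_mult norm_power)
qed

text \<open>The substitution $w = g(x)$. It converges coefficientwise when $g(0)$ is small compared with \<open>\<rho>\<close>,
  even if \<open>g\<close> itself diverges.\<close>

definition subst_w :: "complex fps fps \<Rightarrow> complex fps \<Rightarrow> complex fps" where
  "subst_w F g = Abs_fps (\<lambda>k. \<Sum>n. (F $ n * g ^ n) $ k)"

text \<open>Up to a constant depending on k, the coefficients of g^n up to x^k are bounded by (2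
  G)^n for some G with |g(0)| < G, and 2 G < \<rho>.\<close>

lemma subst_w_summable_norm:
  assumes "radius_ge \<rho> F" "norm (g $ 0) < \<rho> / 2"
  shows "summable (\<lambda>n. norm ((F $ n * g ^ n) $ k))"
proof -
  obtain G where G: "norm (g $ 0) < G" "G < \<rho> / 2" using assms(2) dense by blast
  have "G > 0" using G(1) norm_ge_zero[of "g $ 0"] by linarith
  obtain R where R: "R \<ge> 1" "\<forall>j\<le>k. norm (g $ j) \<le> G * R ^ j"
    using fps_bound_truncated[of g G k, OF less_imp_le[OF G(1)] \<open>G > 0\<close>] by blast
  define T where "T n = (\<Sum>i=0..k. norm (F $ n $ i) * (2 * G) ^ n * (2 * R) ^ (k - i))" for n
  have "summable T"
    unfolding T_def using G \<open>G > 0\<close> assms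
    by (intro summable_sum summable_mult2 radius_ge_summable[of \<rho>]) auto
  moreover have "norm (norm ((F $ n * g ^ n) $ k)) \<le> T n" for n
  proof -
    have "norm ((F $ n * g ^ n) $ k) \<le> (\<Sum>i=0..k. norm (F $ n $ i) * norm ((g ^ n) $ (k - i)))"
      unfolding fps_mult_nth by (rule order.trans[OF norm_sum]) (simp add: norm_mult)
    also have "\<dots> \<le> T n"
      unfolding T_def mult.assoc using R \<open>G > 0\<close>
      by (intro sum_mono mult_left_mono power_nth_bound[of k]) auto
    finally show ?thesis by simp
  qed
  ultimately show ?thesis by (rule summable_comparison_test'[where N = 0])
qed

lemma subst_w_summable:
  "radius_ge \<rho> F \<Longrightarrow> norm (g $ 0) < \<rho> / 2 \<Longrightarrow> summable (\<lambda>n. (F $ n * g ^ n) $ k)"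
  by (rule summable_norm_cancel) (rule subst_w_summable_norm)

lemma subst_w_nth: "subst_w F g $ k = (\<Sum>n. (F $ n * g ^ n) $ k)"
  by (simp add: subst_w_def)

lemma subst_w_const [simp]: "subst_w (fps_const f) g = f"
proof (rule fps_ext)
  fix k
  have "(\<lambda>n. (fps_const f $ n * g ^ n) $ k) sums (\<Sum>n\<in>{0}. (fps_const f $ n * g ^ n) $ k)"
    by (rule sums_finite) auto
  then show "subst_w (fps_const f) g $ k = f $ k" by (simp add: subst_w_nth sums_iff)
qed

lemma subst_w_1 [simp]: "subst_w 1 g = 1"
  using subst_w_const[of 1 g] by simp

lemma subst_w_0 [simp]: "subst_w 0 g = 0"
  using subst_w_const[of 0 g] by simp

lemma subst_w_X [simp]: "subst_w fps_X g = g"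
proof (rule fps_ext)
  fix k
  have "(\<lambda>n. (fps_X $ n * g ^ n) $ k) sums (\<Sum>n\<in>{1}. (fps_X $ n * g ^ n) $ k)"
    by (rule sums_finite) (auto simp: fps_X_def)
  then show "subst_w fps_X g $ k = g $ k" by (simp add: subst_w_nth sums_iff)
qed

lemma subst_w_add:
  assumes "radius_ge \<rho> F" "radius_ge \<rho> G" "norm (g $ 0) < \<rho> / 2"
  shows "subst_w (F + G) g = subst_w F g + subst_w G g"
  by (rule fps_ext) (simp add: subst_w_nth ring_distribs suminf_add subst_w_summable[OF assms(1,3)] subst_w_summable[OF assms(2,3)])

lemma subst_w_mult:
  assumes "radius_ge \<rho> F" "radius_ge \<rho> G" "norm (g $ 0) < \<rho> / 2"
  shows "subst_w (F * G) g = subst_w F g * subst_w G g"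
proof (rule fps_ext)
  fix k
  let ?f = "\<lambda>j n. (F $ n * g ^ n) $ j" and ?g = "\<lambda>j n. (G $ n * g ^ n) $ j"
  have eq: "((F * G) $ n * g ^ n) $ k = (\<Sum>j=0..k. \<Sum>i\<le>n. ?f j i * ?g (k - j) (n - i))" for n
  proof -
    have "(F * G) $ n * g ^ n = (\<Sum>i\<le>n. (F $ i * g ^ i) * (G $ (n - i) * g ^ (n - i)))"
    proof -
      have "(F * G) $ n * g ^ n = (\<Sum>i\<le>n. F $ i * G $ (n - i) * g ^ n)"
        by (simp add: fps_mult_nth sum_distrib_right atLeast0AtMost)
      also have "\<dots> = (\<Sum>i\<le>n. (F $ i * g ^ i) * (G $ (n - i) * g ^ (n - i)))"
      proof (rule sum.cong)
        fix i assume "i \<in> {..n}"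
        then have "g ^ n = g ^ i * g ^ (n - i)" by (simp flip: power_add)
        then show "F $ i * G $ (n - i) * g ^ n = (F $ i * g ^ i) * (G $ (n - i) * g ^ (n - i))"
          by (simp add: mult_ac)
      qed simp
      finally show ?thesis .
    qed
    then have "((F * G) $ n * g ^ n) $ k = (\<Sum>i\<le>n. \<Sum>j=0..k. ?f j i * ?g (k - j) (n - i))"
      by (simp only: fps_sum_nth fps_mult_nth[of "F $ _ * _"])
    then show ?thesis by (subst sum.swap)
  qed
  have s: "(\<lambda>n. \<Sum>i\<le>n. ?f j i * ?g (k - j) (n - i)) sums ((\<Sum>n. ?f j n) * (\<Sum>n. ?g (k - j) n))" for j
    using assms by (intro Cauchy_product_sums subst_w_summable_norm)
  have "(\<lambda>n. ((F * G) $ n * g ^ n) $ k) sums (\<Sum>j=0..k. (\<Sum>n. ?f j n) * (\<Sum>n. ?g (k - j) n))"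
    unfolding eq by (intro sums_sum s)
  then show "subst_w (F * G) g $ k = (subst_w F g * subst_w G g) $ k"
    by (simp add: subst_w_nth fps_mult_nth sums_iff)
qed

lemma subst_w_uminus: "radius_ge \<rho> F \<Longrightarrow> norm (g $ 0) < \<rho> / 2 \<Longrightarrow> subst_w (- F) g = - subst_w F g"
proof -
  assume "radius_ge \<rho> F" "norm (g $ 0) < \<rho> / 2"
  then have "subst_w (fps_const (- 1) * F) g = subst_w (fps_const (- 1)) g * subst_w F g"
    by (rule subst_w_mult[OF radius_ge_const])
  moreover have "fps_const (- 1) * F = - F"
    by (rule fps_ext) simp
  ultimately show ?thesis by (simp only: subst_w_const mult_minus1)
qed

lemma subst_w_diff:
  assumes "radius_ge \<rho> F" "radius_ge \<rho> G" "norm (g $ 0) < \<rho> / 2"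
  shows "subst_w (F - G) g = subst_w F g - subst_w G g"
  using subst_w_add[OF assms(1) radius_ge_uminus[OF assms(2)] assms(3)] subst_w_uminus[OF assms(2,3)] by simp

lemma subst_w_power: "radius_ge \<rho> F \<Longrightarrow> norm (g $ 0) < \<rho> / 2 \<Longrightarrow> subst_w (F ^ n) g = subst_w F g ^ n"
  by (induction n) (simp_all add: subst_w_mult[of \<rho>] radius_ge_power)

lemma delta_op_power: "delta_op \<nu> (g ^ n) = of_nat n * g ^ (n - 1) * delta_op \<nu> g"
  by (simp add: delta_op_def fps_deriv_power mult_ac flip: fps_of_nat)

text \<open>Termwise differentiation of F(x, g(x)) is legitimate because each coefficient of
  \<open>delta_op \<nu> f\<close> is zero or a fixed multiple of a single coefficient of f.\<close>

lemma delta_op_subst_w: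
  assumes "radius_ge \<rho> F" "norm (g $ 0) < \<rho> / 2"
  shows "delta_op \<nu> (subst_w F g) = subst_w (ddelta \<nu> F) g + delta_op \<nu> g * subst_w (fps_deriv F) g"
proof (rule fps_ext)
  fix k
  let ?D = "fps_deriv F * fps_const (delta_op \<nu> g)"
  have D: "subst_w ?D g = subst_w (fps_deriv F) g * delta_op \<nu> g"
    using assms by (simp add: subst_w_mult[of \<rho>] radius_ge_fps_deriv)
  have s1: "summable (\<lambda>n. (ddelta \<nu> F $ n * g ^ n) $ k)"
    using assms by (intro subst_w_summable radius_ge_ddelta)
  have s2: "summable (\<lambda>n. (?D $ n * g ^ n) $ k)"
    using assms by (intro subst_w_summable[of \<rho>] radius_ge_mult radius_ge_fps_deriv) auto
  have D2: "?D $ n * g ^ n = F $ Suc n * delta_op \<nu> (g ^ Suc n)" for n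
    by (simp add: delta_op_power mult_ac del: of_nat_Suc of_nat_add power_Suc)
  have "(\<lambda>n. (F $ Suc n * delta_op \<nu> (g ^ Suc n)) $ k) sums (subst_w ?D g $ k)"
    using s2 unfolding subst_w_nth D2 by (rule summable_sums)
  \<comment> \<open>The index shift is free: the term for n = 0 contains \<delta>(g^0) = 0.\<close>
  then have s4: "(\<lambda>n. (F $ n * delta_op \<nu> (g ^ n)) $ k) sums (subst_w ?D g $ k)"
    using sums_Suc_iff[of "\<lambda>n. (F $ n * delta_op \<nu> (g ^ n)) $ k" "subst_w ?D g $ k"]
    by (simp del: power_Suc)
  have "(\<lambda>n. (ddelta \<nu> F $ n * g ^ n) $ k + (F $ n * delta_op \<nu> (g ^ n)) $ k)
          sums (subst_w (ddelta \<nu> F) g $ k + subst_w ?D g $ k)"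
    unfolding subst_w_nth[of "ddelta \<nu> F"] by (rule sums_add[OF summable_sums[OF s1] s4])
  then have "(\<lambda>n. delta_op \<nu> (F $ n * g ^ n) $ k) sums (subst_w (ddelta \<nu> F) g $ k + subst_w ?D g $ k)"
    by (simp add: delta_op_mult)
  moreover have "(\<lambda>n. delta_op \<nu> (F $ n * g ^ n) $ k) sums (delta_op \<nu> (subst_w F g) $ k)"
  proof (cases "k \<le> \<nu>")
    case False
    have "(\<lambda>n. (F $ n * g ^ n) $ (k - \<nu>)) sums (subst_w F g $ (k - \<nu>))"
      using subst_w_summable[OF assms] by (simp add: subst_w_nth sums_iff)
    from sums_mult[OF this, of "of_nat (k - \<nu>)"] False show ?thesis
      by (simp add: delta_op_nth del: of_nat_diff)
  qed (simp add: delta_op_nth)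
  ultimately have "subst_w (ddelta \<nu> F) g $ k + subst_w ?D g $ k = delta_op \<nu> (subst_w F g) $ k"
    by (rule sums_unique2)
  then show "delta_op \<nu> (subst_w F g) $ k = (subst_w (ddelta \<nu> F) g + delta_op \<nu> g * subst_w (fps_deriv F) g) $ k"
    by (simp only: D fps_add_nth mult.commute[of "delta_op \<nu> g"])
qed

text \<open>With bounds uniform in j, the sum over n is geometric with ratio c = 2 G / \<rho> < 1,
  and only exponential growth in k is left.\<close>

lemma subst_w_convergent:
  assumes F: "\<And>n j. norm (F $ n $ j) \<le> C * (1 / \<rho>) ^ n * R ^ j"
    and g: "fps_conv_radius g > 0" "norm (g $ 0) < \<rho> / 2"
  shows "fps_conv_radius (subst_w F g) > 0"
proof -
  obtain G where G: "norm (g $ 0) < G" "G < \<rho> / 2" using g(2) dense by blast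
  have "G > 0" using G(1) norm_ge_zero[of "g $ 0"] by linarith
  obtain S where S: "S \<ge> 1" "\<forall>j. norm (g $ j) \<le> G * S ^ j"
    using fps_bound_convergent[of g G, OF g(1) less_imp_le[OF G(1)] \<open>G > 0\<close>] by blast
  define Q where "Q = max \<bar>R\<bar> (2 * S)"
  have Q: "Q \<ge> 1" "\<bar>R\<bar> \<le> Q" "2 * S \<le> Q" using S by (auto simp: Q_def)
  define c where "c = 2 * G / \<rho>"
  have \<rho>: "\<rho> > 0" using G \<open>G > 0\<close> by simp
  have c: "0 \<le> c" "c < 1" using G \<open>G > 0\<close> \<rho> by (simp_all add: c_def)
  have C: "C \<ge> 0" using order.trans[OF norm_ge_zero F[of 0 0]] by simp
  have bound: "norm ((F $ n * g ^ n) $ k) \<le> C * (2 * Q) ^ k * c ^ n" for n k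
  proof -
    have "norm ((F $ n * g ^ n) $ k) \<le> (\<Sum>i=0..k. norm (F $ n $ i) * norm ((g ^ n) $ (k - i)))"
      unfolding fps_mult_nth by (rule order.trans[OF norm_sum]) (simp add: norm_mult)
    also have "\<dots> \<le> (\<Sum>i=0..k. (C * (1 / \<rho>) ^ n * Q ^ i) * ((2 * G) ^ n * Q ^ (k - i)))"
    proof (intro sum_mono mult_mono)
      fix i assume "i \<in> {0..k}"
      have C\<rho>: "0 \<le> C * (1 / \<rho>) ^ n" using C \<rho> by simp
      from mult_left_mono[OF abs_ge_self this, of "R ^ i"]
      have "norm (F $ n $ i) \<le> C * (1 / \<rho>) ^ n * \<bar>R ^ i\<bar>"
        using F[of n i] by linarith
      also have "\<dots> \<le> C * (1 / \<rho>) ^ n * Q ^ i"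
        unfolding power_abs using Q by (intro mult_left_mono[OF _ C\<rho>] power_mono) auto
      finally show "norm (F $ n $ i) \<le> C * (1 / \<rho>) ^ n * Q ^ i" .
      then show "0 \<le> C * (1 / \<rho>) ^ n * Q ^ i" by (rule order.trans[OF norm_ge_zero])
      have "norm ((g ^ n) $ (k - i)) \<le> (2 * G) ^ n * (2 * S) ^ (k - i)"
        using S \<open>G > 0\<close> by (intro power_nth_bound[of k]) auto
      also have "\<dots> \<le> (2 * G) ^ n * Q ^ (k - i)"
        using Q S \<open>G > 0\<close> by (intro mult_left_mono power_mono) auto
      finally show "norm ((g ^ n) $ (k - i)) \<le> (2 * G) ^ n * Q ^ (k - i)" .
    qed auto
    also have "\<dots> = (\<Sum>i=0..k. C * c ^ n * Q ^ k)"
    proof (rule sum.cong)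
      fix i assume "i \<in> {0..k}"
      then have "Q ^ k = Q ^ i * Q ^ (k - i)" by (simp flip: power_add)
      moreover have "c ^ n = (1 / \<rho>) ^ n * (2 * G) ^ n"
        unfolding power_mult_distrib[symmetric] by (simp add: c_def)
      ultimately show "(C * (1 / \<rho>) ^ n * Q ^ i) * ((2 * G) ^ n * Q ^ (k - i)) = C * c ^ n * Q ^ k"
        by simp
    qed simp
    also have "\<dots> = real (Suc k) * (C * c ^ n * Q ^ k)" by simp
    also have "\<dots> \<le> 2 ^ k * (C * c ^ n * Q ^ k)"
    proof (intro mult_right_mono)
      have "Suc k \<le> 2 ^ k" by (rule Suc_leI) (rule less_exp)
      then have "real (Suc k) \<le> real (2 ^ k)" by (rule of_nat_mono)
      then show "real (Suc k) \<le> 2 ^ k" by simp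
    qed (use C c Q in auto)
    also have "\<dots> = C * (2 * Q) ^ k * c ^ n" unfolding power_mult_distrib by simp
    finally show ?thesis .
  qed
  have "norm (subst_w F g $ k) \<le> (C / (1 - c)) * (2 * Q) ^ k" for k
  proof -
    have gs: "(\<lambda>n. C * (2 * Q) ^ k * c ^ n) sums (C * (2 * Q) ^ k * (1 / (1 - c)))"
      by (rule sums_mult[OF geometric_sums]) (use c in simp)
    have "norm (subst_w F g $ k) \<le> (\<Sum>n. C * (2 * Q) ^ k * c ^ n)"
      unfolding subst_w_nth by (rule norm_suminf_le[OF bound sums_summable[OF gs]])
    then show ?thesis using gs by (simp add: sums_iff)
  qed
  then show ?thesis unfolding fps_conv_radius_pos_iff by (intro exI allI)
qed

text \<open>The weight \<open>1 + 6 P\<close> of \<^term>\<open>sol_coeff\<close> doubled, for $P = 1 + |p(0)| + |q(0)|$. It depends on the values at $0$ only.\<close>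

definition pde_radius :: "complex fps \<Rightarrow> complex fps \<Rightarrow> real" where
  "pde_radius p q = 1 / (2 * (1 + 6 * (1 + norm (p $ 0) + norm (q $ 0))))"

lemma sol_coeff_bound_pde_radius:
  assumes p: "\<And>i. i \<le> k \<Longrightarrow> norm (p $ i) \<le> (1 + norm (p $ 0) + norm (q $ 0)) * R ^ i"
    and q: "\<And>i. i \<le> k \<Longrightarrow> norm (q $ i) \<le> (1 + norm (p $ 0) + norm (q $ 0)) * R ^ i"
    and c0: "\<And>i. i \<le> k \<Longrightarrow> norm (c0 $ i) \<le> 2 * (1 + norm (p $ 0) + norm (q $ 0)) * R ^ i"
    and c1: "\<And>i. i \<le> k \<Longrightarrow> norm (c1 $ i) \<le> 2 * (1 + norm (p $ 0) + norm (q $ 0)) * R ^ i"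
    and f: "\<And>i. i \<le> k \<Longrightarrow> norm (f $ i) \<le> C * R ^ i"
    and PR: "R \<ge> 1" "C \<ge> 0" and "j \<le> k"
  shows "norm (sol \<nu> p q c0 c1 f $ n $ j) \<le> C * (1 / pde_radius p q) ^ n * (2 * R) ^ j"
proof -
  define P where "P = 1 + norm (p $ 0) + norm (q $ 0)"
  have P: "P \<ge> 0" by (simp add: P_def)
  have "norm (sol \<nu> p q c0 c1 f $ n $ j) \<le> C * (1 + 6 * P) ^ n * real ((n + j) choose j) * R ^ j"
    unfolding sol_def fps_nth_Abs_fps using assms P
    by (intro sol_coeff_bound[of k p P R q c0 c1 f C j]) (auto simp: P_def)
  also have "\<dots> \<le> C * (1 + 6 * P) ^ n * (2 ^ n * 2 ^ j) * R ^ j"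
    using P PR choose_le_power2[of n j] by (intro mult_right_mono mult_left_mono) auto
  also have "\<dots> = C * (2 * (1 + 6 * P)) ^ n * (2 * R) ^ j"
    by (simp only: power_mult_distrib) (simp add: mult_ac)
  finally show ?thesis by (simp add: pde_radius_def P_def)
qed

text \<open>The estimates for the solutions need one R for all data, each with its own constant; the
  largest R works. The index set J is \<open>{..k}\<close> in the formal and \<open>UNIV\<close> in
  the convergent case.\<close>

lemma common_majorant:
  fixes S :: "(complex fps \<times> real) set"
  assumes "finite S" "\<And>f P. (f, P) \<in> S \<Longrightarrow> P \<ge> 0 \<and> (\<exists>R\<ge>1. \<forall>j\<in>J. norm (f $ j) \<le> P * R ^ j)"
  shows "\<exists>R\<ge>1. \<forall>(f, P)\<in>S. \<forall>j\<in>J. norm (f $ j) \<le> P * R ^ j"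
  using assms
proof (induction S rule: finite_induct)
  case (insert a S)
  obtain f P where a: "a = (f, P)" by force
  obtain R1 where R1: "R1 \<ge> 1" "\<forall>j\<in>J. norm (f $ j) \<le> P * R1 ^ j" and P: "P \<ge> 0"
    using insert.prems[of f P] a by auto
  obtain R2 where R2: "R2 \<ge> 1" "\<forall>(f, P)\<in>S. \<forall>j\<in>J. norm (f $ j) \<le> P * R2 ^ j"
    using insert.IH insert.prems by blast
  define R where "R = max R1 R2"
  have mono: "norm (f $ j) \<le> P * R ^ j"
    if "norm (f $ j) \<le> P * R' ^ j" "R' \<le> R" "1 \<le> R'" "P \<ge> 0" for f :: "complex fps" and P R' j
  proof -
    have "P * R' ^ j \<le> P * R ^ j" using that by (intro mult_left_mono power_mono) auto
    with that show ?thesis by linarith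
  qed
  have "\<forall>(f, P)\<in>insert a S. \<forall>j\<in>J. norm (f $ j) \<le> P * R ^ j"
  proof (clarify)
    fix f' P' j assume fP: "(f', P') \<in> insert a S" and j: "j \<in> J"
    show "norm (f' $ j) \<le> P' * R ^ j"
    proof (cases "(f', P') = a")
      case True
      then show ?thesis using a R1 P j mono[of f j P R1] by (auto simp: R_def)
    next
      case False
      then have "(f', P') \<in> S" using fP by blast
      moreover have "P' \<ge> 0" using insert.prems fP by blast
      ultimately show ?thesis using R2 j mono[of f' j P' R2] by (auto simp: R_def)
    qed
  qed
  moreover have "R \<ge> 1" using R1 by (simp add: R_def)
  ultimately show ?case by blast
qed auto

lemma pde_radius_pos: "pde_radius p q > 0"
  by (simp add: pde_radius_def add_pos_nonneg)

lemma radius_ge_sol: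
  assumes "norm (c0 $ 0) \<le> 2 * (1 + norm (p $ 0) + norm (q $ 0))"
    and "norm (c1 $ 0) \<le> 2 * (1 + norm (p $ 0) + norm (q $ 0))"
  shows "radius_ge (pde_radius p q) (sol \<nu> p q c0 c1 f)"
  unfolding radius_ge_def
proof
  fix k
  define P where "P = 1 + norm (p $ 0) + norm (q $ 0)"
  define C where "C = norm (f $ 0) + 1"
  have pos: "P > 0" "C > 0" by (auto simp: P_def C_def add_pos_nonneg add_nonneg_pos)
  define S where "S = {(p, P), (q, P), (c0, 2 * P), (c1, 2 * P), (f, C)}"
  have S: "P' \<ge> 0 \<and> (\<exists>R\<ge>1. \<forall>j\<in>{..k}. norm (f' $ j) \<le> P' * R ^ j)" if "(f', P') \<in> S" for f' P'
  proof -
    have "norm (f' $ 0) \<le> P'" "P' > 0"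
      using that assms pos by (auto simp: S_def P_def C_def)
    then show ?thesis using fps_bound_truncated[of f' P' k] by auto
  qed
  have fin: "finite S" by (simp add: S_def)
  obtain R where R: "R \<ge> 1" "\<forall>(f, P)\<in>S. \<forall>j\<in>{..k}. norm (f $ j) \<le> P * R ^ j"
    using common_majorant[OF fin S] by blast
  have b: "norm (sol \<nu> p q c0 c1 f $ n $ k) \<le> C * (1 / pde_radius p q) ^ n * (2 * R) ^ k" for n
    using R pos by (intro sol_coeff_bound_pde_radius[of k]) (auto simp: P_def S_def)
  show "ereal (pde_radius p q) \<le> fps_conv_radius (Abs_fps (\<lambda>n. sol \<nu> p q c0 c1 f $ n $ k))"
    unfolding fps_conv_radius_def
  proof (rule conv_radius_geI_ex)
    fix r :: real assume r: "0 < r" "ereal r < ereal (pde_radius p q)"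
    have "summable (\<lambda>n. Abs_fps (\<lambda>n. sol \<nu> p q c0 c1 f $ n $ k) $ n * of_real r ^ n)"
    proof (rule summable_comparison_test)
      show "summable (\<lambda>n. C * (2 * R) ^ k * (r / pde_radius p q) ^ n)"
        using r pde_radius_pos[of p q] by (intro summable_mult summable_geometric) (simp add: abs_mult)
      have "norm (sol \<nu> p q c0 c1 f $ n $ k) * r ^ n \<le> C * (2 * R) ^ k * (r / pde_radius p q) ^ n" for n
      proof -
        have "norm (sol \<nu> p q c0 c1 f $ n $ k) * r ^ n \<le> (C * (1 / pde_radius p q) ^ n * (2 * R) ^ k) * r ^ n"
          using r by (intro mult_right_mono b) auto
        then show ?thesis by (simp add: power_divide mult_ac)
      qed
      then show "\<exists>N. \<forall>n\<ge>N. norm (Abs_fps (\<lambda>n. sol \<nu> p q c0 c1 f $ n $ k) $ n * of_real r ^ n)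
          \<le> C * (2 * R) ^ k * (r / pde_radius p q) ^ n"
        using r by (simp add: norm_mult norm_power)
    qed
    then show "\<exists>z. norm z = r \<and> summable (\<lambda>n. Abs_fps (\<lambda>n. sol \<nu> p q c0 c1 f $ n $ k) $ n * z ^ n)"
      using r by (intro exI[of _ "of_real r"]) simp
  qed
qed

lemma subst_w_sol_convergent:
  assumes "norm (c0 $ 0) \<le> 2 * (1 + norm (p $ 0) + norm (q $ 0))"
    and "norm (c1 $ 0) \<le> 2 * (1 + norm (p $ 0) + norm (q $ 0))"
    and "fps_conv_radius p > 0" "fps_conv_radius q > 0" "fps_conv_radius c0 > 0" "fps_conv_radius c1 > 0"
    and "fps_conv_radius f > 0" and g: "fps_conv_radius g > 0" "norm (g $ 0) < pde_radius p q / 2"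
  shows "fps_conv_radius (subst_w (sol \<nu> p q c0 c1 f) g) > 0"
proof -
  define P where "P = 1 + norm (p $ 0) + norm (q $ 0)"
  define C where "C = norm (f $ 0) + 1"
  have pos: "P > 0" "C > 0" by (auto simp: P_def C_def add_pos_nonneg add_nonneg_pos)
  define S where "S = {(p, P), (q, P), (c0, 2 * P), (c1, 2 * P), (f, C)}"
  have S: "P' \<ge> 0 \<and> (\<exists>R\<ge>1. \<forall>j\<in>UNIV. norm (f' $ j) \<le> P' * R ^ j)" if "(f', P') \<in> S" for f' P'
  proof -
    have "norm (f' $ 0) \<le> P'" "P' > 0" "fps_conv_radius f' > 0"
      using that assms pos by (auto simp: S_def P_def C_def)
    then show ?thesis using fps_bound_convergent[of f' P'] by auto
  qed
  have fin: "finite S" by (simp add: S_def)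
  obtain R where R: "R \<ge> 1" "\<forall>(f, P)\<in>S. \<forall>j\<in>UNIV. norm (f $ j) \<le> P * R ^ j"
    using common_majorant[OF fin S] by blast
  have "norm (sol \<nu> p q c0 c1 f $ n $ j) \<le> C * (1 / pde_radius p q) ^ n * (2 * R) ^ j" for n j
    using R pos by (intro sol_coeff_bound_pde_radius[of j]) (auto simp: P_def S_def)
  then show ?thesis using g by (rule subst_w_convergent)
qed

text \<open>The chain rule splits into L F and a multiple of the w-derivative. The multiplier,
  called h below, vanishes exactly if w = g(x) is a characteristic of L.\<close>

lemma delta_op_subst_w_pde:
  assumes F: "pde \<nu> p q c F" and r: "radius_ge \<rho> F" "radius_ge \<rho> c" and g: "norm (g $ 0) < \<rho> / 2"
  shows "delta_op \<nu> (subst_w F g) =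
    subst_w c g * subst_w F g + (1 + g * p - g\<^sup>2 * q + delta_op \<nu> g) * subst_w (fps_deriv F) g"
proof -
  note [simp] = subst_w_add[OF _ _ g] subst_w_mult[OF _ _ g] subst_w_diff[OF _ _ g] subst_w_power[OF _ g]
    radius_ge_fps_deriv radius_ge_mult radius_ge_power radius_ge_add radius_ge_diff radius_ge_pde_factor
  have k: "subst_w (pde_factor p q) g = 1 + g * p - g\<^sup>2 * q"
    by (simp add: pde_factor_def mult.commute)
  have "subst_w (ddelta \<nu> F) g = subst_w (pde_factor p q) g * subst_w (fps_deriv F) g + subst_w c g * subst_w F g"
    using F r by (simp add: pde_def)
  then show ?thesis
    unfolding delta_op_subst_w[OF r(1) g, of \<nu>] k by (simp add: algebra_simps)
qed

section \<open>The double series \<Psi>, T and E\<close>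

lemma pde_1: "pde \<nu> p q 0 1"
  by (simp add: pde_def)

lemma pde_0_power: "pde \<nu> p q 0 F \<Longrightarrow> pde \<nu> p q 0 (F ^ n)"
  using pde_mult[of \<nu> p q 0 F 0] by (induction n) (simp_all add: pde_1)

text \<open>Opposite weights cancel. After substitution this produces units, which gives
  \<open>\<psi> $ 1 \<noteq> 0\<close> and \<open>t $ 0 \<noteq> 0\<close> in
  \<open>substitution_exists\<close>.\<close>

lemma pde_inverse_sol: 
  "sol \<nu> p q c0 c1 1 * sol \<nu> p q (- c0) (- c1) 1 = 1"
  by (rule pde_unique[OF _ pde_1])
     (use pde_mult[OF pde_sol[of \<nu> p q c0 c1 1] pde_sol[of \<nu> p q "- c0" "- c1" 1]]
       in \<open>simp_all add: algebra_simps flip: fps_const_neg\<close>)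

text \<open>The first integral of L that extends f from w = 0. With \<Psi> =
  \<open>transport \<nu> p q fps_X\<close> it stands for f(\<Psi>), a reading that
  \<open>subst_w_transport\<close> confirms after substitution.\<close>

abbreviation "transport \<nu> p q \<equiv> sol \<nu> p q 0 0"

lemma pde_transport: "pde \<nu> p q 0 (transport \<nu> p q f)"
  using pde_sol[of \<nu> p q 0 0 f] by simp

lemma transport_eqI: "pde \<nu> p q 0 F \<Longrightarrow> F $ 0 = f \<Longrightarrow> transport \<nu> p q f = F"
  by (rule pde_unique[OF pde_transport]) auto

lemma transport_add: "transport \<nu> p q (f + g) = transport \<nu> p q f + transport \<nu> p q g"
  by (rule transport_eqI) (auto intro: pde_add pde_transport)

lemma transport_mult: "transport \<nu> p q (f * g) = transport \<nu> p q f * transport \<nu> p q g"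
  by (rule transport_eqI) (use pde_mult[OF pde_transport pde_transport] in auto)

lemma transport_const: "transport \<nu> p q (fps_const c) = fps_const (fps_const c)"
  by (rule transport_eqI) (auto simp: pde_def)

text \<open>Since \<delta>x = x^\<nu> x, the factor x has weight x^\<nu>, and the other factor
  compensates it. The factorization shows that \<Psi> vanishes to first order at x = 0.\<close>

lemma transport_X:
  "transport \<nu> p q fps_X = fps_const fps_X * sol \<nu> p q (- (fps_X ^ \<nu>)) 0 1"
proof (rule transport_eqI)
  show "pde \<nu> p q 0 (fps_const fps_X * sol \<nu> p q (- (fps_X ^ \<nu>)) 0 1)"
    using pde_fps_const_mult[OF pde_sol[of \<nu> p q "- (fps_X ^ \<nu>)" 0 1], of fps_X "fps_X ^ \<nu>"]
    by (simp add: mult.commute)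
qed simp

lemma radius_ge_transport: "radius_ge (pde_radius p q) (transport \<nu> p q f)"
  by (rule radius_ge_sol) auto

text \<open>For polynomials f it would suffice that \<open>transport\<close> respects sums, products
  and constants. For series, f = f(0) + x f' is split: as \<psi>(0) = 0, the coefficient of x^k in
  \<psi> times the substituted f' only uses coefficients of lower index of the latter.\<close>

lemma subst_w_transport:
  assumes g: "norm (g $ 0) < pde_radius p q / 2"
  shows "subst_w (transport \<nu> p q f) g = f oo subst_w (transport \<nu> p q fps_X) g"
proof (rule fps_ext)
  define \<psi> where "\<psi> = subst_w (transport \<nu> p q fps_X) g"
  have r: "radius_ge (pde_radius p q) (sol \<nu> p q (- (fps_X ^ \<nu>)) 0 1)" by (rule radius_ge_sol) (auto simp: fps_X_power_nth)
  have \<psi>0: "\<psi> $ 0 = 0"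
    by (simp add: \<psi>_def transport_X subst_w_mult[OF radius_ge_const r g])
  fix k show "subst_w (transport \<nu> p q f) g $ k = (f oo \<psi>) $ k"
  proof (induction k arbitrary: f rule: less_induct)
    case (less k)
    define f' where "f' = fps_shift 1 f"
    have f: "f = fps_const (f $ 0) + fps_X * f'"
      by (rule fps_ext) (simp add: f'_def)
    have "subst_w (transport \<nu> p q f) g = fps_const (f $ 0) + \<psi> * subst_w (transport \<nu> p q f') g"
      by (subst f) (simp add: transport_add transport_mult transport_const \<psi>_def
          subst_w_add[OF radius_ge_const radius_ge_mult g] subst_w_mult[OF _ _ g] radius_ge_transport)
    moreover have "f oo \<psi> = fps_const (f $ 0) + \<psi> * (f' oo \<psi>)"
      by (subst f) (simp add: fps_compose_add_distrib fps_compose_mult_distrib \<psi>0)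
    moreover have "(\<psi> * subst_w (transport \<nu> p q f') g) $ k = (\<psi> * (f' oo \<psi>)) $ k"
      unfolding fps_mult_nth
    proof (rule sum.cong)
      fix i assume "i \<in> {0..k}"
      then show "\<psi> $ i * subst_w (transport \<nu> p q f') g $ (k - i) = \<psi> $ i * (f' oo \<psi>) $ (k - i)"
        using less.IH[of "k - i"] \<psi>0 by (cases "i = 0") auto
    qed simp
    ultimately show ?case by simp
  qed
qed

text \<open>Both sides have weight \<open>fps_deriv (pde_factor p q)\<close>, because \<Psi> has
  weight 0, and both equal x^(\<nu>+1) at w = 0. So the factor E is the speed of \<Psi> relative to
  \<delta>: the w-derivative of f(\<Psi>) is E (\<delta>f)(\<Psi>).\<close>

lemma deriv_transport_X:
  "fps_deriv (transport \<nu> p q fps_X) = sol \<nu> p q p (- 2 * q) 1 * transport \<nu> p q fps_X ^ Suc \<nu>"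
proof (rule pde_unique)
  have "fps_const p + fps_const (- 2 * q) * fps_X = fps_deriv (pde_factor p q)"
    by (simp add: fps_deriv_pde_factor algebra_simps numeral_fps_const flip: fps_const_mult fps_const_neg)
  then show "pde \<nu> p q (fps_deriv (pde_factor p q)) (sol \<nu> p q p (- 2 * q) 1 * transport \<nu> p q fps_X ^ Suc \<nu>)"
    using pde_mult[OF pde_sol[of \<nu> p q p "- 2 * q" 1] pde_0_power[OF pde_transport, of \<nu> p q fps_X "Suc \<nu>"]]
    by simp
  show "pde \<nu> p q (fps_deriv (pde_factor p q)) (fps_deriv (transport \<nu> p q fps_X))"
    using pde_deriv_iff[OF pde_transport] by (simp add: pde_def)
qed (simp add: fps_power_zeroth sol_def)

text \<open>These are the coefficients of y(\<Psi>) and (\<delta>y)(\<Psi>) in the condition that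
  the second w-derivative of T y(\<Psi>) vanishes for every solution y. Together with the data at w
  = 0 they encode T y(\<Psi>) = y + w \<delta>y.\<close>

lemma deriv_deriv_sol:
  fixes \<nu> :: nat and p q :: "complex fps"
  defines "T \<equiv> sol \<nu> p q 0 q 1" and "E \<equiv> sol \<nu> p q p (- 2 * q) 1"
  shows "fps_deriv (fps_deriv T) = - (E\<^sup>2 * T * transport \<nu> p q q)" (is ?A)
    and "E\<^sup>2 * T * transport \<nu> p q p = - 2 * E * fps_deriv T - fps_deriv E * T" (is ?B)
proof -
  let ?w = "fps_X :: complex fps fps" and ?p = "fps_const p" and ?q = "fps_const q"
  define c where "c = 2 * ?p - 3 * ?q * ?w"
  have two: "fps_const (- 2 * q) = - 2 * ?q"
    by (simp add: numeral_fps_const flip: fps_const_mult fps_const_neg)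
  have T: "pde \<nu> p q (?q * ?w) T"
    using pde_sol[of \<nu> p q 0 q 1] by (simp add: T_def)
  have "?p + fps_const (- 2 * q) * ?w = ?p - 2 * ?q * ?w"
    unfolding two by simp
  then have E: "pde \<nu> p q (?p - 2 * ?q * ?w) E"
    using pde_sol[of \<nu> p q p "- 2 * q" 1] unfolding E_def by (simp only:)
  have Td: "ddelta \<nu> T = pde_factor p q * fps_deriv T + ?q * ?w * T"
    using T by (simp add: pde_def)
  have T1: "ddelta \<nu> (fps_deriv T) = pde_factor p q * fps_deriv (fps_deriv T) + (?p - ?q * ?w) * fps_deriv T + ?q * T"
    using pde_deriv_iff[OF T] by (simp add: fps_deriv_pde_factor algebra_simps)
  \<comment> \<open>The first derivative of T drops out: the second w-derivative - 2 q of
    \<open>pde_factor\<close> cancels the 2 q that comes from differentiating the weight q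
    w.\<close>
  have T2: "ddelta \<nu> (fps_deriv (fps_deriv T)) =
      pde_factor p q * fps_deriv (fps_deriv (fps_deriv T)) + c * fps_deriv (fps_deriv T)"
    unfolding ddelta_fps_deriv[of \<nu> "fps_deriv T"] T1
    by (simp add: fps_deriv_pde_factor c_def algebra_simps)
  have Ed: "ddelta \<nu> E = pde_factor p q * fps_deriv E + (?p - 2 * ?q * ?w) * E"
    using E by (simp add: pde_def)
  have E1: "ddelta \<nu> (fps_deriv E) = pde_factor p q * fps_deriv (fps_deriv E) + 2 * (?p - 2 * ?q * ?w) * fps_deriv E - 2 * ?q * E"
    using pde_deriv_iff[OF E] by (simp add: fps_deriv_pde_factor algebra_simps)
  have "(a - 2 * b * w) + (a - 2 * b * w) + b * w + 0 = 2 * a - 3 * b * w" for a b w :: "complex fps fps"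
    by (simp add: algebra_simps)
  \<comment> \<open>Two factors of weight p - 2 q w, one of weight q w and one of weight 0 have
    total weight c.\<close>
  then have EET: "pde \<nu> p q c (E\<^sup>2 * T * transport \<nu> p q f)" for f
    using pde_mult[OF pde_mult[OF pde_mult[OF E E] T] pde_transport[of \<nu> p q f]]
    unfolding power2_eq_square c_def by (simp only:)
  have T0: "T $ 0 = 1" "T $ 1 = 0" "fps_deriv T $ 1 = - q" "E $ 0 = 1" "E $ 1 = - p"
    by (simp_all add: T_def E_def sol_def numeral_2_eq_2)
  show ?A
  proof (rule pde_unique)
    show "pde \<nu> p q c (fps_deriv (fps_deriv T))" using T2 by (simp add: pde_def)
    show "pde \<nu> p q c (- (E\<^sup>2 * T * transport \<nu> p q q))" by (rule pde_uminus[OF EET])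
    show "fps_deriv (fps_deriv T) $ 0 = (- (E\<^sup>2 * T * transport \<nu> p q q)) $ 0"
      using T0 by (simp add: fps_power_zeroth)
  qed
  show ?B
  proof (rule pde_unique[OF EET])
    show "pde \<nu> p q c (- 2 * E * fps_deriv T - fps_deriv E * T)"
    proof -
      have "ddelta \<nu> (2 :: complex fps fps) = 0"
        by (simp add: numeral_fps_const delta_op_def)
      then show ?thesis
        by (simp add: pde_def ddelta_diff ddelta_mult ddelta_uminus Td T1 Ed E1 c_def)
           (simp add: algebra_simps)
    qed
    show "(E\<^sup>2 * T * transport \<nu> p q p) $ 0 = (- 2 * E * fps_deriv T - fps_deriv E * T) $ 0"
      using T0 by (simp add: fps_power_zeroth)
  qed
qed

text \<open>The values of \<Psi>, T and E at w = g(x) are \<psi>, t and e; t' and e' are those of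
  the w-derivatives of T and E. Each identity for double series turns into one for power series in
  x, with h from \<open>delta_op_subst_w_pde\<close>.\<close>

lemma substitution_exists:
  fixes \<nu> :: nat and p q g :: "complex fps"
  assumes g: "norm (g $ 0) < pde_radius p q / 2"
  defines "h \<equiv> 1 + g * p - g\<^sup>2 * q + delta_op \<nu> g"
  obtains \<psi> t e t' e' where
    "\<psi> $ 0 = 0" "\<psi> $ 1 \<noteq> 0" "t $ 0 \<noteq> 0"
    "delta_op \<nu> \<psi> = \<psi> ^ Suc \<nu> * (h * e)"
    "delta_op \<nu> t = g * q * t + h * t'"
    "delta_op \<nu> e = (p - 2 * g * q) * e + h * e'"
    "delta_op \<nu> t' = q * t + (p - g * q) * t' - h * e\<^sup>2 * t * (q oo \<psi>)"
    "e\<^sup>2 * t * (p oo \<psi>) = - 2 * e * t' - e' * t"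
    "fps_conv_radius p > 0 \<Longrightarrow> fps_conv_radius q > 0 \<Longrightarrow> fps_conv_radius g > 0 \<Longrightarrow>
       fps_conv_radius \<psi> > 0 \<and> fps_conv_radius t > 0"
proof
  let ?w = "fps_X :: complex fps fps"
  define U where "U = sol \<nu> p q (- (fps_X ^ \<nu>)) 0 1"
  define T where "T = sol \<nu> p q 0 q 1"
  define E where "E = sol \<nu> p q p (- 2 * q) 1"
  define Psi where "Psi = transport \<nu> p q fps_X"
  have norm2: "norm (2 * z) = 2 * norm z" for z :: complex by (simp add: norm_mult)
  have c0: "norm (q $ 0) \<le> 2 * (1 + norm (p $ 0) + norm (q $ 0))"
    "norm (p $ 0) \<le> 2 * (1 + norm (p $ 0) + norm (q $ 0))"
    "norm ((- 2 * q) $ 0) \<le> 2 * (1 + norm (p $ 0) + norm (q $ 0))"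
    "norm ((- (fps_X ^ \<nu>)) $ 0 :: complex) \<le> 2 * (1 + norm (p $ 0) + norm (q $ 0))"
    by (auto simp: fps_X_power_nth norm2)
  have z0: "norm ((0 :: complex fps) $ 0) \<le> 2 * (1 + norm (p $ 0) + norm (q $ 0))" by simp
  have rU: "radius_ge (pde_radius p q) U" unfolding U_def by (intro radius_ge_sol c0 z0)
  have rT: "radius_ge (pde_radius p q) T" unfolding T_def by (intro radius_ge_sol c0 z0)
  have rE: "radius_ge (pde_radius p q) E" unfolding E_def by (intro radius_ge_sol c0 z0)
  have rP: "radius_ge (pde_radius p q) Psi" unfolding Psi_def by (rule radius_ge_transport)
  note [simp] = subst_w_add[OF _ _ g] subst_w_mult[OF _ _ g] subst_w_diff[OF _ _ g] subst_w_power[OF _ g] subst_w_uminus[OF _ g]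
    radius_ge_fps_deriv radius_ge_mult radius_ge_power radius_ge_add radius_ge_diff radius_ge_uminus rU rT rE rP radius_ge_transport
  define \<psi> where "\<psi> = subst_w Psi g"
  define t where "t = subst_w T g"
  define e where "e = subst_w E g"
  define t' where "t' = subst_w (fps_deriv T) g"
  define e' where "e' = subst_w (fps_deriv E) g"
  have "Psi = fps_const fps_X * U" by (simp add: Psi_def U_def transport_X)
  then have \<psi>U: "\<psi> = fps_X * subst_w U g" by (simp add: \<psi>_def)
  then show "\<psi> $ 0 = 0" by simp
  have rV: "radius_ge (pde_radius p q) (sol \<nu> p q (- (- (fps_X ^ \<nu>))) (- 0) 1)"
    by (intro radius_ge_sol) (auto simp: fps_X_power_nth)
  have "subst_w U g * subst_w (sol \<nu> p q (- (- (fps_X ^ \<nu>))) (- 0) 1) g = 1"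
    using subst_w_mult[OF rU rV g] pde_inverse_sol[of \<nu> p q "- (fps_X ^ \<nu>)" 0] unfolding U_def by (simp only: subst_w_1)
  then have "(subst_w U g * subst_w (sol \<nu> p q (- (- (fps_X ^ \<nu>))) (- 0) 1) g) $ 0 = 1" by simp
  then have "subst_w U g $ 0 \<noteq> 0" by (auto simp: fps_mult_nth_0)
  then show "\<psi> $ 1 \<noteq> 0" by (simp add: \<psi>U)
  have "norm ((- q) $ 0) \<le> 2 * (1 + norm (p $ 0) + norm (q $ 0))" "norm ((- 0 :: complex fps) $ 0) \<le> 2 * (1 + norm (p $ 0) + norm (q $ 0))"
    by simp_all
  then have rV': "radius_ge (pde_radius p q) (sol \<nu> p q (- 0) (- q) 1)"
    by (rule radius_ge_sol[rotated])
  have "subst_w T g * subst_w (sol \<nu> p q (- 0) (- q) 1) g = 1"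
    using subst_w_mult[OF rT rV' g] pde_inverse_sol[of \<nu> p q 0 q] unfolding T_def by (simp only: subst_w_1)
  then have "(subst_w T g * subst_w (sol \<nu> p q (- 0) (- q) 1) g) $ 0 = 1" by simp
  then show "t $ 0 \<noteq> 0" by (auto simp: t_def fps_mult_nth_0)
  have Q: "subst_w (transport \<nu> p q f) g = f oo \<psi>" for f
    unfolding \<psi>_def Psi_def by (rule subst_w_transport[OF g])
  have "2 = fps_const (2 :: complex fps)" by (rule numeral_fps_const)
  then have two: "subst_w 2 g = 2" "radius_ge (pde_radius p q) 2"
    using subst_w_const[of 2 g] radius_ge_const[of "pde_radius p q" 2] by (simp_all only:)
  have D: "delta_op \<nu> (subst_w F g) = subst_w c g * subst_w F g + h * subst_w (fps_deriv F) g"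
    if "pde \<nu> p q c F" "radius_ge (pde_radius p q) F" "radius_ge (pde_radius p q) c" for c F
    unfolding h_def by (rule delta_op_subst_w_pde[OF that g])
  have "fps_deriv Psi = E * Psi ^ Suc \<nu>"
    by (simp only: Psi_def E_def deriv_transport_X)
  then have Pd: "subst_w (fps_deriv Psi) g = e * \<psi> ^ Suc \<nu>"
    by (simp only: \<psi>_def e_def subst_w_mult[OF rE radius_ge_power[OF rP] g] subst_w_power[OF rP g])
  have "radius_ge (pde_radius p q) 0" using radius_ge_const[of "pde_radius p q" 0] by simp
  then have "delta_op \<nu> \<psi> = subst_w 0 g * \<psi> + h * subst_w (fps_deriv Psi) g"
    unfolding \<psi>_def Psi_def by (intro D pde_transport radius_ge_transport)
  then show "delta_op \<nu> \<psi> = \<psi> ^ Suc \<nu> * (h * e)"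
    unfolding Pd subst_w_0 by simp
  have "delta_op \<nu> t = subst_w (fps_const 0 + fps_const q * ?w) g * t + h * t'"
    unfolding t_def t'_def T_def
    by (rule D[OF pde_sol rT[unfolded T_def]]) (intro radius_ge_add radius_ge_mult radius_ge_const radius_ge_X)
  then show "delta_op \<nu> t = g * q * t + h * t'" by (simp add: mult_ac)
  have "delta_op \<nu> e = subst_w (fps_const p + fps_const (- 2 * q) * ?w) g * e + h * e'"
    unfolding e_def e'_def E_def
    by (rule D[OF pde_sol rE[unfolded E_def]]) (intro radius_ge_add radius_ge_mult radius_ge_const radius_ge_X)
  moreover have "subst_w (fps_const p + fps_const (- 2 * q) * ?w) g = p - 2 * g * q"
    by (simp only: subst_w_add[OF _ _ g] subst_w_mult[OF _ _ g] radius_ge_const radius_ge_X radius_ge_mult subst_w_const subst_w_X) (simp add: algebra_simps)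
  ultimately show "delta_op \<nu> e = (p - 2 * g * q) * e + h * e'" by (simp only:)
  have T: "pde \<nu> p q (fps_const q * ?w) T"
    using pde_sol[of \<nu> p q 0 q 1] by (simp add: T_def)
  have "ddelta \<nu> (fps_deriv T) =
      pde_factor p q * fps_deriv (fps_deriv T) + (fps_const p - fps_const q * ?w) * fps_deriv T + fps_const q * T"
    using pde_deriv_iff[OF T] by (simp add: fps_deriv_pde_factor algebra_simps)
  moreover have "subst_w (pde_factor p q) g = 1 + g * p - g\<^sup>2 * q"
    by (simp add: pde_factor_def mult.commute)
  ultimately have "subst_w (ddelta \<nu> (fps_deriv T)) g
      = (1 + g * p - g\<^sup>2 * q) * subst_w (fps_deriv (fps_deriv T)) g + (p - q * g) * t' + q * t"
    by (simp add: radius_ge_pde_factor t_def t'_def)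
  then have "delta_op \<nu> t' = q * t + (p - g * q) * t' + h * subst_w (fps_deriv (fps_deriv T)) g"
    unfolding t'_def using delta_op_subst_w[OF radius_ge_fps_deriv[OF rT] g, of \<nu>]
    by (simp add: h_def algebra_simps)
  moreover have "subst_w (fps_deriv (fps_deriv T)) g = - (e\<^sup>2 * t * (q oo \<psi>))"
  proof -
    have "fps_deriv (fps_deriv T) = - (E\<^sup>2 * T * transport \<nu> p q q)"
      unfolding T_def E_def by (rule deriv_deriv_sol(1))
    then show ?thesis by (simp add: e_def t_def Q)
  qed
  ultimately show "delta_op \<nu> t' = q * t + (p - g * q) * t' - h * e\<^sup>2 * t * (q oo \<psi>)"
    by (simp add: mult.assoc)
  have "subst_w (E\<^sup>2 * T * transport \<nu> p q p) g = subst_w (- 2 * E * fps_deriv T - fps_deriv E * T) g"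
    using deriv_deriv_sol(2)[of \<nu> p q] unfolding T_def E_def by (simp only:)
  then show "e\<^sup>2 * t * (p oo \<psi>) = - 2 * e * t' - e' * t"
    by (simp add: Q e_def t_def e'_def t'_def two)
  assume an: "fps_conv_radius p > 0" "fps_conv_radius q > 0" "fps_conv_radius g > 0"
  show "fps_conv_radius \<psi> > 0 \<and> fps_conv_radius t > 0"
    unfolding \<psi>_def Psi_def t_def T_def by (intro conjI subst_w_sol_convergent c0 z0 an g) simp_all
qed

text \<open>For z a solution of the equation with p', q' and y = s (z o \<phi>), the last two
  equations compare the coefficients of (\<delta>z) o \<phi> and z o \<phi> in \<delta>^2 y = p
  \<delta>y + q y. The series e is the speed of \<phi>: \<delta>(f o \<phi>) = e ((\<delta>f) o
  \<phi>).\<close>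

definition eq_pullback ::
  "nat \<Rightarrow> complex fps \<Rightarrow> complex fps \<Rightarrow> complex fps \<Rightarrow> complex fps \<Rightarrow> complex fps \<Rightarrow> complex fps \<Rightarrow> bool" where
  "eq_pullback \<nu> p q p' q' \<phi> s \<longleftrightarrow> \<phi> $ 0 = 0 \<and> \<phi> $ 1 \<noteq> 0 \<and> s $ 0 \<noteq> 0 \<and>
    (\<exists>e. delta_op \<nu> \<phi> = \<phi> ^ Suc \<nu> * e \<and>
      e * s * p = 2 * e * delta_op \<nu> s + s * delta_op \<nu> e + s * e\<^sup>2 * (p' oo \<phi>) \<and>
      s * q = delta_op \<nu> (delta_op \<nu> s) + s * e\<^sup>2 * (q' oo \<phi>) - p * delta_op \<nu> s)"

text \<open>The meaning is that y = a z + b \<delta>z solves the equation with p, q whenever z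
  solves the one with p', q'. The second row (c, d) of the gauge matrix is forced by \<delta>y = c z
  + d \<delta>z.\<close>

definition eq_gauge ::
  "nat \<Rightarrow> complex fps \<Rightarrow> complex fps \<Rightarrow> complex fps \<Rightarrow> complex fps \<Rightarrow> complex fps \<Rightarrow> complex fps \<Rightarrow> bool" where
  "eq_gauge \<nu> p q p' q' a b \<longleftrightarrow>
    (let c = delta_op \<nu> a + b * q'; d = a + delta_op \<nu> b + b * p' in
      delta_op \<nu> c + d * q' = q * a + p * c \<and> delta_op \<nu> d + c + d * p' = q * b + p * d \<and>
      (a * d - b * c) $ 0 \<noteq> 0)"

text \<open>With g = b / a one has a z + b \<delta>z = a (z + g \<delta>z) = a T(x, g) z(\<Psi>(x,
  g)). So \<phi> = \<psi>, s = a t, and the speed of \<psi> is h e.\<close>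

lemma eq_pullback_of_gauge:
  assumes G: "eq_gauge \<nu> p q p' q' a b" and a0: "a $ 0 \<noteq> 0" and small: "norm (b $ 0 / a $ 0) < pde_radius p' q' / 2"
  obtains \<phi> s where "eq_pullback \<nu> p q p' q' \<phi> s"
    "fps_conv_radius p' > 0 \<Longrightarrow> fps_conv_radius q' > 0 \<Longrightarrow> fps_conv_radius a > 0 \<Longrightarrow> fps_conv_radius b > 0 \<Longrightarrow>
       fps_conv_radius \<phi> > 0 \<and> fps_conv_radius s > 0"
proof -
  define g where "g = b * inverse a"
  define h where "h = 1 + g * p' - g\<^sup>2 * q' + delta_op \<nu> g"
  define c where "c = delta_op \<nu> a + b * q'"
  define d where "d = a + delta_op \<nu> b + b * p'"
  have b: "b = a * g" using inverse_mult_eq_1'[OF a0] by (simp add: g_def mult.left_commute)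
  have ane: "a \<noteq> 0" using a0 by auto
  have "g $ 0 = b $ 0 / a $ 0" by (simp add: g_def divide_inverse)
  then have g0: "norm (g $ 0) < pde_radius p' q' / 2" using small by simp
  show ?thesis
  proof (rule substitution_exists[OF g0, where \<nu> = \<nu>, folded h_def])
    fix \<psi> t e t' e' :: "complex fps"
    assume *: "\<psi> $ 0 = 0" "\<psi> $ 1 \<noteq> 0" "t $ 0 \<noteq> 0"
      "delta_op \<nu> \<psi> = \<psi> ^ Suc \<nu> * (h * e)"
    assume dt: "delta_op \<nu> t = g * q' * t + h * t'"
    assume de: "delta_op \<nu> e = (p' - 2 * g * q') * e + h * e'"
    assume dt': "delta_op \<nu> t' = q' * t + (p' - g * q') * t' - h * e\<^sup>2 * t * (q' oo \<psi>)"
    assume P: "e\<^sup>2 * t * (p' oo \<psi>) = - 2 * e * t' - e' * t"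
    assume an: "fps_conv_radius p' > 0 \<Longrightarrow> fps_conv_radius q' > 0 \<Longrightarrow> fps_conv_radius g > 0 \<Longrightarrow>
       fps_conv_radius \<psi> > 0 \<and> fps_conv_radius t > 0"
  have G1: "delta_op \<nu> c + d * q' = q * a + p * c" and G2: "delta_op \<nu> d + c + d * p' = q * b + p * d"
    using G by (simp_all add: eq_gauge_def Let_def c_def d_def)
  have dgc: "d = g * c + a * h"
    by (simp add: d_def c_def b h_def delta_op_mult algebra_simps power2_eq_square)
  have da: "delta_op \<nu> a = c - a * g * q'" by (simp add: c_def b)
  have da': "delta_op \<nu> a = c - b * q'" and db: "delta_op \<nu> b = d - a - b * p'"
    by (simp_all add: c_def d_def)
  have det: "a * d - b * c = a * a * h" by (simp add: dgc b algebra_simps)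
  \<comment> \<open>Liouville's formula: p and p' are the traces of the companion matrices, so
    \<delta> of the gauge determinant is p - p' times the determinant. With \<open>det\<close> and
    after division by a this becomes \<open>L\<close>.\<close>
  have "p * (a * d - b * c) = p' * (a * d - b * c) + delta_op \<nu> (a * d - b * c)"
  proof -
    have "p * (a * d - b * c) = a * (p * d) - b * (p * c)" by (simp add: algebra_simps)
    also have "\<dots> = a * (delta_op \<nu> d + c + d * p' - q * b) - b * (delta_op \<nu> c + d * q' - q * a)"
      using G1 G2 by simp
    finally show ?thesis
      by (simp only: delta_op_diff delta_op_mult da' db) (simp add: algebra_simps)
  qed
  then have "a * (a * h * p) = a * (2 * h * delta_op \<nu> a + a * delta_op \<nu> h + a * h * p')"
    unfolding det by (simp add: delta_op_mult algebra_simps)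
  then have L: "a * h * p = 2 * h * delta_op \<nu> a + a * delta_op \<nu> h + a * h * p'"
    using ane by simp
  have "eq_pullback \<nu> p q p' q' \<psi> (a * t)"
    unfolding eq_pullback_def
  proof (intro conjI exI)
    show "(a * t) $ 0 \<noteq> 0" using a0 *(3) by simp
    have "2 * (h * e) * delta_op \<nu> (a * t) + a * t * delta_op \<nu> (h * e) + a * t * (h * e)\<^sup>2 * (p' oo \<psi>)
        = 2 * (h * e) * delta_op \<nu> (a * t) + a * t * delta_op \<nu> (h * e) + a * h\<^sup>2 * (e\<^sup>2 * t * (p' oo \<psi>))"
      by (simp add: power_mult_distrib algebra_simps)
    also have "\<dots> = t * e * (2 * h * delta_op \<nu> a + a * delta_op \<nu> h + a * h * p')"
      unfolding P by (simp add: delta_op_mult dt de) (simp add: algebra_simps power2_eq_square)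
    also have "\<dots> = h * e * (a * t) * p" unfolding L[symmetric] by (simp add: algebra_simps)
    finally show "h * e * (a * t) * p = 2 * (h * e) * delta_op \<nu> (a * t) + a * t * delta_op \<nu> (h * e)
        + a * t * (h * e)\<^sup>2 * (p' oo \<psi>)" by simp
    have dat: "delta_op \<nu> (a * t) = c * t + a * h * t'"
      by (simp add: delta_op_mult dt da) (simp add: algebra_simps)
    have Q: "a * t * (h * e)\<^sup>2 * (q' oo \<psi>) = a * h * (q' * t + (p' - g * q') * t' - delta_op \<nu> t')"
      unfolding dt' by (simp add: algebra_simps power2_eq_square)
    have "delta_op \<nu> (delta_op \<nu> (a * t)) + a * t * (h * e)\<^sup>2 * (q' oo \<psi>)
       = t * (delta_op \<nu> c + d * q') + t' * (2 * h * delta_op \<nu> a + a * delta_op \<nu> h + a * h * p')"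
      unfolding Q dat by (simp add: delta_op_add delta_op_mult dt da dgc) (simp add: algebra_simps)
    then show "a * t * q = delta_op \<nu> (delta_op \<nu> (a * t)) + a * t * (h * e)\<^sup>2 * (q' oo \<psi>) - p * delta_op \<nu> (a * t)"
      unfolding G1 L[symmetric] dat by (simp add: algebra_simps)
  qed (use * in simp_all)
  moreover have "fps_conv_radius \<psi> > 0 \<and> fps_conv_radius (a * t) > 0"
    if r: "fps_conv_radius p' > 0" "fps_conv_radius q' > 0" "fps_conv_radius a > 0" "fps_conv_radius b > 0"
  proof -
    have "fps_conv_radius (inverse a) > 0" using r a0 by (intro fps_conv_radius_inverse_pos)
    then have "fps_conv_radius g > 0"
      unfolding g_def using r by (intro less_le_trans[OF _ fps_conv_radius_mult]) simp
    with an r have "fps_conv_radius \<psi> > 0" "fps_conv_radius t > 0" by auto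
    then show ?thesis
      using r by (auto intro: less_le_trans[OF _ fps_conv_radius_mult])
  qed
  ultimately show ?thesis using that by blast
  qed
qed

section \<open>Convergence and composition of point transformations\<close>

lemma fps_conv_radius_compose_pos:
  fixes f g :: "complex fps"
  assumes "fps_conv_radius f > 0" "fps_conv_radius g > 0" "g $ 0 = 0"
  shows "fps_conv_radius (f oo g) > 0"
proof -
  have "(eval_fps f \<circ> eval_fps g) has_fps_expansion (f oo g)"
    using assms by (intro has_fps_expansion_compose) (auto simp: has_fps_expansion_def)
  then show ?thesis by (simp add: has_fps_expansion_def)
qed

lemma fps_conv_radius_mult_pos:
  fixes f g :: "complex fps"
  assumes "fps_conv_radius f > 0" "fps_conv_radius g > 0"
  shows "fps_conv_radius (f * g) > 0"
  using assms by (intro less_le_trans[OF _ fps_conv_radius_mult]) simp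

lemma fps_conv_radius_add_pos:
  fixes f g :: "complex fps"
  assumes "fps_conv_radius f > 0" "fps_conv_radius g > 0"
  shows "fps_conv_radius (f + g) > 0"
  using assms by (intro less_le_trans[OF _ fps_conv_radius_add]) simp

lemma fps_conv_radius_diff_pos:
  fixes f g :: "complex fps"
  assumes "fps_conv_radius f > 0" "fps_conv_radius g > 0"
  shows "fps_conv_radius (f - g) > 0"
  using assms by (intro less_le_trans[OF _ fps_conv_radius_diff]) simp

lemma fps_conv_radius_delta_op_pos:
  assumes "fps_conv_radius f > 0"
  shows "fps_conv_radius (delta_op \<nu> f) > 0"
  unfolding delta_op_def using less_le_trans[OF assms fps_conv_radius_deriv]
  by (intro fps_conv_radius_mult_pos) (simp_all del: power_Suc)

lemma fps_conv_radius_power_pos: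
  fixes f :: "complex fps"
  assumes "fps_conv_radius f > 0"
  shows "fps_conv_radius (f ^ n) > 0"
  by (rule less_le_trans[OF assms fps_conv_radius_power])

lemmas fps_conv_radius_pos_intros =
  fps_conv_radius_mult_pos fps_conv_radius_add_pos fps_conv_radius_diff_pos fps_conv_radius_power_pos
  fps_conv_radius_delta_op_pos

lemma delta_op_compose:
  assumes "\<phi> $ 0 = 0" "delta_op \<nu> \<phi> = \<phi> ^ Suc \<nu> * e"
  shows "delta_op \<nu> (f oo \<phi>) = e * (delta_op \<nu> f oo \<phi>)"
proof -
  have "delta_op \<nu> (f oo \<phi>) = (fps_deriv f oo \<phi>) * delta_op \<nu> \<phi>"
    using assms(1) by (simp add: delta_op_def fps_compose_deriv)
  also have "\<dots> = e * ((fps_X ^ Suc \<nu> oo \<phi>) * (fps_deriv f oo \<phi>))"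
    using assms by (simp add: fps_X_power_compose del: power_Suc)
  finally show ?thesis using assms(1) by (simp add: delta_op_def fps_compose_mult_distrib)
qed

text \<open>For z = r (z2 o \<psi>), with z2 a solution of the equation with p'', q'', one gets s (z
  o \<phi>) = s (r o \<phi>) (z2 o (\<psi> o \<phi>)). By the chain rule the speed is e (f o
  \<phi>).\<close>

lemma eq_pullback_trans:
  assumes 1: "eq_pullback \<nu> p q p' q' \<phi> s" and 2: "eq_pullback \<nu> p' q' p'' q'' \<psi> r"
  shows "eq_pullback \<nu> p q p'' q'' (\<psi> oo \<phi>) (s * (r oo \<phi>))"
proof -
  obtain e where \<phi>: "\<phi> $ 0 = 0" "\<phi> $ 1 \<noteq> 0" "s $ 0 \<noteq> 0" and e: "delta_op \<nu> \<phi> = \<phi> ^ Suc \<nu> * e"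
    and p: "e * s * p = 2 * e * delta_op \<nu> s + s * delta_op \<nu> e + s * e\<^sup>2 * (p' oo \<phi>)"
    and q: "s * q = delta_op \<nu> (delta_op \<nu> s) + s * e\<^sup>2 * (q' oo \<phi>) - p * delta_op \<nu> s"
    using 1 unfolding eq_pullback_def by blast
  obtain f where \<psi>: "\<psi> $ 0 = 0" "\<psi> $ 1 \<noteq> 0" "r $ 0 \<noteq> 0" and f: "delta_op \<nu> \<psi> = \<psi> ^ Suc \<nu> * f"
    and p': "f * r * p' = 2 * f * delta_op \<nu> r + r * delta_op \<nu> f + r * f\<^sup>2 * (p'' oo \<psi>)"
    and q': "r * q' = delta_op \<nu> (delta_op \<nu> r) + r * f\<^sup>2 * (q'' oo \<psi>) - p' * delta_op \<nu> r"
    using 2 unfolding eq_pullback_def by blast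
  note dist = fps_compose_mult_distrib[OF \<phi>(1)] fps_compose_add_distrib fps_compose_sub_distrib
  define E S P' Q' P Q \<sigma> where "E = f oo \<phi>" and "S = r oo \<phi>" and "P' = p' oo \<phi>" and "Q' = q' oo \<phi>"
    and "P = p'' oo (\<psi> oo \<phi>)" and "Q = q'' oo (\<psi> oo \<phi>)" and "\<sigma> = delta_op \<nu> r oo \<phi>"
  have assoc: "(g oo \<psi>) oo \<phi> = g oo (\<psi> oo \<phi>)" for g
    using fps_compose_assoc[OF \<phi>(1) \<psi>(1)] by simp
  have dS: "delta_op \<nu> S = e * \<sigma>" and dE: "delta_op \<nu> E = e * (delta_op \<nu> f oo \<phi>)"
    and d\<sigma>: "delta_op \<nu> \<sigma> = e * (delta_op \<nu> (delta_op \<nu> r) oo \<phi>)"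
    unfolding S_def \<sigma>_def E_def by (rule delta_op_compose[OF \<phi>(1) e])+
  have two: "2 oo \<phi> = 2"
    by (simp add: numeral_fps_const)
  have P': "E * S * P' = 2 * E * \<sigma> + S * (delta_op \<nu> f oo \<phi>) + S * E\<^sup>2 * P"
    using arg_cong[OF p', of "\<lambda>g. g oo \<phi>"]
    by (simp add: dist assoc two power2_eq_square E_def S_def P'_def P_def \<sigma>_def)
  have Q': "S * Q' = (delta_op \<nu> (delta_op \<nu> r) oo \<phi>) + S * E\<^sup>2 * Q - P' * \<sigma>"
    using arg_cong[OF q', of "\<lambda>g. g oo \<phi>"]
    by (simp add: dist assoc power2_eq_square E_def S_def P'_def Q_def Q'_def \<sigma>_def)
  show ?thesis
    unfolding eq_pullback_def S_def[symmetric]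
  proof (intro conjI exI)
    show "(\<psi> oo \<phi>) $ 0 = 0" using \<psi> by simp
    have "(\<psi> oo \<phi>) $ 1 = \<psi> $ 1 * \<phi> $ 1"
      using \<phi> \<psi> by (simp add: fps_compose_nth)
    then show "(\<psi> oo \<phi>) $ 1 \<noteq> 0" using \<phi> \<psi> by simp
    show "(s * S) $ 0 \<noteq> 0" using \<phi> \<psi> by (simp add: S_def)
    have "delta_op \<nu> (\<psi> oo \<phi>) = e * (\<psi> ^ Suc \<nu> * f oo \<phi>)"
      using delta_op_compose[OF \<phi>(1) e, of \<psi>] f by simp
    then show "delta_op \<nu> (\<psi> oo \<phi>) = (\<psi> oo \<phi>) ^ Suc \<nu> * (e * E)"
      by (simp add: dist fps_compose_power[OF \<phi>(1)] E_def del: power_Suc)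
    have "e * E * (s * S) * p = E * S * (e * s * p)" by simp
    also have "\<dots> = E * S * (2 * e * delta_op \<nu> s + s * delta_op \<nu> e) + s * e\<^sup>2 * (E * S * P')"
      unfolding p by (simp add: P'_def algebra_simps)
    also have "\<dots> = 2 * (e * E) * delta_op \<nu> (s * S) + s * S * delta_op \<nu> (e * E) + s * S * (e * E)\<^sup>2 * P"
      unfolding P' delta_op_mult dS dE by (simp add: algebra_simps power2_eq_square)
    finally show "e * E * (s * S) * p =
        2 * (e * E) * delta_op \<nu> (s * S) + s * S * delta_op \<nu> (e * E) + s * S * (e * E)\<^sup>2 * (p'' oo (\<psi> oo \<phi>))"
      unfolding P_def .
    have "s * S * q = S * (s * q)" by simp
    also have "\<dots> = S * (delta_op \<nu> (delta_op \<nu> s) - p * delta_op \<nu> s) + s * e\<^sup>2 * (S * Q')"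
      unfolding q by (simp add: Q'_def algebra_simps)
    also have "\<dots> = S * (delta_op \<nu> (delta_op \<nu> s) - p * delta_op \<nu> s)
        + s * e\<^sup>2 * ((delta_op \<nu> (delta_op \<nu> r) oo \<phi>) + S * E\<^sup>2 * Q) - \<sigma> * (s * e\<^sup>2 * P')"
      unfolding Q' by (simp add: algebra_simps)
    \<comment> \<open>The first pullback equation, read backwards, eliminates p' o \<phi>, which is
      absent from the claim.\<close>
    also have "s * e\<^sup>2 * P' = e * s * p - 2 * e * delta_op \<nu> s - s * delta_op \<nu> e"
      unfolding p by (simp add: P'_def)
    also have "S * (delta_op \<nu> (delta_op \<nu> s) - p * delta_op \<nu> s)
        + s * e\<^sup>2 * ((delta_op \<nu> (delta_op \<nu> r) oo \<phi>) + S * E\<^sup>2 * Q)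
        - \<sigma> * (e * s * p - 2 * e * delta_op \<nu> s - s * delta_op \<nu> e)
      = delta_op \<nu> (delta_op \<nu> (s * S)) + s * S * (e * E)\<^sup>2 * Q - p * delta_op \<nu> (s * S)"
      by (simp add: delta_op_mult delta_op_add dS d\<sigma>) (simp add: algebra_simps power2_eq_square)
    finally show "s * S * q = delta_op \<nu> (delta_op \<nu> (s * S)) + s * S * (e * E)\<^sup>2 * (q'' oo (\<psi> oo \<phi>))
        - p * delta_op \<nu> (s * S)"
      unfolding Q_def .
  qed
qed

section \<open>Division and existence of gauge transformations\<close>

lemma gauge_row_mult:
  assumes M: "delta_op \<nu> c1 + d1 * q' = q1 * a1 + p1 * c1" "delta_op \<nu> d1 + c1 + d1 * p' = q1 * b1 + p1 * d1"
    and c1: "c1 = delta_op \<nu> a1 + b1 * q'" and d1: "d1 = a1 + delta_op \<nu> b1 + b1 * p'"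
    and a: "a = u * a1 + v * c1" and b: "b = u * b1 + v * d1"
  shows "delta_op \<nu> a + b * q' = (delta_op \<nu> u + v * q1) * a1 + (u + delta_op \<nu> v + v * p1) * c1"
    and "a + delta_op \<nu> b + b * p' = (delta_op \<nu> u + v * q1) * b1 + (u + delta_op \<nu> v + v * p1) * d1"
proof -
  have da: "delta_op \<nu> a1 = c1 - b1 * q'" and db: "delta_op \<nu> b1 = d1 - a1 - b1 * p'"
    using c1 d1 by simp_all
  have dc: "delta_op \<nu> c1 = q1 * a1 + p1 * c1 - d1 * q'"
    and dd: "delta_op \<nu> d1 = q1 * b1 + p1 * d1 - c1 - d1 * p'"
    using M by (simp_all add: algebra_simps)
  show "delta_op \<nu> a + b * q' = (delta_op \<nu> u + v * q1) * a1 + (u + delta_op \<nu> v + v * p1) * c1"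
    unfolding a b delta_op_add delta_op_mult da dc by (simp add: algebra_simps)
  show "a + delta_op \<nu> b + b * p' = (delta_op \<nu> u + v * q1) * b1 + (u + delta_op \<nu> v + v * p1) * d1"
    unfolding a b delta_op_add delta_op_mult db dd by (simp add: algebra_simps)
qed

lemma linear_system_0:
  fixes x y :: "complex fps"
  assumes "x * a + y * c = 0" "x * b + y * d = 0" "a * d - b * c \<noteq> 0"
  shows "x = 0" "y = 0"
proof -
  have "x * (a * d - b * c) = d * (x * a + y * c) - c * (x * b + y * d)" by (simp add: algebra_simps)
  then show "x = 0" using assms by simp
  have "y * (a * d - b * c) = a * (x * b + y * d) - b * (x * a + y * c)" by (simp add: algebra_simps)
  then show "y = 0" using assms by simp
qed

text \<open>For the gauge matrices M with first row (a, b) and M1 with first row (a1, b1), the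
  assumptions say that (u, v) is the first row of M M1^(-1). \<open>gauge_row_mult\<close> yields
  the second row, and applied once more the \<delta>-derivative of that row.\<close>

lemma eq_gauge_cancel:
  assumes G: "eq_gauge \<nu> p q p' q' a b" and G1: "eq_gauge \<nu> p1 q1 p' q' a1 b1"
    and a: "a = u * a1 + v * (delta_op \<nu> a1 + b1 * q')"
    and b: "b = u * b1 + v * (a1 + delta_op \<nu> b1 + b1 * p')"
  shows "eq_gauge \<nu> p q p1 q1 u v"
proof -
  define c d where "c = delta_op \<nu> a + b * q'" and "d = a + delta_op \<nu> b + b * p'"
  define c1 d1 where c1: "c1 = delta_op \<nu> a1 + b1 * q'" and d1: "d1 = a1 + delta_op \<nu> b1 + b1 * p'"
  define u' v' where "u' = delta_op \<nu> u + v * q1" and "v' = u + delta_op \<nu> v + v * p1"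
  have M: "delta_op \<nu> c1 + d1 * q' = q1 * a1 + p1 * c1" "delta_op \<nu> d1 + c1 + d1 * p' = q1 * b1 + p1 * d1"
    and D1: "(a1 * d1 - b1 * c1) $ 0 \<noteq> 0"
    using G1 by (simp_all add: eq_gauge_def Let_def c1 d1)
  have T: "delta_op \<nu> c + d * q' = q * a + p * c" "delta_op \<nu> d + c + d * p' = q * b + p * d"
    and D: "(a * d - b * c) $ 0 \<noteq> 0"
    using G by (simp_all add: eq_gauge_def Let_def c_def d_def)
  have a': "a = u * a1 + v * c1" and b': "b = u * b1 + v * d1" using a b by (simp_all add: c1 d1)
  have c': "c = u' * a1 + v' * c1" and d': "d = u' * b1 + v' * d1"
    using gauge_row_mult[OF M c1 d1 a' b'] by (simp_all add: c_def d_def u'_def v'_def)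
  have r: "delta_op \<nu> c + d * q' = (delta_op \<nu> u' + v' * q1) * a1 + (u' + delta_op \<nu> v' + v' * p1) * c1"
    "c + delta_op \<nu> d + d * p' = (delta_op \<nu> u' + v' * q1) * b1 + (u' + delta_op \<nu> v' + v' * p1) * d1"
    using gauge_row_mult[OF M c1 d1 c' d'] by simp_all
  \<comment> \<open>The defects in the two equations claimed for (u, v). Multiplied by the
    invertible M1 they become the defects for (a, b), which are zero.\<close>
  define x y where "x = delta_op \<nu> u' + v' * q1 - (q * u + p * u')"
    and "y = u' + delta_op \<nu> v' + v' * p1 - (q * v + p * v')"
  have "x * a1 + y * c1 = (delta_op \<nu> c + d * q') - (q * a + p * c)"
    unfolding r(1) unfolding x_def y_def a' c' by (simp add: algebra_simps)
  moreover have "x * b1 + y * d1 = (c + delta_op \<nu> d + d * p') - (q * b + p * d)"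
    unfolding r(2) unfolding x_def y_def b' d' by (simp add: algebra_simps)
  moreover have "a1 * d1 - b1 * c1 \<noteq> 0" using D1 by (metis fps_zero_nth)
  ultimately have "x = 0" "y = 0"
    using linear_system_0[of x a1 y c1 b1 d1] T by (simp_all add: add_ac)
  moreover have "a * d - b * c = (u * v' - v * u') * (a1 * d1 - b1 * c1)"
    unfolding a' b' c' d' by (simp add: algebra_simps)
  then have "(u * v' - v * u') $ 0 \<noteq> 0" using D by (auto simp: fps_mult_nth_0)
  ultimately show ?thesis
    unfolding eq_gauge_def Let_def u'_def[symmetric] v'_def[symmetric]
    by (simp add: x_def y_def add_ac)
qed

text \<open>At x = 0 the \<delta>-terms vanish and the gauge matrix is a(0) + b(0) A'(0), with A'
  the companion matrix of p', q'. It commutes with A'(0), so conjugation by it changes nothing. Its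
  determinant is the expression in the third claim.\<close>

lemma eq_gauge_nth_0:
  assumes "eq_gauge \<nu> p q p' q' a b"
  shows "p $ 0 = p' $ 0" "q $ 0 = q' $ 0" "(a $ 0)\<^sup>2 + a $ 0 * b $ 0 * p' $ 0 - (b $ 0)\<^sup>2 * q' $ 0 \<noteq> 0"
proof -
  define c d where "c = b $ 0 * q' $ 0" and "d = a $ 0 + b $ 0 * p' $ 0"
  have 1: "d * q' $ 0 = q $ 0 * a $ 0 + p $ 0 * c"
    using arg_cong[of _ _ "\<lambda>f. f $ 0", OF conjunct1[OF assms[unfolded eq_gauge_def Let_def]]]
    by (simp add: c_def d_def)
  have 2: "c + d * p' $ 0 = q $ 0 * b $ 0 + p $ 0 * d"
    using arg_cong[of _ _ "\<lambda>f. f $ 0", OF conjunct1[OF conjunct2[OF assms[unfolded eq_gauge_def Let_def]]]]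
    by (simp add: c_def d_def)
  have D: "a $ 0 * d - b $ 0 * c \<noteq> 0"
    using assms by (simp add: eq_gauge_def Let_def c_def d_def)
  then show "(a $ 0)\<^sup>2 + a $ 0 * b $ 0 * p' $ 0 - (b $ 0)\<^sup>2 * q' $ 0 \<noteq> 0"
    by (simp add: c_def d_def algebra_simps power2_eq_square)
  have e1: "(q $ 0 - q' $ 0) * a $ 0 + (p $ 0 - p' $ 0) * c = 0"
    using 1 by (simp add: algebra_simps) (simp add: c_def d_def algebra_simps)
  have e2: "(q $ 0 - q' $ 0) * b $ 0 + (p $ 0 - p' $ 0) * d = 0"
    using 2 by (simp add: algebra_simps) (simp add: c_def d_def algebra_simps)
  have "(p $ 0 - p' $ 0) * (a $ 0 * d - b $ 0 * c) = a $ 0 * ((q $ 0 - q' $ 0) * b $ 0 + (p $ 0 - p' $ 0) * d)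
     - b $ 0 * ((q $ 0 - q' $ 0) * a $ 0 + (p $ 0 - p' $ 0) * c)" by (simp add: algebra_simps)
  then show "p $ 0 = p' $ 0" using D e1 e2 by simp
  have "(q $ 0 - q' $ 0) * (a $ 0 * d - b $ 0 * c) = d * ((q $ 0 - q' $ 0) * a $ 0 + (p $ 0 - p' $ 0) * c)
     - c * ((q $ 0 - q' $ 0) * b $ 0 + (p $ 0 - p' $ 0) * d)" by (simp add: algebra_simps)
  then show "q $ 0 = q' $ 0" using D e1 e2 by simp
qed

text \<open>The gauge equations are linear in p and q with the gauge determinant as determinant, so
  Cramer's rule applies. This supplies the intermediate equations when a gauge transformation is
  split into factors.\<close>

lemma eq_gauge_exists:
  fixes a b :: "complex fps"
  assumes "(a * (a + delta_op \<nu> b + b * p') - b * (delta_op \<nu> a + b * q')) $ 0 \<noteq> 0"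
  obtains p q where "eq_gauge \<nu> p q p' q' a b"
    "fps_conv_radius p' > 0 \<Longrightarrow> fps_conv_radius q' > 0 \<Longrightarrow> fps_conv_radius a > 0 \<Longrightarrow> fps_conv_radius b > 0 \<Longrightarrow>
       fps_conv_radius p > 0 \<and> fps_conv_radius q > 0"
proof -
  define c d where "c = delta_op \<nu> a + b * q'" and "d = a + delta_op \<nu> b + b * p'"
  define D where "D = a * d - b * c"
  define x y where "x = delta_op \<nu> c + d * q'" and "y = delta_op \<nu> d + c + d * p'"
  define p q where "p = (a * y - b * x) * inverse D" and "q = (d * x - c * y) * inverse D"
  have D0: "D $ 0 \<noteq> 0" using assms by (simp add: D_def c_def d_def)
  have D: "D * inverse D = 1" by (rule inverse_mult_eq_1'[OF D0])
  have "q * a + p * c = x * (D * inverse D)" "q * b + p * d = y * (D * inverse D)"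
    by (simp_all add: p_def q_def D_def algebra_simps)
  then have "q * a + p * c = x" "q * b + p * d = y" by (simp_all only: D mult_1_right)
  then have "eq_gauge \<nu> p q p' q' a b"
    using D0 unfolding eq_gauge_def Let_def D_def c_def d_def x_def y_def by simp
  moreover have "fps_conv_radius p > 0 \<and> fps_conv_radius q > 0"
    if "fps_conv_radius p' > 0" "fps_conv_radius q' > 0" "fps_conv_radius a > 0" "fps_conv_radius b > 0"
  proof -
    have "fps_conv_radius D > 0"
      unfolding D_def c_def d_def using that by (intro fps_conv_radius_pos_intros)
    then have "fps_conv_radius (inverse D) > 0" using D0 by (intro fps_conv_radius_inverse_pos)
    then show ?thesis
      unfolding p_def q_def x_def y_def c_def d_def using that by (intro conjI fps_conv_radius_pos_intros)
  qed
  ultimately show ?thesis using that by blast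
qed

section \<open>Splitting a gauge transformation into factors that are small at 0\<close>

text \<open>The pair \<open>(a, b)\<close> stands for the residue class of $a + b z$ modulo $z^2 - p_0 z - q_0$;
  \<open>unit_power p0 q0 w c n\<close> represents $c (1 + w z)^n$.\<close>

primrec unit_power :: "complex \<Rightarrow> complex \<Rightarrow> complex \<Rightarrow> complex \<Rightarrow> nat \<Rightarrow> complex \<times> complex" where
  "unit_power p0 q0 w c 0 = (c, 0)"
| "unit_power p0 q0 w c (Suc n) = (let (a, b) = unit_power p0 q0 w c n in
     (a + b * w * q0, a * w + b * (1 + w * p0)))"

text \<open>Evaluation at a root of z^2 - p0 z - q0 is a ring homomorphism on the quotient.\<close>

lemma unit_power_eval:
  assumes "l\<^sup>2 = p0 * l + q0"
  shows "fst (unit_power p0 q0 w c n) + snd (unit_power p0 q0 w c n) * l = c * (1 + w * l) ^ n"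
proof (induction n)
  case (Suc n)
  obtain a b where ab: "unit_power p0 q0 w c n = (a, b)" by force
  have "(a + b * w * q0) + (a * w + b * (1 + w * p0)) * l
      = (a + b * l) * (1 + w * l) + b * w * (p0 * l + q0 - l\<^sup>2)"
    by (simp add: algebra_simps power2_eq_square)
  then show ?case using Suc ab assms by (simp add: Let_def)
qed simp

text \<open>At a double root the coefficient of z is the derivative there, n c w (1 + w l)^(n-1).
  The extra factor 1 + w l avoids the exponent n - 1.\<close>

lemma unit_power_snd_double_root:
  assumes "p0 = 2 * l" "q0 = - l\<^sup>2"
  shows "snd (unit_power p0 q0 w c n) * (1 + w * l) = of_nat n * c * w * (1 + w * l) ^ n"
proof (induction n)
  case (Suc n)
  obtain a b where ab: "unit_power p0 q0 w c n = (a, b)" by force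
  have e: "a + b * l = c * (1 + w * l) ^ n"
    using unit_power_eval[of l p0 q0 w c n] assms ab by (simp add: power2_eq_square)
  have IH: "b * (1 + w * l) = of_nat n * c * w * (1 + w * l) ^ n" using Suc ab by simp
  have "a * w + b * (1 + w * p0) = (a + b * l) * w + b * (1 + w * l)"
    by (simp add: assms algebra_simps)
  then have "snd (unit_power p0 q0 w c (Suc n)) = (1 + of_nat n) * (c * w * (1 + w * l) ^ n)"
    using ab unfolding e IH by (simp add: algebra_simps)
  then show ?case by (simp add: mult_ac)
qed simp

lemma pair_eqI_roots:
  fixes a b :: complex
  assumes "a + b * l = a' + b' * l" "a + b * m = a' + b' * m" "l \<noteq> m"
  shows "a = a'" "b = b'"
proof -
  have "(b - b') * (l - m) = (a + b * l) - (a' + b' * l) - ((a + b * m) - (a' + b' * m))"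
    by (simp add: algebra_simps)
  then show "b = b'" using assms by simp
  then show "a = a'" using assms by simp
qed

text \<open>A unit of $\mathbb{C}[z]/(z^2 - p_0 z - q_0)$ is a multiple of an exponential, hence of an $n$-th power of
  some $1 + w z$ with $w \to 0$ as $n \to \infty$.\<close>

lemma unit_power_exists:
  fixes a b p0 q0 :: complex
  assumes nz: "a\<^sup>2 + a * b * p0 - b\<^sup>2 * q0 \<noteq> 0" and r: "r > 0"
  shows "\<exists>w c n. norm w < r \<and> (a, b) = unit_power p0 q0 w c n"
proof -
  define D where "D = csqrt (p0\<^sup>2 + 4 * q0)"
  define l m where "l = (p0 + D) / 2" and "m = (p0 - D) / 2"
  have D: "D\<^sup>2 = p0\<^sup>2 + 4 * q0" by (simp add: D_def)
  have p0: "p0 = l + m" by (simp add: l_def m_def field_simps)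
  have "4 * (l * m) = p0\<^sup>2 - D\<^sup>2" by (simp add: l_def m_def field_simps power2_eq_square)
  then have q0: "q0 = - (l * m)" by (simp add: D)
  have roots: "l\<^sup>2 = p0 * l + q0" "m\<^sup>2 = p0 * m + q0"
    by (simp_all add: p0 q0 algebra_simps power2_eq_square)
  have "(a + b * l) * (a + b * m) = a\<^sup>2 + a * b * p0 - b\<^sup>2 * q0"
    by (simp add: p0 q0 algebra_simps power2_eq_square)
  then have nz: "a + b * l \<noteq> 0" "a + b * m \<noteq> 0" using nz by auto
  have lim: "(\<lambda>n. L / of_nat n) \<longlonglongrightarrow> 0" for L :: complex
    by (rule lim_const_over_n)
  show ?thesis
  proof (cases "l = m")
    case False
    define L where "L = Ln ((a + b * l) / (a + b * m))"
    define rr where "rr n = exp (L / of_nat n)" for n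
    \<comment> \<open>The solution of (1 + w l) / (1 + w m) = rr n, where rr n is an n-th root of
      the quotient of the values of a + b z at l and m. It tends to 0, as rr n tends to 1 and l
      \<noteq> m.\<close>
    define w where "w n = (rr n - 1) / (l - rr n * m)" for n
    have rr: "rr \<longlonglongrightarrow> exp 0" unfolding rr_def by (intro tendsto_exp lim)
    then have "w \<longlonglongrightarrow> (1 - 1) / (l - 1 * m)"
      unfolding w_def using False by (intro tendsto_intros) auto
    then have "(\<lambda>n. norm (w n)) \<longlonglongrightarrow> 0" by (intro tendsto_norm_zero) simp
    then have ev1: "eventually (\<lambda>n. norm (w n) < r) sequentially"
      using r by (rule order_tendstoD(2))
    have "(\<lambda>n. l - rr n * m) \<longlonglongrightarrow> l - exp 0 * m" by (intro tendsto_intros rr)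
    then have ev2: "eventually (\<lambda>n. l - rr n * m \<noteq> 0) sequentially"
      using False by (intro tendsto_imp_eventually_ne) auto
    obtain n where n: "norm (w n) < r" "l - rr n * m \<noteq> 0" "n > 0"
      using eventually_happens[OF eventually_conj[OF ev1 eventually_conj[OF ev2 eventually_gt_at_top[of 0]]]]
      by auto
    have "rr n ^ n = exp L" using n by (simp add: rr_def flip: exp_of_nat_mult)
    then have rn: "rr n ^ n * (a + b * m) = a + b * l" using nz by (simp add: L_def)
    have wz: "w n * (l - rr n * m) = rr n - 1" using n(2) by (simp add: w_def)
    have "(1 + w n * m) * (l - rr n * m) = (l - rr n * m) + w n * (l - rr n * m) * m"
      by (simp add: algebra_simps)
    also have "\<dots> = l - m" unfolding wz by (simp add: algebra_simps)
    finally have wm': "(1 + w n * m) * (l - rr n * m) = l - m" .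
    have "(1 + w n * l) * (l - rr n * m) = (l - rr n * m) + w n * (l - rr n * m) * l"
      by (simp add: algebra_simps)
    also have "\<dots> = rr n * (l - m)" unfolding wz by (simp add: algebra_simps)
    finally have wl': "(1 + w n * l) * (l - rr n * m) = rr n * (l - m)" .
    have wm: "1 + w n * m = (l - m) / (l - rr n * m)" and wl: "1 + w n * l = rr n * ((l - m) / (l - rr n * m))"
      using wm' wl' by (simp_all only: times_divide_eq_right nonzero_eq_divide_eq[OF n(2)])
    define u where "u = (l - m) / (l - rr n * m)"
    have u: "u \<noteq> 0" using n False by (simp add: u_def)
    define c where "c = (a + b * m) / u ^ n"
    have "c * (1 + w n * m) ^ n = a + b * m" using u by (simp add: c_def wm u_def[symmetric])
    moreover have "c * (1 + w n * l) ^ n = rr n ^ n * (a + b * m)"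
      unfolding wl u_def[symmetric] c_def power_mult_distrib using u by simp
    then have "c * (1 + w n * l) ^ n = a + b * l" unfolding rn .
    ultimately have "a + b * l = fst (unit_power p0 q0 (w n) c n) + snd (unit_power p0 q0 (w n) c n) * l"
      "a + b * m = fst (unit_power p0 q0 (w n) c n) + snd (unit_power p0 q0 (w n) c n) * m"
      unfolding unit_power_eval[OF roots(1)] unit_power_eval[OF roots(2)] by (simp_all only:)
    from pair_eqI_roots[OF this False] have "(a, b) = unit_power p0 q0 (w n) c n"
      by (simp add: prod_eq_iff)
    with n show ?thesis by blast
  next
    case True
    define s where "s = b / (a + b * l)"
    \<comment> \<open>Comparing logarithmic derivatives at the double root gives n w / (1 + w l) = b
      / (a + b l) = s, which is solved for w.\<close>
    define w where "w n = (s / of_nat n) / (1 - l * (s / of_nat n))" for n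
    have "w \<longlonglongrightarrow> 0 / (1 - l * 0)"
      unfolding w_def by (intro tendsto_intros lim) auto
    then have "(\<lambda>n. norm (w n)) \<longlonglongrightarrow> 0" by (intro tendsto_norm_zero) simp
    then have ev1: "eventually (\<lambda>n. norm (w n) < r) sequentially"
      using r by (rule order_tendstoD(2))
    have "(\<lambda>n. 1 - l * (s / of_nat n)) \<longlonglongrightarrow> 1 - l * 0" by (intro tendsto_intros lim)
    then have ev2: "eventually (\<lambda>n. 1 - l * (s / of_nat n) \<noteq> 0) sequentially"
      by (intro tendsto_imp_eventually_ne) auto
    obtain n where n: "norm (w n) < r" "1 - l * (s / of_nat n) \<noteq> 0" "n > 0"
      using eventually_happens[OF eventually_conj[OF ev1 eventually_conj[OF ev2 eventually_gt_at_top[of 0]]]]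
      by auto
    define v where "v = 1 - l * (s / of_nat n)"
    have v: "v \<noteq> 0" using n by (simp add: v_def)
    have wv: "w n = s / of_nat n / v" by (simp add: w_def v_def)
    have "1 + w n * l = (v + l * (s / of_nat n)) / v" using v by (simp add: wv add_divide_distrib mult_ac)
    then have wl: "1 + w n * l = 1 / v" by (simp add: v_def)
    define c where "c = (a + b * l) * v ^ n"
    have cl: "c * (1 + w n * l) ^ n = a + b * l" using v by (simp add: c_def wl power_divide)
    define A B where "A = fst (unit_power p0 q0 (w n) c n)" and "B = snd (unit_power p0 q0 (w n) c n)"
    have "B * (1 + w n * l) = of_nat n * w n * (c * (1 + w n * l) ^ n)"
      unfolding B_def using unit_power_snd_double_root[of p0 l q0 "w n" c n] True p0 q0
      by (simp add: power2_eq_square)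
    then have "B * (1 + w n * l) = of_nat n * w n * (a + b * l)" by (simp only: cl)
    then have "B * (1 / v) = of_nat n * w n * (a + b * l)" by (simp only: wl)
    then have "B / v = s * (a + b * l) / v" using n(3) by (simp add: wv)
    then have "B = b" using v nz by (simp add: s_def)
    moreover have "A + B * l = a + b * l"
      using unit_power_eval[OF roots(1), of "w n" c n] cl by (simp add: A_def B_def)
    ultimately have "(a, b) = unit_power p0 q0 (w n) c n" by (simp add: A_def B_def prod_eq_iff)
    with n show ?thesis by blast
  qed
qed

text \<open>Each step splits off the gauge transformation with constant first row (1, w), which
  contributes the factor 1 + w z at x = 0. The intermediate equation has the same values p(0), q(0),
  hence the same \<open>pde_radius\<close>, and w stays small enough.\<close>

lemma eq_pullback_of_gauge_power:
  assumes "eq_gauge \<nu> p q p' q' a b" "(a $ 0, b $ 0) = unit_power (p' $ 0) (q' $ 0) w c n"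
    and "norm w < pde_radius p' q' / 2"
  shows "\<exists>\<phi> s. eq_pullback \<nu> p q p' q' \<phi> s \<and>
    (fps_conv_radius p' > 0 \<longrightarrow> fps_conv_radius q' > 0 \<longrightarrow> fps_conv_radius a > 0 \<longrightarrow> fps_conv_radius b > 0 \<longrightarrow>
       fps_conv_radius \<phi> > 0 \<and> fps_conv_radius s > 0)"
  using assms
proof (induction n arbitrary: p' q' a b)
  case 0
  then have "b $ 0 = 0" by simp
  moreover have "a $ 0 \<noteq> 0" using eq_gauge_nth_0(3)[OF 0(1)] \<open>b $ 0 = 0\<close> by auto
  moreover have "0 < pde_radius p' q' / 2" using pde_radius_pos[of p' q'] by simp
  ultimately show ?case
    using eq_pullback_of_gauge[OF 0(1)] by simp blast
next
  case (Suc n)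
  define p0 q0 where "p0 = p' $ 0" and "q0 = q' $ 0"
  obtain u0 v0 where uv0: "unit_power p0 q0 w c n = (u0, v0)" by force
  have ab0: "a $ 0 = u0 + v0 * w * q0" "b $ 0 = u0 * w + v0 * (1 + w * p0)"
    using Suc.prems(2) uv0 by (simp_all add: p0_def q0_def)
  define h0 where "h0 = 1 + w * p0 - w\<^sup>2 * q0"
  have "(a $ 0)\<^sup>2 + a $ 0 * b $ 0 * p0 - (b $ 0)\<^sup>2 * q0 = (u0\<^sup>2 + u0 * v0 * p0 - v0\<^sup>2 * q0) * h0"
    unfolding ab0 h0_def by (simp add: algebra_simps power2_eq_square)
  then have h0: "h0 \<noteq> 0" using eq_gauge_nth_0(3)[OF Suc.prems(1)] by (auto simp: p0_def q0_def)
  let ?w = "fps_const w"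
  define d1 where "d1 = 1 + ?w * p'"
  define c1 where "c1 = ?w * q'"
  define D1 where "D1 = d1 - ?w * c1"
  have "D1 $ 0 = h0" by (simp add: D1_def d1_def c1_def h0_def p0_def q0_def power2_eq_square algebra_simps)
  then have D10: "D1 $ 0 \<noteq> 0" using h0 by simp
  then have D1: "D1 * inverse D1 = 1" by (rule inverse_mult_eq_1')
  have "(1 * (1 + delta_op \<nu> ?w + ?w * p') - ?w * (delta_op \<nu> 1 + ?w * q')) $ 0 \<noteq> 0"
    using D10 by (simp add: D1_def d1_def c1_def)
  from eq_gauge_exists[OF this] obtain p1 q1 where G1: "eq_gauge \<nu> p1 q1 p' q' 1 ?w"
    and an1: "fps_conv_radius p' > 0 \<Longrightarrow> fps_conv_radius q' > 0 \<Longrightarrow> fps_conv_radius p1 > 0 \<and> fps_conv_radius q1 > 0"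
    by auto
  have pq1: "p1 $ 0 = p' $ 0" "q1 $ 0 = q' $ 0" using eq_gauge_nth_0[OF G1] by auto
  have "norm (?w $ 0 / 1 $ 0) < pde_radius p' q' / 2" using Suc.prems(3) by simp
  from eq_pullback_of_gauge[OF G1 _ this] obtain \<psi> r where P1: "eq_pullback \<nu> p1 q1 p' q' \<psi> r"
    and an\<psi>: "fps_conv_radius p' > 0 \<Longrightarrow> fps_conv_radius q' > 0 \<Longrightarrow> fps_conv_radius \<psi> > 0 \<and> fps_conv_radius r > 0"
    by auto
  \<comment> \<open>The row (a, b) times the inverse of the matrix with rows (1, w) and (c1, d1),
    whose determinant is D1.\<close>
  define u v where "u = (a * d1 - b * c1) * inverse D1" and "v = (b - a * ?w) * inverse D1"
  have a: "a = u * 1 + v * c1"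
  proof -
    have "u * 1 + v * c1 = a * (D1 * inverse D1)" by (simp add: u_def v_def D1_def algebra_simps)
    then show ?thesis by (simp add: D1)
  qed
  have b: "b = u * ?w + v * d1"
  proof -
    have "u * ?w + v * d1 = b * (D1 * inverse D1)" by (simp add: u_def v_def D1_def algebra_simps)
    then show ?thesis by (simp add: D1)
  qed
  have G: "eq_gauge \<nu> p q p1 q1 u v"
    by (rule eq_gauge_cancel[OF Suc.prems(1) G1]) (use a b in \<open>simp_all add: c1_def d1_def\<close>)
  have "u $ 0 = u0" "v $ 0 = v0"
  proof -
    have "u * D1 = (a * d1 - b * c1) * (D1 * inverse D1)" "v * D1 = (b - a * ?w) * (D1 * inverse D1)"
      by (simp_all add: u_def v_def mult_ac)
    then have "u * D1 = a * d1 - b * c1" "v * D1 = b - a * ?w"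
      by (simp_all only: D1 mult_1_right)
    then have "(u * D1) $ 0 = (a * d1 - b * c1) $ 0" "(v * D1) $ 0 = (b - a * ?w) $ 0"
      by (simp_all only:)
    then have "u $ 0 * h0 = u0 * h0" "v $ 0 * h0 = v0 * h0"
      by (simp_all add: \<open>D1 $ 0 = h0\<close> ab0 d1_def c1_def p0_def[symmetric] q0_def[symmetric])
        (simp_all add: h0_def algebra_simps power2_eq_square)
    then show "u $ 0 = u0" "v $ 0 = v0" using h0 by simp_all
  qed
  then have uv: "(u $ 0, v $ 0) = unit_power (p1 $ 0) (q1 $ 0) w c n"
    using uv0 pq1 by (simp add: p0_def q0_def)
  have "norm w < pde_radius p1 q1 / 2" using Suc.prems(3) pq1 by (simp add: pde_radius_def)
  from Suc.IH[OF G uv this] obtain \<phi> s where P: "eq_pullback \<nu> p q p1 q1 \<phi> s"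
    and an: "fps_conv_radius p1 > 0 \<longrightarrow> fps_conv_radius q1 > 0 \<longrightarrow> fps_conv_radius u > 0 \<longrightarrow> fps_conv_radius v > 0 \<longrightarrow>
       fps_conv_radius \<phi> > 0 \<and> fps_conv_radius s > 0" by blast
  have "fps_conv_radius (\<psi> oo \<phi>) > 0 \<and> fps_conv_radius (s * (r oo \<phi>)) > 0"
    if that: "fps_conv_radius p' > 0" "fps_conv_radius q' > 0" "fps_conv_radius a > 0" "fps_conv_radius b > 0"
  proof -
    have w: "fps_conv_radius ?w > 0" "fps_conv_radius (1 :: complex fps) > 0" by simp_all
    have "fps_conv_radius D1 > 0" unfolding D1_def d1_def c1_def
      by (intro fps_conv_radius_pos_intros w that)
    then have i: "fps_conv_radius (inverse D1) > 0" using D10 by (intro fps_conv_radius_inverse_pos)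
    have "fps_conv_radius u > 0" "fps_conv_radius v > 0"
      unfolding u_def v_def d1_def c1_def by (intro fps_conv_radius_pos_intros w that i)+
    then have \<phi>: "fps_conv_radius \<phi> > 0" "fps_conv_radius s > 0" using an an1 that by auto
    have \<phi>0: "\<phi> $ 0 = 0" using P by (simp add: eq_pullback_def)
    have \<psi>: "fps_conv_radius \<psi> > 0" "fps_conv_radius r > 0" using an\<psi> that by auto
    show ?thesis
      using \<phi> \<psi> \<phi>0 by (intro conjI fps_conv_radius_mult_pos fps_conv_radius_compose_pos) auto
  qed
  with eq_pullback_trans[OF P P1] show ?case by blast
qed

lemma gauge_imp_pullback:
  assumes G: "eq_gauge \<nu> p q p' q' a b"
  obtains \<phi> s where "eq_pullback \<nu> p q p' q' \<phi> s"
    "fps_conv_radius p' > 0 \<Longrightarrow> fps_conv_radius q' > 0 \<Longrightarrow> fps_conv_radius a > 0 \<Longrightarrow> fps_conv_radius b > 0 \<Longrightarrow>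
       fps_conv_radius \<phi> > 0 \<and> fps_conv_radius s > 0"
proof -
  have "pde_radius p' q' / 2 > 0" using pde_radius_pos[of p' q'] by simp
  from unit_power_exists[OF eq_gauge_nth_0(3)[OF G] this] obtain w c n where
    "norm w < pde_radius p' q' / 2" "(a $ 0, b $ 0) = unit_power (p' $ 0) (q' $ 0) w c n" by blast
  from eq_pullback_of_gauge_power[OF G this(2,1)] that show ?thesis by blast
qed

lemma delta_op_unit:
  assumes "\<phi> $ 0 = 0" "\<phi> $ 1 \<noteq> 0"
  obtains e where "delta_op \<nu> \<phi> = \<phi> ^ Suc \<nu> * e" "e $ 0 \<noteq> 0"
    "fps_conv_radius \<phi> > 0 \<Longrightarrow> fps_conv_radius e > 0"
proof -
  define u where "u = fps_shift 1 \<phi>"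
  have \<phi>: "\<phi> = fps_X * u" using assms(1) by (intro fps_ext) (simp add: u_def)
  have u0: "u $ 0 \<noteq> 0" using assms by (simp add: u_def)
  define e where "e = fps_deriv \<phi> * inverse (u ^ Suc \<nu>)"
  have "u ^ Suc \<nu> * inverse (u ^ Suc \<nu>) = 1"
    using u0 by (intro inverse_mult_eq_1') (simp add: fps_power_zeroth del: power_Suc)
  moreover have "\<phi> ^ Suc \<nu> * e = fps_X ^ Suc \<nu> * fps_deriv \<phi> * (u ^ Suc \<nu> * inverse (u ^ Suc \<nu>))"
    by (simp only: e_def \<phi> power_mult_distrib mult_ac)
  ultimately have "delta_op \<nu> \<phi> = \<phi> ^ Suc \<nu> * e" by (simp add: delta_op_def)
  moreover have "e $ 0 \<noteq> 0"
    using assms u0 by (simp add: e_def fps_power_zeroth del: power_Suc)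
  moreover have "fps_conv_radius e > 0" if "fps_conv_radius \<phi> > 0"
  proof -
    have "fps_conv_radius (u ^ Suc \<nu>) > 0"
      using that by (intro fps_conv_radius_power_pos) (simp add: u_def)
    then have "fps_conv_radius (inverse (u ^ Suc \<nu>)) > 0"
      using u0 by (intro fps_conv_radius_inverse_pos) (simp_all add: fps_power_zeroth del: power_Suc)
    then show ?thesis unfolding e_def
      by (intro fps_conv_radius_mult_pos less_le_trans[OF that fps_conv_radius_deriv])
  qed
  ultimately show ?thesis using that by blast
qed

section \<open>Point transformations in terms of power series\<close>

lemma fls_X_powi_neg: "fls_X powi (- int n) = inverse (fps_to_fls (fps_X ^ n) :: complex fls)"
  by (simp only: power_int_minus power_int_of_nat) (simp add: fps_to_fls_power)

lemma fls_compose_pole: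
  assumes "\<phi> $ 0 = 0" "\<phi> \<noteq> (0 :: complex fps)"
  shows "fls_compose_fps (fps_to_fls f * fls_X powi (- int n)) \<phi> =
    fps_to_fls (f oo \<phi>) * inverse (fps_to_fls (\<phi> ^ n))"
  unfolding fls_X_powi_neg using assms
  by (simp only: fls_compose_fps_mult fls_compose_fps_inverse fls_compose_fps_to_fls fps_X_power_compose not_False_eq_True)

text \<open>Clearing the denominators turns Laurent series into power series. The two ranks are kept
  apart, since their equality will be deduced from these equations.\<close>

lemma eq_transforms_iff:
  fixes \<nu> \<mu> :: nat and p q p' q' t :: "complex fps"
  assumes \<phi>: "\<phi> $ 0 = 0" "\<phi> $ 1 \<noteq> 0"
  defines "s \<equiv> inverse t" and "x \<equiv> fps_X ^ Suc \<nu>"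
    and "a \<equiv> of_nat (Suc \<nu>) * fps_X ^ \<nu> - p" and "b \<equiv> of_nat (Suc \<mu>) * fps_X ^ \<mu> - p'"
  shows "eq_transforms (eq_a1 \<nu> p) (eq_a0 \<nu> q) (eq_a1 \<mu> p') (eq_a0 \<mu> q') \<phi> t \<longleftrightarrow>
    (b oo \<phi>) * s * (fps_deriv \<phi>)\<^sup>2 * x =
      \<phi> ^ Suc \<mu> * ((2 * fps_deriv s * fps_deriv \<phi> + s * fps_deriv (fps_deriv \<phi>)) * x + a * s * fps_deriv \<phi>) \<and>
    - (q' oo \<phi>) * s * (fps_deriv \<phi>)\<^sup>2 * x\<^sup>2 =
      (\<phi> ^ Suc \<mu>)\<^sup>2 * (fps_deriv (fps_deriv s) * x\<^sup>2 + a * x * fps_deriv s - q * s)"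
proof -
  have "\<phi> \<noteq> 0" using \<phi> by auto
  define X F where "X = fps_to_fls x" and "F = fps_to_fls (\<phi> ^ Suc \<mu>)"
  have X: "X \<noteq> 0" and F: "F \<noteq> 0"
    using \<open>\<phi> \<noteq> 0\<close> by (simp_all add: X_def F_def x_def del: power_Suc)
  have a1: "eq_a1 \<nu> p = fps_to_fls a * inverse X"
    unfolding eq_a1_def a_def X_def x_def fls_X_powi_neg ..
  have "- (2 * int (Suc n)) = - int (Suc n + Suc n)" for n by simp
  then have pw: "fls_X powi (- (2 * int (Suc n))) = inverse (fps_to_fls (fps_X ^ (Suc n + Suc n) :: complex fps))" for n
    by (simp only: fls_X_powi_neg)
  have a0: "eq_a0 \<nu> q = - fps_to_fls q * inverse (X\<^sup>2)"
    unfolding eq_a0_def pw power_add by (simp only: X_def x_def fls_times_fps_to_fls power2_eq_square)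
  have b1: "fls_compose_fps (eq_a1 \<mu> p') \<phi> = fps_to_fls (b oo \<phi>) * inverse F"
    unfolding eq_a1_def F_def b_def by (rule fls_compose_pole[OF \<phi>(1) \<open>\<phi> \<noteq> 0\<close>])
  have "eq_a0 \<mu> q' = fps_to_fls (- q') * fls_X powi (- int (Suc \<mu> + Suc \<mu>))"
    by (simp add: eq_a0_def)
  then have b0: "fls_compose_fps (eq_a0 \<mu> q') \<phi> = fps_to_fls (- q' oo \<phi>) * inverse (F\<^sup>2)"
    by (simp only: fls_compose_pole[OF \<phi>(1) \<open>\<phi> \<noteq> 0\<close>]) (simp only: F_def power_add fls_times_fps_to_fls power2_eq_square)
  define S S' S'' P' P'' A B Q Q' where "S = fps_to_fls s" and "S' = fps_to_fls (fps_deriv s)"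
    and "S'' = fps_to_fls (fps_deriv (fps_deriv s))" and "P' = fps_to_fls (fps_deriv \<phi>)"
    and "P'' = fps_to_fls (fps_deriv (fps_deriv \<phi>))" and "A = fps_to_fls a" and "B = fps_to_fls (b oo \<phi>)"
    and "Q = fps_to_fls q" and "Q' = fps_to_fls (q' oo \<phi>)"
  note defs = S_def S'_def S''_def P'_def P''_def A_def B_def Q_def Q'_def
  have "eq_transforms (eq_a1 \<nu> p) (eq_a0 \<nu> q) (eq_a1 \<mu> p') (eq_a0 \<mu> q') \<phi> t \<longleftrightarrow>
    B * inverse F * S * P'\<^sup>2 = 2 * S' * P' + S * P'' + A * inverse X * S * P' \<and>
    - Q' * inverse (F\<^sup>2) * S * P'\<^sup>2 = S'' + A * inverse X * S' + (- Q * inverse (X\<^sup>2)) * S"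
    unfolding eq_transforms_def Let_def b1 b0 a1 a0
    by (simp only: s_def[symmetric] defs fps_compose_uminus fps_to_fls_uminus)
  also have "B * inverse F * S * P'\<^sup>2 = 2 * S' * P' + S * P'' + A * inverse X * S * P' \<longleftrightarrow>
     B * S * P'\<^sup>2 * X = F * ((2 * S' * P' + S * P'') * X + A * S * P')"
    using X F by (simp add: field_simps)
  also have "- Q' * inverse (F\<^sup>2) * S * P'\<^sup>2 = S'' + A * inverse X * S' + (- Q * inverse (X\<^sup>2)) * S \<longleftrightarrow>
     - Q' * S * P'\<^sup>2 * X\<^sup>2 = F\<^sup>2 * (S'' * X\<^sup>2 + A * X * S' - Q * S)"
  proof -
    have "- Q' * inverse (F\<^sup>2) * S * P'\<^sup>2 = (- Q' * S * P'\<^sup>2) / F\<^sup>2"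
      by (simp add: divide_inverse mult_ac)
    moreover have "S'' + A * inverse X * S' + (- Q * inverse (X\<^sup>2)) * S = (S'' * X\<^sup>2 + A * X * S' - Q * S) / X\<^sup>2"
      using X by (simp add: divide_simps power2_eq_square algebra_simps)
    moreover have "F\<^sup>2 \<noteq> 0" "X\<^sup>2 \<noteq> 0" using X F by simp_all
    ultimately show ?thesis by (simp only: frac_eq_eq mult.commute[of "F\<^sup>2"] not_False_eq_True)
  qed
  also have "B * S * P'\<^sup>2 * X = F * ((2 * S' * P' + S * P'') * X + A * S * P') \<longleftrightarrow>
     fps_to_fls ((b oo \<phi>) * s * (fps_deriv \<phi>)\<^sup>2 * x) =
     fps_to_fls (\<phi> ^ Suc \<mu> * ((2 * fps_deriv s * fps_deriv \<phi> + s * fps_deriv (fps_deriv \<phi>)) * x + a * s * fps_deriv \<phi>))"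
    by (simp only: defs X_def F_def fls_times_fps_to_fls fps_to_fls_plus power2_eq_square fps_to_fls_numeral)
  also have "- Q' * S * P'\<^sup>2 * X\<^sup>2 = F\<^sup>2 * (S'' * X\<^sup>2 + A * X * S' - Q * S) \<longleftrightarrow>
     fps_to_fls (- (q' oo \<phi>) * s * (fps_deriv \<phi>)\<^sup>2 * x\<^sup>2) =
     fps_to_fls ((\<phi> ^ Suc \<mu>)\<^sup>2 * (fps_deriv (fps_deriv s) * x\<^sup>2 + a * x * fps_deriv s - q * s))"
    by (simp only: defs X_def F_def fls_times_fps_to_fls fps_to_fls_plus fps_to_fls_minus fps_to_fls_uminus power2_eq_square)
  finally show ?thesis by (simp only: fps_to_fls_eq_iff)
qed

lemma eq_transforms_iff_pullback:
  assumes \<phi>: "\<phi> $ 0 = 0" "\<phi> $ 1 \<noteq> 0" and t0: "t $ 0 \<noteq> 0"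
  shows "eq_transforms (eq_a1 \<nu> p) (eq_a0 \<nu> q) (eq_a1 \<nu> p') (eq_a0 \<nu> q') \<phi> t \<longleftrightarrow>
    eq_pullback \<nu> p q p' q' \<phi> (inverse t)"
proof -
  define s x where "s = inverse t" and "x = (fps_X ^ Suc \<nu> :: complex fps)"
  define N where "N = (of_nat (Suc \<nu>) :: complex fps)"
  obtain e where e: "delta_op \<nu> \<phi> = \<phi> ^ Suc \<nu> * e" and e0: "e $ 0 \<noteq> 0"
    using delta_op_unit[OF \<phi>] by metis
  define f where "f = \<phi> ^ Suc \<nu>"
  have "\<phi> \<noteq> 0" using \<phi> by auto
  have x0: "x \<noteq> 0" by (simp add: x_def)
  have f0: "f \<noteq> 0" using \<open>\<phi> \<noteq> 0\<close> by (simp add: f_def)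
  have ene: "e \<noteq> 0" using e0 by auto
  define P' P'' where "P' = fps_deriv \<phi>" and "P'' = fps_deriv (fps_deriv \<phi>)"
  have xP: "x * P' = f * e" using e by (simp add: delta_op_def x_def P'_def f_def del: power_Suc)
  have P'0: "P' \<noteq> 0" using xP f0 ene x0 by auto
  have dX: "fps_deriv x = N * fps_X ^ \<nu>" by (simp add: x_def N_def fps_deriv_power del: power_Suc of_nat_Suc flip: fps_of_nat)
  have df: "fps_deriv f = N * \<phi> ^ \<nu> * P'" by (simp add: f_def N_def P'_def fps_deriv_power del: power_Suc of_nat_Suc flip: fps_of_nat)
  have d: "delta_op \<nu> g = x * fps_deriv g" for g by (simp add: delta_op_def x_def)
  \<comment> \<open>The second derivative of \<phi> is eliminated by differentiating x^(\<nu>+1)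
    \<phi>' = \<phi>^(\<nu>+1) e.\<close>
  have deriv: "x * x * P'' = N * \<phi> ^ \<nu> * (x * P') * e + f * delta_op \<nu> e - N * fps_X ^ \<nu> * (x * P')"
  proof -
    have "fps_deriv (x * P') = fps_deriv (f * e)" using xP by simp
    then have "N * fps_X ^ \<nu> * P' + x * P'' = N * \<phi> ^ \<nu> * P' * e + f * fps_deriv e"
      by (simp add: dX df P'_def P''_def algebra_simps)
    then have "x * (N * fps_X ^ \<nu> * P' + x * P'') = x * (N * \<phi> ^ \<nu> * P' * e + f * fps_deriv e)" by simp
    then show ?thesis by (simp add: d algebra_simps)
  qed
  define a where "a = N * fps_X ^ \<nu> - p"
  have bo: "(N * fps_X ^ \<nu> - p') oo \<phi> = N * \<phi> ^ \<nu> - (p' oo \<phi>)"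
    using \<phi>(1) unfolding N_def
    by (simp add: fps_compose_sub_distrib fps_compose_mult_distrib fps_X_power_compose del: of_nat_Suc)
  have 1: "((N * fps_X ^ \<nu> - p') oo \<phi>) * s * P'\<^sup>2 * x =
      f * ((2 * fps_deriv s * P' + s * P'') * x + a * s * P') \<longleftrightarrow>
      e * s * p = 2 * e * delta_op \<nu> s + s * delta_op \<nu> e + s * e\<^sup>2 * (p' oo \<phi>)"
    (is "?L = ?R \<longleftrightarrow> ?l = ?r")
  proof -
    have "x * e * ?L = (N * \<phi> ^ \<nu> - (p' oo \<phi>)) * s * (x * P') * (x * P') * e"
      unfolding bo by (simp add: power2_eq_square mult_ac)
    moreover have "x * e * ?R = (f * e) * (2 * delta_op \<nu> s * (x * P') + s * (x * x * P'') + a * s * (x * P'))"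
      by (simp add: d algebra_simps)
    moreover have "\<dots> = (f * e) * (2 * delta_op \<nu> s * (f * e) + s * (N * \<phi> ^ \<nu> * (f * e) * e + f * delta_op \<nu> e
        - N * fps_X ^ \<nu> * (f * e)) + a * s * (f * e))"
      unfolding deriv unfolding xP ..
    ultimately have "x * e * (?L - ?R) = f * f * e * (?l - ?r)"
      unfolding xP by (simp add: a_def algebra_simps power2_eq_square)
    then have "?L - ?R = 0 \<longleftrightarrow> ?l - ?r = 0"
      using x0 ene f0 by (metis mult_eq_0_iff)
    then show ?thesis by simp
  qed
  have 2: "- (q' oo \<phi>) * s * P'\<^sup>2 * x\<^sup>2 = f\<^sup>2 * (fps_deriv (fps_deriv s) * x\<^sup>2 + a * x * fps_deriv s - q * s) \<longleftrightarrow>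
      s * q = delta_op \<nu> (delta_op \<nu> s) + s * e\<^sup>2 * (q' oo \<phi>) - p * delta_op \<nu> s"
    (is "?L = ?R \<longleftrightarrow> ?l = ?r")
  proof -
    have "?L = - (q' oo \<phi>) * s * (x * P')\<^sup>2" by (simp add: power2_eq_square)
    then have "?L = - (q' oo \<phi>) * s * (f * e)\<^sup>2" unfolding xP .
    moreover have "delta_op \<nu> (delta_op \<nu> s) = N * fps_X ^ \<nu> * x * fps_deriv s + x\<^sup>2 * fps_deriv (fps_deriv s)"
      by (simp add: d dX algebra_simps power2_eq_square)
    moreover have "?R = f\<^sup>2 * (x\<^sup>2 * fps_deriv (fps_deriv s) + a * delta_op \<nu> s - q * s)"
      by (simp add: d mult_ac)
    ultimately have "?L - ?R = f\<^sup>2 * (?l - ?r)"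
      by (simp only:) (simp add: a_def d algebra_simps power2_eq_square)
    moreover have "f\<^sup>2 \<noteq> 0" using f0 by simp
    ultimately have "?L - ?R = 0 \<longleftrightarrow> ?l - ?r = 0" by (metis mult_eq_0_iff)
    then show ?thesis by simp
  qed
  have s0: "s $ 0 \<noteq> 0" using t0 by (simp add: s_def)
  have uniq: "e' = e" if "delta_op \<nu> \<phi> = \<phi> ^ Suc \<nu> * e'" for e'
    using that e f0 by (simp add: f_def)
  show ?thesis
    unfolding eq_transforms_iff[OF \<phi>] eq_pullback_def
    using 1 2 \<phi> s0 e uniq unfolding N_def a_def x_def s_def P'_def P''_def f_def by metis
qed

text \<open>The maximum with 0 covers f = 0, whose \<open>fls_subdegree\<close> is 0 by
  convention.\<close>

lemma pole_order_le:
  fixes f :: "complex fps"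
  shows "pole_order (fps_to_fls (fps_X ^ k * f) * fls_X powi (- int m)) \<le> max 0 (int m - int k)"
proof (cases "f = 0")
  case False
  define P where "P = (inverse (fps_to_fls (fps_X ^ m)) :: complex fls)"
  have "P \<noteq> 0" by (simp add: P_def)
  moreover have "P * fps_to_fls (fps_X ^ m) = 1" by (simp add: P_def)
  then have "fls_subdegree (P * fps_to_fls (fps_X ^ m)) = 0" by simp
  ultimately have P: "fls_subdegree P = - int m"
    by (simp add: fls_subdegree_fls_to_fps del: fps_to_fls_power)
  have "fls_subdegree (fps_to_fls (fps_X ^ k * f) * P) = int (subdegree (fps_X ^ k * f)) - int m"
    using False \<open>P \<noteq> 0\<close> P by (simp add: fls_subdegree_fls_to_fps)
  then have "fls_subdegree (fps_to_fls (fps_X ^ k * f) * fls_X powi (- int m)) =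
      int (subdegree (fps_X ^ k * f)) - int m"
    by (simp only: P_def fls_X_powi_neg)
  then show ?thesis using False by (simp add: pole_order_def)
qed (simp add: pole_order_def)

text \<open>If \<nu> were positive, a1 and a0 would have poles of order at most \<nu> and 2 \<nu>,
  and the Poincare rank would be smaller than \<nu>.\<close>

lemma is_rank_form_nonzero:
  assumes "is_rank_form \<nu> p q" "p $ 0 = 0" "q $ 0 = 0" "q $ 1 = 0"
  shows "\<nu> = 0"
proof (rule ccontr)
  assume "\<nu> \<noteq> 0"
  define a where "a = of_nat (Suc \<nu>) * fps_X ^ \<nu> - p"
  have "a $ 0 = 0" using assms \<open>\<nu> \<noteq> 0\<close> by (simp add: a_def fps_mult_nth_0)
  then have "a = fps_X ^ 1 * fps_shift 1 a" by (intro fps_ext) simp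
  then have "pole_order (eq_a1 \<nu> p) \<le> max 0 (int (Suc \<nu>) - int 1)"
    unfolding eq_a1_def a_def[symmetric] by (metis pole_order_le)
  then have 1: "pole_order (eq_a1 \<nu> p) \<le> int \<nu>" by simp
  have "q = fps_X ^ 2 * fps_shift 2 q"
  proof (rule fps_ext)
    fix n show "q $ n = (fps_X ^ 2 * fps_shift 2 q) $ n"
    proof (cases "n < 2")
      case True
      then show ?thesis using assms(3,4) by (auto simp: fps_X_power_mult_nth less_Suc_eq numeral_2_eq_2)
    next
      case False
      then obtain m where "n = m + 2" by (metis add.commute le_Suc_ex not_less)
      then show ?thesis by (simp add: fps_X_power_mult_nth)
    qed
  qed
  then have q: "- q = fps_X ^ 2 * (- fps_shift 2 q)" by simp
  have "eq_a0 \<nu> q = fps_to_fls (fps_X ^ 2 * (- fps_shift 2 q)) * fls_X powi (- int (2 * Suc \<nu>))"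
    unfolding q[symmetric] by (simp add: eq_a0_def)
  then have "pole_order (eq_a0 \<nu> q) \<le> max 0 (int (2 * Suc \<nu>) - int 2)"
    by (simp only: pole_order_le)
  then have "pole_order (eq_a0 \<nu> q) \<le> 2 * int \<nu>" by simp
  then have "real_of_int (pole_order (eq_a0 \<nu> q)) / 2 \<le> real_of_int (int \<nu>)" by linarith
  then have "\<lceil>real_of_int (pole_order (eq_a0 \<nu> q)) / 2\<rceil> \<le> int \<nu>" by (simp only: ceiling_le_iff)
  with 1 have "poincare_rank (eq_a1 \<nu> p) (eq_a0 \<nu> q) < int \<nu>" by (simp add: poincare_rank_def)
  then show False using assms(1) by (simp add: is_rank_form_def)
qed

lemma fps_X_factor:
  fixes \<phi> :: "complex fps"
  assumes "\<phi> $ 0 = 0" "\<phi> $ 1 \<noteq> 0"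
  obtains u where "\<phi> = fps_X * u" "u $ 0 \<noteq> 0"
proof
  show "\<phi> = fps_X * fps_shift 1 \<phi>" using assms by (intro fps_ext) simp
qed (use assms in simp)

lemma mult_unit_eq_X_mult:
  fixes f W G :: "complex fps"
  assumes "f * W = fps_X * G" "W $ 0 \<noteq> 0"
  shows "f $ 0 = 0"
  using arg_cong[OF assms(1), of "\<lambda>g. g $ 0"] assms(2) by (simp add: fps_mult_nth_0)

lemma mult_unit_eq_X2_mult:
  fixes f W G :: "complex fps"
  assumes "f * W = fps_X\<^sup>2 * G" "W $ 0 \<noteq> 0"
  shows "f $ 0 = 0" "f $ 1 = 0"
proof -
  show 0: "f $ 0 = 0"
    by (rule mult_unit_eq_X_mult[of f W "fps_X * G"]) (use assms in \<open>simp_all add: power2_eq_square mult_ac\<close>)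
  have "(f * W) $ 1 = 0" unfolding assms(1) by (simp add: fps_X_power_mult_nth)
  then show "f $ 1 = 0" using 0 assms(2) by (simp add: fps_mult_nth_1)
qed

text \<open>If the ranks differed, dividing by the smaller power of x would show for the equation of
  larger rank that its p vanishes at 0 and its q to second order, against
  \<open>is_rank_form_nonzero\<close>.\<close>

lemma eq_transforms_rank:
  assumes R: "is_rank_form \<nu> p q" and R': "is_rank_form \<mu> p' q'"
    and \<phi>: "\<phi> $ 0 = 0" "\<phi> $ 1 \<noteq> 0" and t: "t $ 0 \<noteq> 0"
    and tr: "eq_transforms (eq_a1 \<nu> p) (eq_a0 \<nu> q) (eq_a1 \<mu> p') (eq_a0 \<mu> q') \<phi> t"
  shows "\<nu> = \<mu>"
proof -
  obtain u where u: "\<phi> = fps_X * u" "u $ 0 \<noteq> 0" using fps_X_factor[OF \<phi>] .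
  define s where "s = inverse t"
  define a b where "a = of_nat (Suc \<nu>) * fps_X ^ \<nu> - p" and "b = of_nat (Suc \<mu>) * fps_X ^ \<mu> - p'"
  define X M where "X = (fps_X ^ Suc \<nu> :: complex fps)" and "M = (fps_X ^ Suc \<mu> :: complex fps)"
  define v where "v = u ^ Suc \<mu>"
  have v0: "v $ 0 \<noteq> 0" using u by (simp add: v_def fps_power_zeroth del: power_Suc)
  have \<phi>M: "\<phi> ^ Suc \<mu> = M * v" unfolding u(1) M_def v_def by (rule power_mult_distrib)
  have X0: "X \<noteq> 0" and M0: "M \<noteq> 0" by (simp_all add: X_def M_def del: power_Suc)
  have s0: "s $ 0 \<noteq> 0" using t by (simp add: s_def)
  define G1 G2 where "G1 = 2 * fps_deriv s * fps_deriv \<phi> + s * fps_deriv (fps_deriv \<phi>)"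
    and "G2 = fps_deriv (fps_deriv s)"
  define W where "W = s * (fps_deriv \<phi>)\<^sup>2"
  have W0: "W $ 0 \<noteq> 0" using \<phi> s0 by (simp add: W_def fps_power_zeroth)
  have I: "(b oo \<phi>) * W * X = M * v * (G1 * X + a * s * fps_deriv \<phi>)"
    and II: "- (q' oo \<phi>) * W * X\<^sup>2 = (M * v)\<^sup>2 * (G2 * X\<^sup>2 + a * X * fps_deriv s - q * s)"
    using tr[unfolded eq_transforms_iff[OF \<phi>]] unfolding \<phi>M
    unfolding G1_def G2_def W_def s_def X_def a_def b_def by (simp_all only: mult.assoc)
  consider "\<nu> = \<mu>" | k where "\<mu> = \<nu> + Suc k" | k where "\<nu> = \<mu> + Suc k"
    by (metis less_iff_Suc_add linorder_neqE_nat add_Suc_right)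
  then show ?thesis
  proof cases
    case (2 k)
    define K where "K = (fps_X ^ k :: complex fps)"
    have M: "M = X * (fps_X * K)" by (simp add: M_def X_def K_def 2 power_add)
    have "X * ((b oo \<phi>) * W) = X * (fps_X * (K * v * (G1 * X + a * s * fps_deriv \<phi>)))"
      using I unfolding M by (simp only: mult_ac)
    then have "(b oo \<phi>) * W = fps_X * (K * v * (G1 * X + a * s * fps_deriv \<phi>))" using X0 by simp
    then have "(b oo \<phi>) $ 0 = 0" using W0 by (rule mult_unit_eq_X_mult)
    then have "p' $ 0 = 0" using 2 by (simp add: b_def fps_mult_nth_0)
    have "X\<^sup>2 * ((q' oo \<phi>) * W) = X\<^sup>2 * (fps_X\<^sup>2 * (- (K * v)\<^sup>2 * (G2 * X\<^sup>2 + a * X * fps_deriv s - q * s)))"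
    proof -
      have "X\<^sup>2 * ((q' oo \<phi>) * W) = - (- (q' oo \<phi>) * W * X\<^sup>2)" by simp
      then show ?thesis unfolding II M by (simp add: algebra_simps power2_eq_square)
    qed
    moreover have "X\<^sup>2 \<noteq> 0" using X0 by simp
    ultimately have "(q' oo \<phi>) * W = fps_X\<^sup>2 * (- (K * v)\<^sup>2 * (G2 * X\<^sup>2 + a * X * fps_deriv s - q * s))"
      by (metis mult_left_cancel)
    from mult_unit_eq_X2_mult[OF this W0] have "(q' oo \<phi>) $ 0 = 0" "(q' oo \<phi>) $ 1 = 0" .
    then have "q' $ 0 = 0" "q' $ 1 = 0" using \<phi> by (simp_all add: fps_compose_nth)
    with is_rank_form_nonzero[OF R' \<open>p' $ 0 = 0\<close>] 2 show ?thesis by simp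
  next
    case (3 k)
    define K where "K = (fps_X ^ k :: complex fps)"
    have X: "X = M * (fps_X * K)" by (simp add: M_def X_def K_def 3 power_add)
    have "M * (a * (v * s * fps_deriv \<phi>)) = (b oo \<phi>) * W * X - M * v * G1 * X"
      unfolding I by (simp add: algebra_simps)
    also have "\<dots> = M * (fps_X * (K * ((b oo \<phi>) * W - M * v * G1)))"
      unfolding X by (simp add: algebra_simps)
    finally have "a * (v * s * fps_deriv \<phi>) = fps_X * (K * ((b oo \<phi>) * W - M * v * G1))" using M0 by simp
    then have a0: "a $ 0 = 0" by (rule mult_unit_eq_X_mult) (use v0 s0 \<phi> in simp)
    then have "p $ 0 = 0" using 3 by (simp add: a_def fps_mult_nth_0)
    \<comment> \<open>In the term with a X, one factor x of the required x^2 comes from a, the other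
      from X.\<close>
    obtain a' where a': "a = fps_X * a'"
    proof
      show "a = fps_X * fps_shift 1 a" using a0 by (intro fps_ext) simp
    qed
    have "M\<^sup>2 * (q * (s * v\<^sup>2)) = (M * v)\<^sup>2 * (G2 * X\<^sup>2 + a * X * fps_deriv s) + (q' oo \<phi>) * W * X\<^sup>2"
    proof -
      have "(q' oo \<phi>) * W * X\<^sup>2 = - (- (q' oo \<phi>) * W * X\<^sup>2)" by simp
      then show ?thesis unfolding II by (simp add: algebra_simps power2_eq_square)
    qed
    also have "\<dots> = M\<^sup>2 * (fps_X\<^sup>2 * (v\<^sup>2 * (G2 * (M * K)\<^sup>2 + a' * (M * K) * fps_deriv s) + (q' oo \<phi>) * W * K\<^sup>2))"
      unfolding X a' by (simp add: algebra_simps power2_eq_square)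
    finally have "q * (s * v\<^sup>2) = fps_X\<^sup>2 * (v\<^sup>2 * (G2 * (M * K)\<^sup>2 + a' * (M * K) * fps_deriv s) + (q' oo \<phi>) * W * K\<^sup>2)"
      using M0 by simp
    moreover have "(s * v\<^sup>2) $ 0 \<noteq> 0" using s0 v0 by (simp add: fps_power_zeroth)
    ultimately have "q $ 0 = 0" "q $ 1 = 0" by (rule mult_unit_eq_X2_mult)+
    with is_rank_form_nonzero[OF R \<open>p $ 0 = 0\<close>] 3 show ?thesis by simp
  qed
qed

section \<open>Gauge transformations of companion systems\<close>

abbreviation entry :: "'a ^ 'n ^ 'm \<Rightarrow> 'm \<Rightarrow> 'n \<Rightarrow> 'a" where
  "entry A i j \<equiv> vec_nth (vec_nth A i) j"

lemma sys_transforms_companion_iff: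
  fixes \<nu> \<mu> :: nat and T :: "complex fps ^ 2 ^ 2" and \<phi> p q p' q' :: "complex fps"
  assumes \<phi>: "\<phi> $ 0 = 0" "\<phi> $ 1 \<noteq> 0"
  defines "x \<equiv> fps_X ^ Suc \<nu>" and "a \<equiv> entry T 1 1" and "b \<equiv> entry T 1 2" and "c \<equiv> entry T 2 1" and "d \<equiv> entry T 2 2"
  shows "sys_transforms (sys_B \<nu> (companion p q)) (sys_B \<mu> (companion p' q')) \<phi> T \<longleftrightarrow>
    fps_deriv \<phi> * c * x = \<phi> ^ Suc \<mu> * (b * q + x * fps_deriv a) \<and>
    fps_deriv \<phi> * d * x = \<phi> ^ Suc \<mu> * (a + b * p + x * fps_deriv b) \<and>
    fps_deriv \<phi> * ((q' oo \<phi>) * a + (p' oo \<phi>) * c) * x = \<phi> ^ Suc \<mu> * (d * q + x * fps_deriv c) \<and>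
    fps_deriv \<phi> * ((q' oo \<phi>) * b + (p' oo \<phi>) * d) * x = \<phi> ^ Suc \<mu> * (c + d * p + x * fps_deriv d)"
proof -
  have "\<phi> \<noteq> 0" using \<phi> by auto
  define X F P where "X = fps_to_fls x" and "F = fps_to_fls (\<phi> ^ Suc \<mu>)" and "P = fps_to_fls (fps_deriv \<phi>)"
  have X: "X \<noteq> 0" and F: "F \<noteq> 0"
    using \<open>\<phi> \<noteq> 0\<close> by (simp_all add: X_def F_def x_def del: power_Suc)
  have comp: "entry (companion p q) 1 1 = 0" "entry (companion p q) 1 2 = 1"
    "entry (companion p q) 2 1 = q" "entry (companion p q) 2 2 = p" for p q
    by (simp_all add: companion_def)
  have C: "fls_compose_fps (entry (sys_B \<mu> A) i j) \<phi> = fps_to_fls (entry A i j oo \<phi>) * inverse F" for i j A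
    unfolding sys_B_def vec_lambda_beta F_def by (rule fls_compose_pole[OF \<phi>(1) \<open>\<phi> \<noteq> 0\<close>])
  have B: "entry (sys_B \<nu> A) i j = fps_to_fls (entry A i j) * inverse X" for i j A
    unfolding sys_B_def vec_lambda_beta X_def x_def fls_X_powi_neg ..
  have key: "(P * (f * inverse F)) * g + (P * (f' * inverse F)) * g' = h * (k * inverse X) + h' * (k' * inverse X) + l
      \<longleftrightarrow> P * (f * g + f' * g') * X = F * (h * k + h' * k' + X * l)" for f f' g g' h k h' k' l
    using X F by (simp add: field_simps)
  have conv: "P * (fps_to_fls f * fps_to_fls g + fps_to_fls f' * fps_to_fls g') * X =
      F * (fps_to_fls h * fps_to_fls k + fps_to_fls h' * fps_to_fls k' + X * fps_to_fls l) \<longleftrightarrow>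
      fps_deriv \<phi> * (f * g + f' * g') * x = \<phi> ^ Suc \<mu> * (h * k + h' * k' + x * l)" for f f' g g' h k h' k' l
    unfolding P_def X_def F_def fps_to_fls_eq_iff[symmetric, of "fps_deriv \<phi> * (f * g + f' * g') * x"]
    by (simp only: fls_times_fps_to_fls fps_to_fls_plus)
  show ?thesis
    unfolding sys_transforms_def vec_eq_iff forall_2 matrix_matrix_mult_def vec_lambda_beta sum_2
      vector_add_component C B mat_to_fls_def P_def[symmetric] key conv comp
    by (simp add: a_def b_def c_def d_def)
qed

text \<open>Compare leading terms. If \<mu> > \<nu>, the second row of T(0) vanishes. If \<nu> >
  \<mu>, then T(0) A(0) = 0 for the companion matrix A of p, q, whose second column is never zero.
  Both contradict the invertibility of T(0).\<close>

lemma sys_transforms_rank: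
  fixes T :: "complex fps ^ 2 ^ 2"
  assumes \<phi>: "\<phi> $ 0 = 0" "\<phi> $ 1 \<noteq> 0"
    and D: "(entry T 1 1 * entry T 2 2 - entry T 1 2 * entry T 2 1) $ 0 \<noteq> 0"
    and tr: "sys_transforms (sys_B \<nu> (companion p q)) (sys_B \<mu> (companion p' q')) \<phi> T"
  shows "\<nu> = \<mu>"
proof -
  obtain u where u: "\<phi> = fps_X * u" "u $ 0 \<noteq> 0" using fps_X_factor[OF \<phi>] .
  define a b c d where "a = entry T 1 1" and "b = entry T 1 2" and "c = entry T 2 1" and "d = entry T 2 2"
  define X M where "X = (fps_X ^ Suc \<nu> :: complex fps)" and "M = (fps_X ^ Suc \<mu> :: complex fps)"
  define v where "v = u ^ Suc \<mu>"
  have v0: "v $ 0 \<noteq> 0" using u by (simp add: v_def fps_power_zeroth del: power_Suc)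
  have \<phi>M: "\<phi> ^ Suc \<mu> = M * v" unfolding u(1) M_def v_def by (rule power_mult_distrib)
  have X0: "X \<noteq> 0" and M0: "M \<noteq> 0" by (simp_all add: X_def M_def del: power_Suc)
  note eqs = tr[unfolded sys_transforms_companion_iff[OF \<phi>] \<phi>M, folded X_def a_def b_def c_def d_def]
  have D: "a $ 0 * d $ 0 - b $ 0 * c $ 0 \<noteq> 0" using D by (simp add: a_def b_def c_def d_def)
  have \<phi>': "fps_deriv \<phi> $ 0 \<noteq> 0" using \<phi> by simp
  consider "\<nu> = \<mu>" | k where "\<mu> = \<nu> + Suc k" | k where "\<nu> = \<mu> + Suc k"
    by (metis less_iff_Suc_add linorder_neqE_nat add_Suc_right)
  then show ?thesis
  proof cases
    case (2 k)
    define K where "K = (fps_X ^ k :: complex fps)"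
    have M: "M = X * (fps_X * K)" by (simp add: M_def X_def K_def 2 power_add)
    have zero: "f $ 0 = 0" if "fps_deriv \<phi> * f * X = M * v * g" for f g
    proof (rule mult_unit_eq_X_mult[OF _ \<phi>'])
      have "X * (f * fps_deriv \<phi>) = X * (fps_X * (K * v * g))"
        using that unfolding M by (simp only: mult_ac)
      then show "f * fps_deriv \<phi> = fps_X * (K * v * g)" using X0 by simp
    qed
    have "c $ 0 = 0" "d $ 0 = 0" using eqs zero by blast+
    then show ?thesis using D by simp
  next
    case (3 k)
    define K where "K = (fps_X ^ k :: complex fps)"
    have X: "X = M * (fps_X * K)" by (simp add: M_def X_def K_def 3 power_add)
    have zero: "f $ 0 = 0" if "fps_deriv \<phi> * g * X = M * v * (f + X * h)" for f g h
    proof -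
      have "M * ((f + X * h) * v) = M * (fps_X * (K * fps_deriv \<phi> * g))"
        using that[symmetric] unfolding X by (simp add: mult_ac)
      then have "(f + X * h) * v = fps_X * (K * fps_deriv \<phi> * g)" using M0 by simp
      then have "(f + X * h) $ 0 = 0" using v0 by (rule mult_unit_eq_X_mult)
      then show ?thesis by (simp add: X_def)
    qed
    have "(b * q) $ 0 = 0" "(a + b * p) $ 0 = 0" "(d * q) $ 0 = 0" "(c + d * p) $ 0 = 0"
      using eqs by (blast intro: zero)+
    then have "a $ 0 = - (b $ 0 * p $ 0)" "c $ 0 = - (d $ 0 * p $ 0)"
      by (simp_all add: eq_neg_iff_add_eq_0)
    then show ?thesis using D by simp
  qed
qed

lemma gauge_det_nonzero:
  fixes T U :: "complex fps ^ 2 ^ 2"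
  assumes "T ** U = mat 1"
  shows "(entry T 1 1 * entry T 2 2 - entry T 1 2 * entry T 2 1) $ 0 \<noteq> 0"
proof -
  have "det T * det U = 1" using assms det_mul[of T U] by simp
  then have "(det T * det U) $ 0 = 1" by simp
  then have "det T $ 0 \<noteq> 0" by (auto simp: fps_mult_nth_0)
  then show ?thesis by (simp add: det_2)
qed

lemma sys_transforms_companion_delta:
  fixes T :: "complex fps ^ 2 ^ 2"
  assumes \<phi>: "\<phi> $ 0 = 0" "\<phi> $ 1 \<noteq> 0" and e: "delta_op \<nu> \<phi> = \<phi> ^ Suc \<nu> * e"
  defines "a \<equiv> entry T 1 1" and "b \<equiv> entry T 1 2" and "c \<equiv> entry T 2 1" and "d \<equiv> entry T 2 2"
  shows "sys_transforms (sys_B \<nu> (companion p q)) (sys_B \<nu> (companion p' q')) \<phi> T \<longleftrightarrow>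
    e * c = delta_op \<nu> a + b * q \<and> e * d = a + delta_op \<nu> b + b * p \<and>
    e * ((q' oo \<phi>) * a + (p' oo \<phi>) * c) = delta_op \<nu> c + d * q \<and>
    e * ((q' oo \<phi>) * b + (p' oo \<phi>) * d) = delta_op \<nu> d + c + d * p"
proof -
  define F where "F = \<phi> ^ Suc \<nu>"
  have F: "F \<noteq> 0" using \<phi> by (auto simp: F_def)
  have e': "fps_deriv \<phi> * f * fps_X ^ Suc \<nu> = F * (e * f)" for f
  proof -
    have "fps_deriv \<phi> * f * fps_X ^ Suc \<nu> = delta_op \<nu> \<phi> * f"
      by (simp only: delta_op_def mult_ac)
    then show ?thesis unfolding e F_def by (simp only: mult.assoc)
  qed
  show ?thesis
    unfolding sys_transforms_companion_iff[OF \<phi>] e' F_def[symmetric] mult_cancel_left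
    using F by (simp add: a_def b_def c_def d_def delta_op_def add_ac del: power_Suc)
qed

text \<open>For y = s (z o \<phi>), r = 1 / s and i = 1 / e, one has z o \<phi> = r y and
  (\<delta>z) o \<phi> = i \<delta>(r y). These are the rows of T; U expresses y and \<delta>y in
  turn.\<close>

lemma pullback_imp_sys_transforms:
  assumes P: "eq_pullback \<nu> p q p' q' \<phi> s"
  obtains T U where "sys_transforms (sys_B \<nu> (companion p q)) (sys_B \<nu> (companion p' q')) \<phi> T"
    "T ** U = mat 1" "U ** T = mat 1"
    "fps_conv_radius \<phi> > 0 \<Longrightarrow> fps_conv_radius s > 0 \<Longrightarrow>
       (\<forall>i j. fps_conv_radius (entry T i j) > 0) \<and> (\<forall>i j. fps_conv_radius (entry U i j) > 0)"
proof -
  have \<phi>: "\<phi> $ 0 = 0" "\<phi> $ 1 \<noteq> 0" and s0: "s $ 0 \<noteq> 0" using P by (simp_all add: eq_pullback_def)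
  obtain e where e: "delta_op \<nu> \<phi> = \<phi> ^ Suc \<nu> * e" and e0: "e $ 0 \<noteq> 0"
    and an: "fps_conv_radius \<phi> > 0 \<Longrightarrow> fps_conv_radius e > 0"
    using delta_op_unit[OF \<phi>] by blast
  obtain e' where "delta_op \<nu> \<phi> = \<phi> ^ Suc \<nu> * e'"
    and p': "e' * s * p = 2 * e' * delta_op \<nu> s + s * delta_op \<nu> e' + s * e'\<^sup>2 * (p' oo \<phi>)"
    and q': "s * q = delta_op \<nu> (delta_op \<nu> s) + s * e'\<^sup>2 * (q' oo \<phi>) - p * delta_op \<nu> s"
    using P unfolding eq_pullback_def by blast
  moreover have "\<phi> ^ Suc \<nu> \<noteq> 0" using \<phi> by auto
  ultimately have "e' = e" using e by simp
  note p = p'[unfolded this] and q = q'[unfolded this]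
  define r i where "r = inverse s" and "i = inverse e"
  have rs: "s * r = 1" and ei: "e * i = 1"
    unfolding r_def i_def using s0 e0 by (auto intro: inverse_mult_eq_1')
  have ne: "s \<noteq> 0" "e \<noteq> 0" using s0 e0 by auto
  have "delta_op \<nu> (s * r) = 0" "delta_op \<nu> (e * i) = 0" unfolding rs ei by simp_all
  then have dr: "s * delta_op \<nu> r = - (r * delta_op \<nu> s)" and di: "e * delta_op \<nu> i = - (i * delta_op \<nu> e)"
    by (simp_all add: delta_op_mult eq_neg_iff_add_eq_0 mult.commute add.commute)
  define T :: "complex fps ^ 2 ^ 2" where "T = vector [vector [r, 0], vector [i * delta_op \<nu> r, i * r]]"
  define U :: "complex fps ^ 2 ^ 2" where "U = vector [vector [s, 0], vector [delta_op \<nu> s, s * e]]"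
  have T: "entry T 1 1 = r" "entry T 1 2 = 0" "entry T 2 1 = i * delta_op \<nu> r" "entry T 2 2 = i * r"
    and U: "entry U 1 1 = s" "entry U 1 2 = 0" "entry U 2 1 = delta_op \<nu> s" "entry U 2 2 = s * e"
    by (simp_all add: T_def U_def)
  have TU: "i * delta_op \<nu> r * s + i * r * delta_op \<nu> s = 0"
    using arg_cong[OF dr, of "\<lambda>g. i * g"] by (simp add: mult_ac)
  have "T ** U = mat 1"
    unfolding vec_eq_iff forall_2 matrix_matrix_mult_def vec_lambda_beta sum_2 mat_def T U
    using rs ei TU by (simp add: mult_ac)
  moreover have "U ** T = mat 1"
  proof -
    have "s * r + 0 * (i * delta_op \<nu> r) = 1" using rs by simp
    moreover have "delta_op \<nu> s * r + s * e * (i * delta_op \<nu> r) = delta_op \<nu> s * r + (e * i) * (s * delta_op \<nu> r)"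
      by (simp only: mult_ac)
    then have "delta_op \<nu> s * r + s * e * (i * delta_op \<nu> r) = 0" unfolding ei dr by simp
    moreover have "s * e * (i * r) = (s * r) * (e * i)" by (simp only: mult_ac)
    then have "s * e * (i * r) = 1" unfolding rs ei by simp
    ultimately show ?thesis
      unfolding vec_eq_iff forall_2 matrix_matrix_mult_def vec_lambda_beta sum_2 mat_def T U by simp
  qed
  moreover have "sys_transforms (sys_B \<nu> (companion p q)) (sys_B \<nu> (companion p' q')) \<phi> T"
    unfolding sys_transforms_companion_delta[OF \<phi> e] T
  proof (intro conjI)
    define P Q where "P = p' oo \<phi>" and "Q = q' oo \<phi>"
    have cancel: "e * (i * z) = z" "i * (e * z) = z" "s * (r * z) = z" "r * (s * z) = z" "i * e = 1" "r * s = 1" for z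
      using ei rs by (simp_all add: mult.commute flip: mult.assoc)
    have "r * (s * delta_op \<nu> r) = r * - (r * delta_op \<nu> s)" "i * (e * delta_op \<nu> i) = i * - (i * delta_op \<nu> e)"
      unfolding dr di by simp_all
    then have dr: "delta_op \<nu> r = - (r * r * delta_op \<nu> s)" and di: "delta_op \<nu> i = - (i * i * delta_op \<nu> e)"
      by (simp_all add: cancel mult.assoc)
    have ddr: "delta_op \<nu> (delta_op \<nu> r) = 2 * r * r * r * delta_op \<nu> s * delta_op \<nu> s - r * r * delta_op \<nu> (delta_op \<nu> s)"
      by (simp add: dr delta_op_uminus delta_op_mult algebra_simps)
    have H: "e * P = p - i * delta_op \<nu> e - 2 * r * delta_op \<nu> s"
    proof -
      have "e * s * (e * P) = e * s * p - s * delta_op \<nu> e - 2 * e * delta_op \<nu> s"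
        unfolding p by (simp add: P_def power2_eq_square mult_ac)
      also have "\<dots> = e * s * p - s * (e * i) * delta_op \<nu> e - 2 * e * (s * r) * delta_op \<nu> s"
        unfolding ei rs by simp
      also have "\<dots> = e * s * (p - i * delta_op \<nu> e - 2 * r * delta_op \<nu> s)"
        by (simp add: algebra_simps)
      finally show ?thesis using ne by simp
    qed
    have "r * (s * q) = r * (delta_op \<nu> (delta_op \<nu> s) - p * delta_op \<nu> s) + (r * s) * (e * e * Q)"
      unfolding q by (simp add: Q_def algebra_simps power2_eq_square)
    then have q2: "q = r * (delta_op \<nu> (delta_op \<nu> s) - p * delta_op \<nu> s) + e * e * Q"
      by (simp add: cancel)
    show "e * (i * delta_op \<nu> r) = delta_op \<nu> r + 0 * q" "e * (i * r) = r + delta_op \<nu> 0 + 0 * p"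
      by (simp_all add: cancel)
    have "delta_op \<nu> (i * delta_op \<nu> r) + i * r * q
      = i * r * (e * e * Q) - i * r * r * delta_op \<nu> s * (p - i * delta_op \<nu> e - 2 * r * delta_op \<nu> s)"
      unfolding delta_op_mult ddr di by (subst q2) (simp add: dr algebra_simps)
    also have "\<dots> = (i * e) * (r * (e * Q) - r * r * delta_op \<nu> s * P)"
      unfolding H[symmetric] by (simp add: algebra_simps)
    also have "\<dots> = e * Q * r + (e * i) * P * delta_op \<nu> r"
      unfolding ei cancel by (simp add: dr algebra_simps)
    finally show "e * ((q' oo \<phi>) * r + (p' oo \<phi>) * (i * delta_op \<nu> r)) = delta_op \<nu> (i * delta_op \<nu> r) + i * r * q"
      unfolding P_def[symmetric] Q_def[symmetric] by (simp add: algebra_simps)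
    have "delta_op \<nu> (i * r) + i * delta_op \<nu> r + i * r * p = i * r * (p - i * delta_op \<nu> e - 2 * r * delta_op \<nu> s)"
      by (simp add: delta_op_mult dr di algebra_simps)
    also have "\<dots> = e * (Q * 0 + P * (i * r))" unfolding H[symmetric] by (simp add: algebra_simps)
    finally show "e * ((q' oo \<phi>) * 0 + (p' oo \<phi>) * (i * r)) = delta_op \<nu> (i * r) + i * delta_op \<nu> r + i * r * p"
      unfolding P_def[symmetric] Q_def[symmetric] by simp
  qed
  moreover have "(\<forall>i j. fps_conv_radius (entry T i j) > 0) \<and> (\<forall>i j. fps_conv_radius (entry U i j) > 0)"
    if "fps_conv_radius \<phi> > 0" "fps_conv_radius s > 0"
  proof -
    have "fps_conv_radius e > 0" "fps_conv_radius r > 0" "fps_conv_radius i > 0"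
      unfolding r_def i_def using an that s0 e0 by (auto intro: fps_conv_radius_inverse_pos)
    then show ?thesis
      unfolding forall_2 T U using that by (auto intro!: fps_conv_radius_pos_intros)
  qed
  ultimately show ?thesis using that by blast
qed

lemma sys_transforms_imp_pullback:
  fixes T :: "complex fps ^ 2 ^ 2"
  assumes \<phi>: "\<phi> $ 0 = 0" "\<phi> $ 1 \<noteq> 0"
    and D: "(entry T 1 1 * entry T 2 2 - entry T 1 2 * entry T 2 1) $ 0 \<noteq> 0"
    and tr: "sys_transforms (sys_B \<nu> (companion p q)) (sys_B \<nu> (companion p' q')) \<phi> T"
  obtains \<psi> s where "eq_pullback \<nu> p q p' q' \<psi> s"
    "fps_conv_radius p' > 0 \<Longrightarrow> fps_conv_radius q' > 0 \<Longrightarrow> fps_conv_radius \<phi> > 0 \<Longrightarrow>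
     (\<forall>i j. fps_conv_radius (entry T i j) > 0) \<Longrightarrow> fps_conv_radius p > 0 \<Longrightarrow> fps_conv_radius q > 0 \<Longrightarrow>
     fps_conv_radius \<psi> > 0 \<and> fps_conv_radius s > 0"
proof -
  obtain e where e: "delta_op \<nu> \<phi> = \<phi> ^ Suc \<nu> * e" and e0: "e $ 0 \<noteq> 0"
    and an_e: "fps_conv_radius \<phi> > 0 \<Longrightarrow> fps_conv_radius e > 0"
    using delta_op_unit[OF \<phi>] by blast
  have ei: "e * inverse e = 1" using e0 by (rule inverse_mult_eq_1')
  define P Q where "P = p' oo \<phi>" and "Q = q' oo \<phi>"
  \<comment> \<open>The coefficients obtained by solving the equations of \<open>eq_pullback\<close>
    with s = 1, that is, the second equation pulled back along \<phi> alone.\<close>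
  define p2 q2 where "p2 = (delta_op \<nu> e + e\<^sup>2 * P) * inverse e" and "q2 = e\<^sup>2 * Q"
  have "e * p2 = (delta_op \<nu> e + e\<^sup>2 * P) * (e * inverse e)" by (simp add: p2_def mult_ac)
  then have p2: "e * p2 = delta_op \<nu> e + e\<^sup>2 * P" unfolding ei by simp
  have P2: "eq_pullback \<nu> p2 q2 p' q' \<phi> 1"
    unfolding eq_pullback_def using \<phi> e p2 by (auto simp: q2_def P_def Q_def)
  define a b c d where "a = entry T 1 1" and "b = entry T 1 2" and "c = entry T 2 1" and "d = entry T 2 2"
  note eqs = tr[unfolded sys_transforms_companion_delta[OF \<phi> e],
      folded P_def Q_def a_def b_def c_def d_def]
  have c: "delta_op \<nu> a + b * q = e * c" and d: "a + delta_op \<nu> b + b * p = e * d"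
    and c': "delta_op \<nu> c + d * q = e * (Q * a + P * c)" and d': "delta_op \<nu> d + c + d * p = e * (Q * b + P * d)"
    using eqs by simp_all
  define D where "D = a * (e * d) - b * (e * c)"
  have D': "D = e * (a * d - b * c)" by (simp add: D_def algebra_simps)
  have D0: "D $ 0 \<noteq> 0"
    using \<open>(entry T 1 1 * entry T 2 2 - entry T 1 2 * entry T 2 1) $ 0 \<noteq> 0\<close> e0
    unfolding D' a_def[symmetric] b_def[symmetric] c_def[symmetric] d_def[symmetric] by (simp add: fps_mult_nth_0)
  \<comment> \<open>The second row of T is multiplied by e, since it describes (\<delta>z) o \<phi>
    and not \<delta>(z o \<phi>).\<close>
  have G1: "eq_gauge \<nu> p2 q2 p q a b"
    unfolding eq_gauge_def Let_def c d
  proof (intro conjI)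
    have "delta_op \<nu> (e * c) + e * d * q = delta_op \<nu> e * c + e * (delta_op \<nu> c + d * q)"
      by (simp add: delta_op_mult algebra_simps)
    also have "\<dots> = q2 * a + (e * p2) * c" unfolding c' p2 by (simp add: q2_def algebra_simps power2_eq_square)
    finally show "delta_op \<nu> (e * c) + e * d * q = q2 * a + p2 * (e * c)" by (simp add: mult_ac)
    have "delta_op \<nu> (e * d) + e * c + e * d * p = delta_op \<nu> e * d + e * (delta_op \<nu> d + c + d * p)"
      by (simp add: delta_op_mult algebra_simps)
    also have "\<dots> = q2 * b + (e * p2) * d" unfolding d' p2 by (simp add: q2_def algebra_simps power2_eq_square)
    finally show "delta_op \<nu> (e * d) + e * c + e * d * p = q2 * b + p2 * (e * d)" by (simp add: mult_ac)
    show "(a * (e * d) - b * (e * c)) $ 0 \<noteq> 0" using D0 by (simp add: D_def)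
  qed
  \<comment> \<open>The first row of the inverse gauge matrix. \<open>G1\<close> expresses solutions
    for p2, q2 by those for p, q, whereas the opposite direction is wanted; it arises by dividing
    the identity gauge (1, 0).\<close>
  define u v where "u = e * d * inverse D" and "v = - b * inverse D"
  have Di: "D * inverse D = 1" using D0 by (rule inverse_mult_eq_1')
  have "eq_gauge \<nu> p q p q 1 0" by (simp add: eq_gauge_def)
  then have G: "eq_gauge \<nu> p q p2 q2 u v"
  proof (rule eq_gauge_cancel[OF _ G1])
    have "u * a + v * (e * c) = D * inverse D" by (simp add: u_def v_def D_def algebra_simps)
    then show "1 = u * a + v * (delta_op \<nu> a + b * q)" unfolding c Di by simp
    show "0 = u * b + v * (a + delta_op \<nu> b + b * p)" unfolding d by (simp add: u_def v_def algebra_simps)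
  qed
  obtain \<psi> s where PG: "eq_pullback \<nu> p q p2 q2 \<psi> s"
    and an: "fps_conv_radius p2 > 0 \<Longrightarrow> fps_conv_radius q2 > 0 \<Longrightarrow> fps_conv_radius u > 0 \<Longrightarrow> fps_conv_radius v > 0 \<Longrightarrow>
       fps_conv_radius \<psi> > 0 \<and> fps_conv_radius s > 0"
    using gauge_imp_pullback[OF G] by blast
  have "fps_conv_radius (\<phi> oo \<psi>) > 0 \<and> fps_conv_radius (s * (1 oo \<psi>)) > 0"
    if r: "fps_conv_radius p' > 0" "fps_conv_radius q' > 0" "fps_conv_radius \<phi> > 0"
      "\<forall>i j. fps_conv_radius (entry T i j) > 0" "fps_conv_radius p > 0" "fps_conv_radius q > 0"
  proof -
    have e: "fps_conv_radius e > 0" using an_e r by blast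
    have abcd: "fps_conv_radius a > 0" "fps_conv_radius b > 0" "fps_conv_radius c > 0" "fps_conv_radius d > 0"
      using r by (simp_all add: a_def b_def c_def d_def)
    have PQ: "fps_conv_radius P > 0" "fps_conv_radius Q > 0"
      unfolding P_def Q_def using r \<phi> by (auto intro: fps_conv_radius_compose_pos)
    have "fps_conv_radius D > 0" unfolding D_def using e abcd by (intro fps_conv_radius_pos_intros)
    then have "fps_conv_radius (inverse D) > 0" "fps_conv_radius (inverse e) > 0"
      using D0 e0 e by (auto intro: fps_conv_radius_inverse_pos)
    moreover have "fps_conv_radius (- b) > 0" using abcd by simp
    ultimately have "fps_conv_radius p2 > 0" "fps_conv_radius q2 > 0" "fps_conv_radius u > 0" "fps_conv_radius v > 0"
      unfolding p2_def q2_def u_def v_def using e PQ abcd by (auto intro!: fps_conv_radius_pos_intros)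
    then have "fps_conv_radius \<psi> > 0" "fps_conv_radius s > 0" using an by auto
    moreover have "\<psi> $ 0 = 0" using PG by (simp add: eq_pullback_def)
    ultimately show ?thesis using r by (auto intro: fps_conv_radius_compose_pos)
  qed
  with eq_pullback_trans[OF PG P2] that show ?thesis by blast
qed

theorem theoremA:
  fixes \<nu> \<mu> :: nat and p q p' q' :: "complex fps"
  assumes "is_rank_form \<nu> p q"
      and "regular_sing \<nu> \<or> nondeg_irregular_sing \<nu> p q"
      and "is_rank_form \<mu> p' q'"
      and "regular_sing \<mu> \<or> nondeg_irregular_sing \<mu> p' q'"
  shows "(eq_analytically_equiv \<nu> p q \<mu> p' q' \<longleftrightarrow>
            sys_analytically_equiv \<nu> (companion p q) \<mu> (companion p' q')) \<and>
         (eq_formally_equiv \<nu> p q \<mu> p' q' \<longleftrightarrow>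
            sys_formally_equiv \<nu> (companion p q) \<mu> (companion p' q'))"
proof -
  note R = assms(1,3)
  have an: "fps_conv_radius p > 0" "fps_conv_radius q > 0" "fps_conv_radius p' > 0" "fps_conv_radius q' > 0"
    using R by (simp_all add: is_rank_form_def)
  \<comment> \<open>The formal and the analytic case share one construction: convergence is an
    implication carried along with it.\<close>
  have eq_to_sys: "\<exists>T U. sys_transforms (sys_B \<nu> (companion p q)) (sys_B \<mu> (companion p' q')) \<phi> T \<and>
      T ** U = mat 1 \<and> U ** T = mat 1 \<and>
      (fps_conv_radius \<phi> > 0 \<longrightarrow> fps_conv_radius t > 0 \<longrightarrow>
        (\<forall>i j. fps_conv_radius (entry T i j) > 0) \<and> (\<forall>i j. fps_conv_radius (entry U i j) > 0))"
    if \<phi>: "formal_point_transf \<phi> t"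
      and tr: "eq_transforms (eq_a1 \<nu> p) (eq_a0 \<nu> q) (eq_a1 \<mu> p') (eq_a0 \<mu> q') \<phi> t" for \<phi> t
  proof -
    have \<phi>: "\<phi> $ 0 = 0" "\<phi> $ 1 \<noteq> 0" "t $ 0 \<noteq> 0" using \<phi> by (simp_all add: formal_point_transf_def)
    have \<mu>: "\<nu> = \<mu>" by (rule eq_transforms_rank[OF R \<phi> tr])
    have "eq_pullback \<nu> p q p' q' \<phi> (inverse t)"
      using tr unfolding \<mu>[symmetric] eq_transforms_iff_pullback[OF \<phi>] .
    from pullback_imp_sys_transforms[OF this] obtain T U where
      "sys_transforms (sys_B \<nu> (companion p q)) (sys_B \<nu> (companion p' q')) \<phi> T"
      "T ** U = mat 1" "U ** T = mat 1"
      "fps_conv_radius \<phi> > 0 \<Longrightarrow> fps_conv_radius (inverse t) > 0 \<Longrightarrow>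
       (\<forall>i j. fps_conv_radius (entry T i j) > 0) \<and> (\<forall>i j. fps_conv_radius (entry U i j) > 0)" by blast
    moreover have "fps_conv_radius t > 0 \<longrightarrow> fps_conv_radius (inverse t) > 0"
      using \<phi>(3) fps_conv_radius_inverse_pos by blast
    ultimately show ?thesis unfolding \<mu>[symmetric] by blast
  qed
  have sys_to_eq: "\<exists>\<psi> t. formal_point_transf \<psi> t \<and>
      eq_transforms (eq_a1 \<nu> p) (eq_a0 \<nu> q) (eq_a1 \<mu> p') (eq_a0 \<mu> q') \<psi> t \<and>
      (fps_conv_radius \<phi> > 0 \<longrightarrow> (\<forall>i j. fps_conv_radius (entry T i j) > 0) \<longrightarrow>
        fps_conv_radius \<psi> > 0 \<and> fps_conv_radius t > 0)"
    if \<phi>: "\<phi> $ 0 = 0" "\<phi> $ 1 \<noteq> 0" and TU: "T ** U = mat 1"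
      and tr: "sys_transforms (sys_B \<nu> (companion p q)) (sys_B \<mu> (companion p' q')) \<phi> T" for \<phi> T U
  proof -
    note D = gauge_det_nonzero[OF TU]
    have \<mu>: "\<nu> = \<mu>" by (rule sys_transforms_rank[OF \<phi> D tr])
    obtain \<psi> s where P: "eq_pullback \<nu> p q p' q' \<psi> s"
      and r: "fps_conv_radius p' > 0 \<Longrightarrow> fps_conv_radius q' > 0 \<Longrightarrow> fps_conv_radius \<phi> > 0 \<Longrightarrow>
       (\<forall>i j. fps_conv_radius (entry T i j) > 0) \<Longrightarrow> fps_conv_radius p > 0 \<Longrightarrow> fps_conv_radius q > 0 \<Longrightarrow>
       fps_conv_radius \<psi> > 0 \<and> fps_conv_radius s > 0"
      using sys_transforms_imp_pullback[OF \<phi> D] tr unfolding \<mu>[symmetric] by blast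
    have \<psi>: "\<psi> $ 0 = 0" "\<psi> $ 1 \<noteq> 0" and s: "s $ 0 \<noteq> 0" using P by (simp_all add: eq_pullback_def)
    have t: "inverse s $ 0 \<noteq> 0" "inverse (inverse s) = s" using s by (simp_all add: fps_inverse_idempotent)
    have "eq_transforms (eq_a1 \<nu> p) (eq_a0 \<nu> q) (eq_a1 \<mu> p') (eq_a0 \<mu> q') \<psi> (inverse s)"
      unfolding \<mu>[symmetric] eq_transforms_iff_pullback[OF \<psi> t(1)] t(2) by (rule P)
    moreover have "formal_point_transf \<psi> (inverse s)"
      using \<psi> t by (simp add: formal_point_transf_def)
    moreover have "fps_conv_radius s > 0 \<longrightarrow> fps_conv_radius (inverse s) > 0"
      using s fps_conv_radius_inverse_pos by blast
    ultimately show ?thesis using r an by blast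
  qed
  show ?thesis
    unfolding eq_analytically_equiv_def sys_analytically_equiv_def eq_formally_equiv_def sys_formally_equiv_def
      analytic_point_transf_def analytic_gauge_def formal_gauge_def
  proof (intro conjI iffI; elim exE conjE)
    fix \<phi> t
    assume "formal_point_transf \<phi> t" "fps_conv_radius \<phi> > 0" "fps_conv_radius t > 0"
      "eq_transforms (eq_a1 \<nu> p) (eq_a0 \<nu> q) (eq_a1 \<mu> p') (eq_a0 \<mu> q') \<phi> t"
    with eq_to_sys[of \<phi> t] show "\<exists>\<phi> T. (\<phi> $ 0 = 0 \<and> \<phi> $ 1 \<noteq> 0 \<and> fps_conv_radius \<phi> > 0 \<and>
        (\<forall>i j. fps_conv_radius (entry T i j) > 0) \<and>
        (\<exists>U. T ** U = mat 1 \<and> U ** T = mat 1 \<and> (\<forall>i j. fps_conv_radius (entry U i j) > 0))) \<and>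
        sys_transforms (sys_B \<nu> (companion p q)) (sys_B \<mu> (companion p' q')) \<phi> T"
      unfolding formal_point_transf_def by blast
  next
    fix \<phi> T U
    assume "\<phi> $ 0 = 0" "\<phi> $ 1 \<noteq> 0" "fps_conv_radius \<phi> > 0"
      "\<forall>i j. fps_conv_radius (entry T i j) > 0" "T ** U = mat 1"
      "sys_transforms (sys_B \<nu> (companion p q)) (sys_B \<mu> (companion p' q')) \<phi> T"
    with sys_to_eq[of \<phi> T U] show "\<exists>\<phi> t. (formal_point_transf \<phi> t \<and> fps_conv_radius \<phi> > 0 \<and> fps_conv_radius t > 0) \<and>
        eq_transforms (eq_a1 \<nu> p) (eq_a0 \<nu> q) (eq_a1 \<mu> p') (eq_a0 \<mu> q') \<phi> t"
      by blast
  next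
    fix \<phi> t
    assume "formal_point_transf \<phi> t" "eq_transforms (eq_a1 \<nu> p) (eq_a0 \<nu> q) (eq_a1 \<mu> p') (eq_a0 \<mu> q') \<phi> t"
    with eq_to_sys[of \<phi> t] show "\<exists>\<phi> T. (\<phi> $ 0 = 0 \<and> \<phi> $ 1 \<noteq> 0 \<and> (\<exists>U. T ** U = mat 1 \<and> U ** T = mat 1)) \<and>
        sys_transforms (sys_B \<nu> (companion p q)) (sys_B \<mu> (companion p' q')) \<phi> T"
      unfolding formal_point_transf_def by blast
  next
    fix \<phi> T U
    assume "\<phi> $ 0 = 0" "\<phi> $ 1 \<noteq> 0" "T ** U = mat 1"
      "sys_transforms (sys_B \<nu> (companion p q)) (sys_B \<mu> (companion p' q')) \<phi> T"
    with sys_to_eq[of \<phi> T U] show "\<exists>\<phi> t. formal_point_transf \<phi> t \<and>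
        eq_transforms (eq_a1 \<nu> p) (eq_a0 \<nu> q) (eq_a1 \<mu> p') (eq_a0 \<mu> q') \<phi> t"
      by blast
  qed
qed

end
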